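(* Let $(G,(J_v)_{v\in V},(O_v)_{v\in V},(T_e)_{e\in E})$ be a simple GIFS which is conformal and satisfies bounded distortion, $V$-summability, and contractibility of the sets $J_v$. Assume also that either the strong separation condition or the open set condition holds. Let $\varphi:=\varphi^V$ $(=\underline{\varphi}^V)$. Then for every real $s\ge 0$, $\dim_H K=s$ if and only if $P(s\varphi)=0$. In particular, $\dim_H K=\max_{G_0}\dim_H K(G_0)$, where the maximum is taken over all strongly connected components $G_0=(V_0,E_0)$ of $G$ and $K(G_0)$ denotes the limit set of the subsystem $(G_0,(J_v)_{v\in V_0},(O_v)_{v\in V_0},(T_e)_{e\in E_0})$.
   Context: Fix an integer $D\ge 1$; $|\cdot|$ is the Euclidean norm on $\mathbb{R}^D$, $\|\cdot\|$ the operator norm, $\|M\|_i:=\|M^{-1}\|^{-1}$ for an invertible matrix $M$, $\dim_H$ the Hausdorff dimension. Conventions: suprema of nonnegative quantities over empty sets are $0$, $\log 0=-\infty$. A GIFS is a system $(G,(J_v)_{v\in V},(O_v)_{v\in V},(T_e)_{e\in E})$ such that: (1) $G=(V,E,i,t)$ is a directed multigraph with countable (finite or infinite) vertex set $V$ and countable edge set $E$, where $i(e),t(e)\in V$ are the initial and terminal vertices of $e\in E$; (2) each $J_v\subset\mathbb{R}^D$ is compact and connected, equals the closure of its interior, and $\sup_v\operatorname{diam}(J_v)<\infty$; (3) each $O_v\subset\mathbb{R}^D$ is bounded, open and connected, and $\inf_v\operatorname{dist}(J_v,\mathbb{R}^D\setminus O_v)>0$; (4) each $T_e$ is a $C^1$-diffeomorphism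 from $O_{t(e)}$ onto an open subset of $O_{i(e)}$ with $T_e(J_{t(e)})\subset J_{i(e)}$, and there is $r\in(0,1)$ with $\sup_{e\in E}\sup_{x\in O_{t(e)}}\|T_e'(x)\|\le r$. The GIFS is simple if for all $v,u\in V$ there is at most one edge from $v$ to $u$; then $E\subset V\times V$, and the edge from $v$ to $u$ is written $vu$, with map $T_{vu}:O_u\to O_v$. No connectivity of $G$ is assumed. A subgraph $G_0=(V_0,E_0)$ of $G$ is strongly connected if for any $v,u\in V_0$ there is a path of positive length in $G_0$ from $v$ to $u$. A strongly connected component is a strongly connected subgraph $G_0$ such that every strongly connected subgraph $G_1$ containing $G_0$ as a subgraph equals $G_0$. For a simple GIFS let $X=\{\omega=\omega_0\omega_1\cdots\in V^{\mathbb{Z}_{\ge0}}:\omega_n\omega_{n+1}\in E\ \text{for all } n\ge 0\}$, let $\sigma$ be the shift $(\sigma\omega)_n=\omega_{n+1}$, define $\pi:X\to\mathbb{R}^D$ by $\{\pi\omega\}=\bigcap_{k\ge0}T_{\omega_0\omega_1}\circ\cdots\circ T_{\omega_k\omega_{k+1}}(J_{\omega_{k+1}})$, and let $K=\pi(X)$ be the limit set. Put $\varphi^V(\omega)=\log\|T_{\omega_0\omega_1}'(\pi\sigma\omega)\|$ and $\underline{\varphi}^V(\omega)=\log\|T_{\omega_0\omega_1}'(\pi\sigma\omega)\|_i$ for $\omega\in X$ (these coincide in the conformal case). For a real function $f$ on $X$ the topological pressure is $P(f)=\lim_{n\to\infty}\frac1n\log\sum_{w\in V^n:[w]\ne\emptyset}\exp(\sup_{\omega\in[w]}\sum_{i=0}^{n-1}f(\sigma^i\omega))$,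 where $[w]=\{\omega\in X:\omega_0\cdots\omega_{n-1}=w\}$. Conformal: each $T_e$ is conformal. Strong separation condition: $T_e(J_{t(e)}\cap K)\cap T_{e'}(J_{t(e')}\cap K)=\emptyset$ for all $e\ne e'$ in $E$. Open set condition: $T_e(\operatorname{int}J_{t(e)})\cap T_{e'}(\operatorname{int}J_{t(e')})=\emptyset$ for all $e\ne e'$ in $E$. Bounded distortion: there exist $c_1>0$ and $0<\beta\le1$ such that $\big|\|T_e'(x)\|-\|T_e'(y)\|\big|\le c_1\|T_e'(x)\|\,|x-y|^\beta$ for all $e\in E$ and $x,y\in O_{t(e)}$. $V$-summability: there exists $s\in\underline{I}^V$ with $P(s\underline{\varphi}^V)=0$, where $\underline{I}^V=\{s\ge0:\sum_{v\in V}\sup_{u\in V:\,vu\in E}\sup_{x\in K\cap J_u}\|T_{vu}'(x)\|_i^s<\infty\}$. Contractibility of the sets $J_v$: there exists $c_2>0$ such that $\operatorname{diam}J_v\le c_2\sup_{e\in E:\,i(e)=v}\sup_{z\in J_{t(e)}}\|T_e'(z)\|$ for every $v\in V$. *)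

theory Defs
  imports
    "HOL-Analysis.Analysis"
    "Graph_Theory.Digraph_Component"
begin

section \<open>Hausdorff dimension\<close>

text \<open>
  \<open>0 powr 0 = 0\<close> in HOL, whereas a nonempty set has to contribute \<open>1\<close> to the
  \<open>0\<close>-dimensional Hausdorff measure, hence the case distinction.
\<close>

definition diam_power :: "real \<Rightarrow> 'a::metric_space set \<Rightarrow> ennreal" where
  "diam_power s A = (if A = {} then 0 else if s = 0 then 1 else ennreal (diameter A powr s))"

definition hausdorff_premeasure :: "real \<Rightarrow> real \<Rightarrow> 'a::metric_space set \<Rightarrow> ennreal" where
  "hausdorff_premeasure s \<delta> A =
     (INF C \<in> {C :: nat \<Rightarrow> 'a set.
                 A \<subseteq> (\<Union>n. C n) \<and> (\<forall>n. bounded (C n) \<and> diameter (C n) \<le> \<delta>)}.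
        \<Sum>n. diam_power s (C n))"

definition hausdorff_measure :: "real \<Rightarrow> 'a::metric_space set \<Rightarrow> ennreal" where
  "hausdorff_measure s A = (SUP \<delta> \<in> {0<..}. hausdorff_premeasure s \<delta> A)"

definition hausdorff_dim :: "'a::metric_space set \<Rightarrow> ereal" where
  "hausdorff_dim A = Inf {ereal s |s. 0 \<le> s \<and> hausdorff_measure s A = 0}"

section \<open>Derivatives\<close>

definition C1_on :: "('a::real_normed_vector \<Rightarrow> 'b::real_normed_vector) \<Rightarrow> 'a set \<Rightarrow> bool" where
  "C1_on f S \<longleftrightarrow>
     (\<exists>f' :: 'a \<Rightarrow> 'a \<Rightarrow>\<^sub>L 'b. continuous_on S f' \<and>
        (\<forall>x\<in>S. (f has_derivative blinfun_apply (f' x)) (at x)))"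

definition C1_diffeomorphism ::
    "('a::real_normed_vector \<Rightarrow> 'b::real_normed_vector) \<Rightarrow> 'a set \<Rightarrow> 'b set \<Rightarrow> bool" where
  "C1_diffeomorphism f S W \<longleftrightarrow>
     open S \<and> open W \<and> (\<exists>g. homeomorphism S W f g \<and> C1_on f S \<and> C1_on g W)"

abbreviation dnorm :: "('a::real_normed_vector \<Rightarrow> 'a) \<Rightarrow> 'a \<Rightarrow> real" where
  "dnorm f x \<equiv> onorm (frechet_derivative f (at x))"

text \<open>The quantity \<open>\<parallel>M\<parallel>\<^sub>i = \<parallel>M\<^sup>-\<^sup>1\<parallel>\<^sup>-\<^sup>1\<close>, meant for invertible linear \<open>M\<close>.\<close>

definition inorm :: "('a::real_normed_vector \<Rightarrow> 'a) \<Rightarrow> real" where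
  "inorm M = inverse (onorm (inv M))"

abbreviation dinorm :: "('a::real_normed_vector \<Rightarrow> 'a) \<Rightarrow> 'a \<Rightarrow> real" where
  "dinorm f x \<equiv> inorm (frechet_derivative f (at x))"

definition conformal_on :: "('a::euclidean_space \<Rightarrow> 'a) \<Rightarrow> 'a set \<Rightarrow> bool" where
  "conformal_on f S \<longleftrightarrow>
     (\<forall>x\<in>S. \<exists>c>0. \<exists>Q. orthogonal_transformation Q \<and>
        (f has_derivative (\<lambda>h. c *\<^sub>R Q h)) (at x))"

section \<open>Graph iterated function systems\<close>

text \<open>
  The initial and terminal vertex of an edge \<open>e\<close> are \<open>tail G e\<close> and \<open>head G e\<close>.
  The sets \<open>O\<^sub>v\<close> are called \<open>U v\<close>, since \<open>O\<close> is reserved for relation composition.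
  Only the values of \<open>J\<close> and \<open>U\<close> on \<open>verts G\<close>, and of \<open>T e\<close> on \<open>U (head G e)\<close> for
  \<open>e \<in> arcs G\<close>, are meaningful.
\<close>

locale gifs = wf_digraph G
  for G :: "('v, 'e) pre_digraph" +
  fixes J U :: "'v \<Rightarrow> (real ^ 'n) set"
    and T :: "'e \<Rightarrow> real ^ 'n \<Rightarrow> real ^ 'n"
  assumes countable_verts: "countable (verts G)"
    and countable_arcs: "countable (arcs G)"
    and J_nonempty: "v \<in> verts G \<Longrightarrow> J v \<noteq> {}"
    and J_compact: "v \<in> verts G \<Longrightarrow> compact (J v)"
    and J_connected: "v \<in> verts G \<Longrightarrow> Topological_Spaces.connected (J v)"
    and J_regular: "v \<in> verts G \<Longrightarrow> J v = closure (interior (J v))"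
    and J_diameter: "bdd_above ((\<lambda>v. diameter (J v)) ` verts G)"
    and U_bounded: "v \<in> verts G \<Longrightarrow> bounded (U v)"
    and U_open: "v \<in> verts G \<Longrightarrow> open (U v)"
    and U_connected: "v \<in> verts G \<Longrightarrow> Topological_Spaces.connected (U v)"
    and J_in_U: "\<exists>\<delta>>0. \<forall>v\<in>verts G. \<delta> \<le> setdist (J v) (- U v)"
    and T_diffeomorphism: "e \<in> arcs G \<Longrightarrow>
          \<exists>W. open W \<and> W \<subseteq> U (tail G e) \<and> C1_diffeomorphism (T e) (U (head G e)) W"
    and T_J: "e \<in> arcs G \<Longrightarrow> T e ` J (head G e) \<subseteq> J (tail G e)"
    and T_contracting: "\<exists>r. 0 < r \<and> r < 1 \<and>
          (\<forall>e\<in>arcs G. \<forall>x\<in>U (head G e). dnorm (T e) x \<le> r)"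

text \<open>The map \<open>T\<^sub>v\<^sub>u\<close> of a simple system.\<close>

definition arc_map :: "('v, 'e) pre_digraph \<Rightarrow> ('e \<Rightarrow> 'a) \<Rightarrow> 'v \<Rightarrow> 'v \<Rightarrow> 'a" where
  "arc_map G T v u = T (THE e. e \<in> arcs G \<and> arc_to_ends G e = (v, u))"

definition path_space :: "('v, 'e) pre_digraph \<Rightarrow> (nat \<Rightarrow> 'v) set" where
  "path_space G = {\<omega>. \<forall>n. \<omega> n \<in> verts G \<and> (\<omega> n, \<omega> (Suc n)) \<in> arcs_ends G}"

definition shift :: "(nat \<Rightarrow> 'v) \<Rightarrow> nat \<Rightarrow> 'v" where
  "shift \<omega> = (\<lambda>n. \<omega> (Suc n))"

text \<open>
  \<open>path_map G T \<omega> n\<close> is the composition of the first \<open>n\<close> maps along \<open>\<omega>\<close>.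
\<close>

primrec path_map ::
    "('v, 'e) pre_digraph \<Rightarrow> ('e \<Rightarrow> 'a \<Rightarrow> 'a) \<Rightarrow> (nat \<Rightarrow> 'v) \<Rightarrow> nat \<Rightarrow> 'a \<Rightarrow> 'a" where
  "path_map G T \<omega> 0 = id"
| "path_map G T \<omega> (Suc n) = path_map G T \<omega> n \<circ> arc_map G T (\<omega> n) (\<omega> (Suc n))"

definition coding ::
    "('v, 'e) pre_digraph \<Rightarrow> ('v \<Rightarrow> 'a set) \<Rightarrow> ('e \<Rightarrow> 'a \<Rightarrow> 'a) \<Rightarrow> (nat \<Rightarrow> 'v) \<Rightarrow> 'a" where
  "coding G J T \<omega> = (THE x. {x} = (\<Inter>k. path_map G T \<omega> (Suc k) ` J (\<omega> (Suc k))))"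

definition limit_set ::
    "('v, 'e) pre_digraph \<Rightarrow> ('v \<Rightarrow> 'a set) \<Rightarrow> ('e \<Rightarrow> 'a \<Rightarrow> 'a) \<Rightarrow> 'a set" where
  "limit_set G J T = coding G J T ` path_space G"

definition phi_V ::
    "('v, 'e) pre_digraph \<Rightarrow> ('v \<Rightarrow> (real ^ 'n) set) \<Rightarrow> ('e \<Rightarrow> real ^ 'n \<Rightarrow> real ^ 'n)
      \<Rightarrow> (nat \<Rightarrow> 'v) \<Rightarrow> real" where
  "phi_V G J T \<omega> = ln (dnorm (arc_map G T (\<omega> 0) (\<omega> 1)) (coding G J T (shift \<omega>)))"

definition lower_phi_V ::
    "('v, 'e) pre_digraph \<Rightarrow> ('v \<Rightarrow> (real ^ 'n) set) \<Rightarrow> ('e \<Rightarrow> real ^ 'n \<Rightarrow> real ^ 'n)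
      \<Rightarrow> (nat \<Rightarrow> 'v) \<Rightarrow> real" where
  "lower_phi_V G J T \<omega> = ln (dinorm (arc_map G T (\<omega> 0) (\<omega> 1)) (coding G J T (shift \<omega>)))"

section \<open>Topological pressure\<close>

definition exp_ereal :: "ereal \<Rightarrow> ennreal" where
  "exp_ereal x = (case x of ereal r \<Rightarrow> ennreal (exp r) | PInfty \<Rightarrow> \<infinity> | MInfty \<Rightarrow> 0)"

definition ln_ennreal :: "ennreal \<Rightarrow> ereal" where
  "ln_ennreal x = (if x = 0 then - \<infinity> else if x = \<infinity> then \<infinity> else ereal (ln (enn2real x)))"

definition cylinder :: "('v, 'e) pre_digraph \<Rightarrow> 'v list \<Rightarrow> (nat \<Rightarrow> 'v) set" where
  "cylinder G w = {\<omega> \<in> path_space G. map \<omega> [0..<length w] = w}"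

definition partition_sum ::
    "('v, 'e) pre_digraph \<Rightarrow> ((nat \<Rightarrow> 'v) \<Rightarrow> real) \<Rightarrow> nat \<Rightarrow> ennreal" where
  "partition_sum G f n =
     (\<Sum>\<^sub>\<infinity>w \<in> {w. length w = n \<and> set w \<subseteq> verts G \<and> cylinder G w \<noteq> {}}.
        exp_ereal (SUP \<omega> \<in> cylinder G w. ereal (\<Sum>i<n. f ((shift ^^ i) \<omega>))))"

text \<open>
  \<open>has_pressure G f p\<close> says that the limit defining the pressure \<open>P(f)\<close> exists in
  \<open>[-\<infinity>, \<infinity>]\<close> and equals \<open>p\<close>. It is a relation because, over an infinite graph, the
  limit need not exist if \<open>f\<close> is not summable.
\<close>

definition has_pressure ::
    "('v, 'e) pre_digraph \<Rightarrow> ((nat \<Rightarrow> 'v) \<Rightarrow> real) \<Rightarrow> ereal \<Rightarrow> bool" where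
  "has_pressure G f p \<longleftrightarrow>
     (\<lambda>n. ereal (1 / real n) * ln_ennreal (partition_sum G f n)) \<longlonglongrightarrow> p"

section \<open>Conditions on the system\<close>

definition conformal_system ::
    "('v, 'e) pre_digraph \<Rightarrow> ('v \<Rightarrow> (real ^ 'n) set) \<Rightarrow> ('e \<Rightarrow> real ^ 'n \<Rightarrow> real ^ 'n) \<Rightarrow> bool" where
  "conformal_system G U T \<longleftrightarrow> (\<forall>e\<in>arcs G. conformal_on (T e) (U (head G e)))"

definition strong_separation ::
    "('v, 'e) pre_digraph \<Rightarrow> ('v \<Rightarrow> (real ^ 'n) set) \<Rightarrow> ('e \<Rightarrow> real ^ 'n \<Rightarrow> real ^ 'n) \<Rightarrow> bool" where
  "strong_separation G J T \<longleftrightarrow>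
     (\<forall>e\<in>arcs G. \<forall>e'\<in>arcs G. e \<noteq> e' \<longrightarrow>
        T e ` (J (head G e) \<inter> limit_set G J T) \<inter>
        T e' ` (J (head G e') \<inter> limit_set G J T) = {})"

definition open_set_condition ::
    "('v, 'e) pre_digraph \<Rightarrow> ('v \<Rightarrow> (real ^ 'n) set) \<Rightarrow> ('e \<Rightarrow> real ^ 'n \<Rightarrow> real ^ 'n) \<Rightarrow> bool" where
  "open_set_condition G J T \<longleftrightarrow>
     (\<forall>e\<in>arcs G. \<forall>e'\<in>arcs G. e \<noteq> e' \<longrightarrow>
        T e ` interior (J (head G e)) \<inter> T e' ` interior (J (head G e')) = {})"

definition bounded_distortion ::
    "('v, 'e) pre_digraph \<Rightarrow> ('v \<Rightarrow> (real ^ 'n) set) \<Rightarrow> ('e \<Rightarrow> real ^ 'n \<Rightarrow> real ^ 'n) \<Rightarrow> bool" where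
  "bounded_distortion G U T \<longleftrightarrow>
     (\<exists>c1>0. \<exists>\<beta>>0. \<beta> \<le> 1 \<and>
        (\<forall>e\<in>arcs G. \<forall>x\<in>U (head G e). \<forall>y\<in>U (head G e).
           \<bar>dnorm (T e) x - dnorm (T e) y\<bar> \<le> c1 * dnorm (T e) x * norm (x - y) powr \<beta>))"

text \<open>
  Suprema are taken in \<^typ>\<open>ennreal\<close>, where the supremum of the empty set is \<open>0\<close>.
\<close>

definition lower_I_V ::
    "('v, 'e) pre_digraph \<Rightarrow> ('v \<Rightarrow> (real ^ 'n) set) \<Rightarrow> ('e \<Rightarrow> real ^ 'n \<Rightarrow> real ^ 'n) \<Rightarrow> real set" where
  "lower_I_V G J T =
     {s. 0 \<le> s \<and>
        (\<Sum>\<^sub>\<infinity>v \<in> verts G. SUP u \<in> {u \<in> verts G. (v, u) \<in> arcs_ends G}.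
           SUP x \<in> limit_set G J T \<inter> J u. ennreal (dinorm (arc_map G T v u) x powr s)) < \<infinity>}"

definition V_summable ::
    "('v, 'e) pre_digraph \<Rightarrow> ('v \<Rightarrow> (real ^ 'n) set) \<Rightarrow> ('e \<Rightarrow> real ^ 'n \<Rightarrow> real ^ 'n) \<Rightarrow> bool" where
  "V_summable G J T \<longleftrightarrow>
     (\<exists>s \<in> lower_I_V G J T. has_pressure G (\<lambda>\<omega>. s * lower_phi_V G J T \<omega>) 0)"

definition contractible_seeds ::
    "('v, 'e) pre_digraph \<Rightarrow> ('v \<Rightarrow> (real ^ 'n) set) \<Rightarrow> ('e \<Rightarrow> real ^ 'n \<Rightarrow> real ^ 'n) \<Rightarrow> bool" where
  "contractible_seeds G J T \<longleftrightarrow>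
     (\<exists>c2>0. \<forall>v\<in>verts G. ennreal (diameter (J v)) \<le>
        ennreal c2 * (SUP e \<in> {e \<in> arcs G. tail G e = v}.
                        SUP z \<in> J (head G e). ennreal (dnorm (T e) z)))"

section \<open>Strongly connected components\<close>

text \<open>
  Unlike in the library's \<^const>\<open>strongly_connected\<close>, the paths must have positive length,
  so a single vertex without a loop does not count.
\<close>

definition pos_strongly_connected :: "('v, 'e) pre_digraph \<Rightarrow> bool" where
  "pos_strongly_connected H \<longleftrightarrow>
     verts H \<noteq> {} \<and> (\<forall>v\<in>verts H. \<forall>u\<in>verts H. v \<rightarrow>\<^sup>+\<^bsub>H\<^esub> u)"

definition strong_components :: "('v, 'e) pre_digraph \<Rightarrow> ('v, 'e) pre_digraph set" where
  "strong_components G = {H. pre_digraph.max_subgraph G pos_strongly_connected H}"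

end

theory Submission
  imports Defs "HOL-Library.Sublist"
begin

text \<open>
  Let \<open>s\<^sub>0\<close> be the exponent given by \<open>V\<close>-summability, so that \<open>P(s\<^sub>0 \<phi>) = 0\<close>, and write
  \<open>Z\<^sub>n(s)\<close> for the partition sum of \<open>s \<phi>\<close> over words of length \<open>n\<close>. Every map contracts at least
  by the factor \<open>r < 1\<close>, hence \<open>Z\<^sub>n(s') \<le> r powr ((s' - s) n) \<cdot> Z\<^sub>n(s)\<close> for \<open>s \<le> s'\<close>, and \<open>s\<^sub>0\<close> is the only zero
  of the pressure (\<open>pressure_zero_unique\<close>). So everything follows from two estimates:
  the limit set \<open>K\<close> has dimension at most \<open>s\<^sub>0\<close>, and some strong component of the graph has a
  limit set of dimension at least \<open>s\<^sub>0\<close>. Limit sets of components are subsets of \<open>K\<close>.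

  Upper bound (\<open>hausdorff_dim_limit_set_le\<close>). Cover \<open>K\<close> by the coded images of the cylinders
  \<open>[w]\<close> with \<open>|w| = n\<close>. Such an image lies in \<open>T\<^sub>w(J\<^sub>v)\<close>, where \<open>v\<close> is the last letter of \<open>w\<close>. Its
  diameter is at most a constant times \<open>\<parallel>T\<^sub>w'\<parallel>\<close> times the diameter of \<open>J\<^sub>v\<close>, and contractibility
  replaces the latter by the derivative of one more edge. Hence the sum of \<open>diam\<^sup>t\<close> over the
  cover is at most a constant times \<open>Z\<^sub>n(t)\<close>, which tends to \<open>0\<close> for \<open>t > s\<^sub>0\<close>.

  Lower bound. There is a vertex \<open>v\<close> at which the sums over loops, with exponent \<open>s\<^sub>0\<close>, do not
  decay exponentially (\<open>ex_nondecaying_loop_vertex\<close>). Indeed, by summability all vertices outside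
  some finite set \<open>F\<close> have total weight at most \<open>1/2\<close>, so words that avoid \<open>F\<close> have
  exponentially decaying sums. Adding the vertices of \<open>F\<close> one at a time, a word that
  visits the new vertex is split at its first and last visit into a word, a loop and a word.
  If all loop sums decayed, so would the sum over all words, against \<open>P(s\<^sub>0 \<phi>) = 0\<close>.

  For \<open>t < s\<^sub>0\<close> the loop sums at \<open>v\<close> with exponent \<open>t\<close> are then unbounded. Choose finitely many loops
  of one length with \<open>\<Sum> inf \<parallel>T\<^sub>y'\<parallel>\<^sup>t \<ge> 1\<close>, the infimum being taken over \<open>J\<^sub>v\<close>
  (\<open>ex_finite_loop_system\<close>). Loops at \<open>v\<close> can be concatenated freely, so they form an ordinary
  finite conformal iterated function system on \<open>J\<^sub>v\<close>. Either separation condition makes every ball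
  of radius \<open>\<rho>\<close> meet boundedly many pieces of size about \<open>\<rho>\<close>, and the classical mass distribution
  argument shows that the attractor has positive \<open>t\<close>-dimensional measure
  (\<open>hausdorff_measure_attractor_nonzero\<close>). The loops run inside the strong component of \<open>v\<close>, and
  \<open>v\<close> was chosen before \<open>t\<close>, so the limit set of this one component has dimension at least \<open>s\<^sub>0\<close>.
  This covers infinite graphs with infinitely many components as well.

  Contractibility also shapes the graph: \<open>J\<^sub>v\<close> is the closure of its nonempty interior and has
  positive diameter, so every vertex has an outgoing edge and every finite path extends to an
  infinite one.
\<close>

section \<open>Chains, open images and packings in Euclidean space\<close>

text \<open>
  The number of steps depends on the dimension, \<open>M\<close> and \<open>\<delta>\<close> but not on \<open>S\<close>, because the balls of
  radius \<open>\<delta>/2\<close> that cover a ball of radius \<open>M\<close> can be translated to any point of \<open>S\<close>. Two cells of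
  this cover are linked if they share a point of \<open>S\<close>; connectedness of \<open>S\<close> makes the finite graph of
  cells connected, and a path in it visits each link at most once.
\<close>

lemma connected_imp_bounded_chain:
  fixes M \<delta> :: real
  assumes "0 < \<delta>"
  shows "\<exists>N. \<forall>S :: 'a::euclidean_space set.
           Topological_Spaces.connected S \<longrightarrow> bounded S \<longrightarrow> diameter S \<le> M \<longrightarrow>
           (\<forall>x\<in>S. \<forall>y\<in>S. \<exists>k\<le>N. (x, y) \<in> {(a, b). a \<in> S \<and> b \<in> S \<and> dist a b < \<delta>} ^^ k)"
proof -
  have "compact (cball (0::'a) M)" by simp
  then obtain F where F: "finite F" "cball (0::'a) M \<subseteq> (\<Union>c\<in>F. ball c (\<delta>/2))"
    using assms unfolding compact_eq_totally_bounded by (meson half_gt_zero)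
  have "\<exists>k\<le>card (F \<times> F) + 1. (x, y) \<in> {(a, b). a \<in> S \<and> b \<in> S \<and> dist a b < \<delta>} ^^ k"
    if S: "Topological_Spaces.connected S" "bounded S" "diameter S \<le> M" and xy: "x \<in> S" "y \<in> S" for S :: "'a set" and x y
  proof -
    define B where "B c = S \<inter> ball (x + c) (\<delta>/2)" for c
    define R where "R = {(c, c'). c \<in> F \<and> c' \<in> F \<and> B c \<inter> B c' \<noteq> {}}"
    have cov: "\<exists>c\<in>F. z \<in> B c" if "z \<in> S" for z
    proof -
      have "dist x z \<le> diameter S" using diameter_bounded_bound[OF S(2) xy(1) that] .
      then have "z - x \<in> cball 0 M" using S(3) by (simp add: dist_norm norm_minus_commute)
      then obtain c where "c \<in> F" "z - x \<in> ball c (\<delta>/2)" using F(2) by blast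
      then show ?thesis using that unfolding B_def
        by (intro bexI[of _ c]) (auto simp: dist_norm algebra_simps)
    qed
    have Rsub: "R \<subseteq> F \<times> F" by (auto simp: R_def)
    then have finR: "finite R" using F(1) finite_subset by blast
    obtain c0 c1 where c: "c0 \<in> F" "x \<in> B c0" "c1 \<in> F" "y \<in> B c1"
      using cov xy by blast
    have "(c0, c1) \<in> R\<^sup>*"
    proof (rule ccontr)
      assume n: "(c0, c1) \<notin> R\<^sup>*"
      define F1 where "F1 = {c \<in> F. (c0, c) \<in> R\<^sup>*}"
      define P where "P = (\<Union>c\<in>F1. ball (x + c) (\<delta>/2))"
      define Q where "Q = (\<Union>c\<in>F - F1. ball (x + c) (\<delta>/2))"
      have "open P" "open Q" by (auto simp: P_def Q_def)
      moreover have "S \<subseteq> P \<union> Q" using cov unfolding P_def Q_def B_def by blast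
      moreover have "P \<inter> Q \<inter> S = {}"
      proof (rule ccontr)
        assume "P \<inter> Q \<inter> S \<noteq> {}"
        then obtain z c c' where z: "c \<in> F1" "c' \<in> F - F1" "z \<in> B c" "z \<in> B c'"
          unfolding P_def Q_def B_def by blast
        then have "(c, c') \<in> R" unfolding R_def F1_def by blast
        then show False using z unfolding F1_def by (auto intro: rtrancl_into_rtrancl)
      qed
      moreover have "P \<inter> S \<noteq> {}" using c unfolding P_def F1_def B_def by blast
      moreover have "Q \<inter> S \<noteq> {}" using c n unfolding Q_def F1_def B_def by blast
      ultimately show False using connectedD[OF S(1)] by blast
    qed
    then obtain k where k: "k \<le> card R" "(c0, c1) \<in> R ^^ k"
      using rtrancl_finite_eq_relpow[OF finR] by auto
    have step: "(z, z') \<in> {(a, b). a \<in> S \<and> b \<in> S \<and> dist a b < \<delta>} ^^ (k + 1)"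
      if "(c, c') \<in> R ^^ k" "z \<in> B c" "z' \<in> B c'" for z z' c c' k
      using that
    proof (induction k arbitrary: c' z')
      case 0
      then have "dist z z' < \<delta>" unfolding B_def
        by (auto intro: dist_triangle_half_r)
      then show ?case using 0 by (auto simp: B_def)
    next
      case (Suc k)
      then obtain d where d: "(c, d) \<in> R ^^ k" "(d, c') \<in> R" by auto
      then obtain w where w: "w \<in> B d" "w \<in> B c'" by (auto simp: R_def)
      have "(z, w) \<in> {(a, b). a \<in> S \<and> b \<in> S \<and> dist a b < \<delta>} ^^ (k + 1)"
        using Suc.IH[OF d(1) Suc.prems(2) w(1)] .
      moreover have "dist w z' < \<delta>" using w Suc.prems(3) unfolding B_def
        by (auto intro: dist_triangle_half_r)
      ultimately show ?case using w Suc.prems(3) by (auto simp: B_def)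
    qed
    have "card R \<le> card (F \<times> F)" using Rsub F(1) by (intro card_mono) auto
    then show ?thesis using step[OF k(2) c(2) c(4)] k(1)
      by (intro exI[of _ "k + 1"]) auto
  qed
  then show ?thesis by blast
qed

text \<open>
  A quantitative open mapping statement: an expansion bound for the inverse forces the image
  to be large. Follow a segment from \<open>f x\<close> towards a point outside the image and stop at its first
  exit. Up to the exit the inverse branch is Lipschitz with constant \<open>1/m\<close>, so the preimages stay
  in a smaller closed ball, whose image is closed and contains the exit point after all.
\<close>

lemma ball_subset_image_ball:
  fixes f g :: "'a::euclidean_space \<Rightarrow> 'a"
  assumes hom: "homeomorphism U W f g" and "open U" "open W"
    and sub: "ball x \<epsilon> \<subseteq> U" and pos: "0 < \<epsilon>" "0 < m"
    and deriv: "\<And>p. p \<in> f ` ball x \<epsilon> \<Longrightarrow> (g has_derivative g' p) (at p) \<and> onorm (g' p) \<le> 1 / m"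
  shows "ball (f x) (m * \<epsilon>) \<subseteq> f ` ball x \<epsilon>"
proof (rule ccontr)
  assume "\<not> ?thesis"
  then obtain y where y: "dist (f x) y < m * \<epsilon>" "y \<notin> f ` ball x \<epsilon>"
    unfolding subset_iff mem_ball by blast
  define S where "S = f ` ball x \<epsilon>"
  have "openin (top_of_set W) S"
    unfolding S_def using homeomorphism_imp_open_map[OF hom] sub
    by (metis open_ball open_subset openin_open_eq[OF \<open>open U\<close>])
  then have opS: "open S" using \<open>open W\<close> openin_open_eq by blast
  define e where "e = dist (f x) y / m"
  have e: "0 \<le> e" "e < \<epsilon>" using y pos by (auto simp: e_def field_simps)
  define \<gamma> where "\<gamma> t = f x + t *\<^sub>R (y - f x)" for t :: real
  have cont: "continuous_on UNIV \<gamma>" unfolding \<gamma>_def by (intro continuous_intros)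
  define Z where "Z = {0..1} \<inter> \<gamma> -` (- S)"
  have "closed (\<gamma> -` (- S))"
    using continuous_closed_vimage[of "- S" \<gamma>] opS cont by (simp add: closed_def continuous_on_eq_continuous_at)
  then have "compact Z" unfolding Z_def by (simp add: compact_Int_closed)
  moreover have "1 \<in> Z" using y(2) by (simp add: Z_def \<gamma>_def S_def)
  ultimately obtain t0 where t0: "t0 \<in> Z" "\<And>t. t \<in> Z \<Longrightarrow> t0 \<le> t"
    using compact_attains_inf[of Z] by blast
  have fxS: "f x \<in> S" using pos by (simp add: S_def)
  have "t0 \<noteq> 0" using t0(1) fxS by (auto simp: Z_def \<gamma>_def)
  then have t01: "0 < t0" "t0 \<le> 1" using t0(1) by (auto simp: Z_def)
  have inS: "\<gamma> t \<in> S" if "0 \<le> t" "t < t0" for t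
    using t0(2)[of t] that t01 by (auto simp: Z_def)
  have gfx: "g (f z) = z" if "z \<in> ball x \<epsilon>" for z
    using hom sub that unfolding homeomorphism_def by blast
  have key: "\<gamma> t \<in> f ` cball x e" if t: "0 \<le> t" "t < t0" for t
  proof -
    have seg: "p \<in> S" if p: "p \<in> closed_segment (f x) (\<gamma> t)" for p
    proof -
      obtain u where u: "0 \<le> u" "u \<le> 1" "p = (1 - u) *\<^sub>R f x + u *\<^sub>R \<gamma> t"
        using p by (auto simp: in_segment)
      then have "p = \<gamma> (u * t)" by (simp add: \<gamma>_def algebra_simps)
      moreover have "u * t \<le> t" using u t by (simp add: mult_left_le_one_le)
      ultimately show ?thesis using inS[of "u * t"] u t by simp
    qed
    have "norm (g (\<gamma> t) - g (f x)) \<le> (1 / m) * norm (\<gamma> t - f x)"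
    proof (rule differentiable_bound)
      show "convex (closed_segment (f x) (\<gamma> t))" by simp
      show "(g has_derivative g' p) (at p within closed_segment (f x) (\<gamma> t))"
        if "p \<in> closed_segment (f x) (\<gamma> t)" for p
        using deriv seg[OF that] has_derivative_at_withinI unfolding S_def by blast
      show "onorm (g' p) \<le> 1 / m" if "p \<in> closed_segment (f x) (\<gamma> t)" for p
        using deriv seg[OF that] by (auto simp: S_def)
    qed auto
    also have "norm (\<gamma> t - f x) = t * dist (f x) y"
      using t by (simp add: \<gamma>_def dist_norm norm_minus_commute)
    also have "(1 / m) * (t * dist (f x) y) \<le> e"
      using t t01 pos by (simp add: e_def divide_right_mono mult_left_le_one_le)
    finally have "g (\<gamma> t) \<in> cball x e"
      using gfx[of x] pos by (simp add: dist_norm norm_minus_commute)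
    moreover have "f (g (\<gamma> t)) = \<gamma> t"
      using inS[OF t] gfx by (auto simp: S_def)
    ultimately show ?thesis by (metis imageI)
  qed
  have "cball x e \<subseteq> ball x \<epsilon>" using e by auto
  then have "continuous_on (cball x e) f"
    using continuous_on_subset[OF homeomorphism_cont1[OF hom]] sub by simp
  then have "closed (f ` cball x e)"
    by (simp add: compact_continuous_image compact_imp_closed)
  moreover have "\<gamma> t0 \<in> closure (\<gamma> ` {0..<t0})"
  proof -
    have "t0 \<in> closure {0..<t0}" using t01 by simp
    moreover have "\<gamma> ` closure {0..<t0} \<subseteq> closure (\<gamma> ` {0..<t0})"
      using continuous_image_closure_subset[OF cont] by simp
    ultimately show ?thesis by blast
  qed
  moreover have "\<gamma> ` {0..<t0} \<subseteq> f ` cball x e" using key by auto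
  ultimately have "\<gamma> t0 \<in> f ` cball x e" by (meson closure_minimal subsetD)
  then have "\<gamma> t0 \<in> S" using \<open>cball x e \<subseteq> ball x \<epsilon>\<close> by (auto simp: S_def)
  then show False using t0(1) by (simp add: Z_def)
qed

text \<open>
  Compare Lebesgue measures.
\<close>

lemma card_disjoint_balls_le:
  fixes y :: "'i \<Rightarrow> 'a::euclidean_space"
  assumes "finite I" "0 < a" "0 \<le> b"
    and dis: "disjoint_family_on (\<lambda>i. ball (y i) a) I"
    and sub: "\<And>i. i \<in> I \<Longrightarrow> ball (y i) a \<subseteq> ball c b"
  shows "real (card I) \<le> (b / a) ^ DIM('a)"
proof -
  have "(\<Sum>i\<in>I. measure lborel (ball (y i) a)) = measure lborel (\<Union>i\<in>I. ball (y i) a)"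
    by (rule measure_finite_Union[symmetric])
       (use assms emeasure_lborel_ball_finite in \<open>auto simp: less_top[symmetric]\<close>)
  also have "\<dots> \<le> measure lborel (ball c b)"
    using sub by (intro measure_mono_fmeasurable) (auto intro!: borel_open fmeasurableI emeasure_lborel_ball_finite)
  finally have "(\<Sum>i\<in>I. measure lborel (ball (y i) a)) \<le> measure lborel (ball c b)" .
  then have "real (card I) * (unit_ball_vol (real DIM('a)) * a ^ DIM('a)) \<le> unit_ball_vol (real DIM('a)) * b ^ DIM('a)"
    using assms by (simp add: content_ball)
  then show ?thesis using assms unit_ball_vol_pos[of "real DIM('a)"]
    by (simp add: power_divide field_simps)
qed

lemma onorm_scaled_orthogonal:
  fixes Q :: "'a::euclidean_space \<Rightarrow> 'a"
  assumes "orthogonal_transformation Q" "0 \<le> c"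
  shows "onorm (\<lambda>h. c *\<^sub>R Q h) = c"
proof (rule antisym)
  show "onorm (\<lambda>h. c *\<^sub>R Q h) \<le> c"
    by (rule onorm_le) (use assms orthogonal_transformation_norm[OF assms(1)] in simp)
  obtain b :: 'a where b: "norm b = 1" using norm_Basis SOME_Basis by blast
  have lin: "bounded_linear (\<lambda>h. c *\<^sub>R Q h)"
    using assms(1) by (intro bounded_linear_scaleR_right bounded_linear_compose[OF bounded_linear_scaleR_right])
      (simp add: orthogonal_transformation_linear linear_linear)
  have "norm (c *\<^sub>R Q b) \<le> onorm (\<lambda>h. c *\<^sub>R Q h) * norm b" by (rule onorm[OF lin])
  then show "c \<le> onorm (\<lambda>h. c *\<^sub>R Q h)"
    using assms b orthogonal_transformation_norm[OF assms(1)] by simp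
qed

lemma inorm_scaled_orthogonal:
  fixes Q :: "'a::euclidean_space \<Rightarrow> 'a"
  assumes "orthogonal_transformation Q" "0 < c"
  shows "inorm (\<lambda>h. c *\<^sub>R Q h) = c"
proof -
  have "inv (\<lambda>h. c *\<^sub>R Q h) = (\<lambda>h. (1 / c) *\<^sub>R inv Q h)"
  proof (rule inv_equality)
    have lin: "linear (inv Q)"
      using orthogonal_transformation_inv[OF assms(1)] orthogonal_transformation_linear by blast
    show "(1 / c) *\<^sub>R inv Q (c *\<^sub>R Q x) = x" for x
      using assms lin orthogonal_transformation_inj[OF assms(1)] by (simp add: linear_scale)
    show "c *\<^sub>R Q ((1 / c) *\<^sub>R inv Q x) = x" for x
      using assms orthogonal_transformation_surj[OF assms(1)] orthogonal_transformation_linear[OF assms(1)]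
      by (simp add: surj_f_inv_f linear_scale)
  qed
  then show ?thesis
    unfolding inorm_def using onorm_scaled_orthogonal[OF orthogonal_transformation_inv[OF assms(1)], of "1 / c"] assms(2)
    by simp
qed

section \<open>Extended nonnegative sums and subexponential growth\<close>

lemma sum_le_infsum_ennreal:
  fixes f :: "'a \<Rightarrow> ennreal"
  assumes "finite F" "F \<subseteq> A"
  shows "sum f F \<le> infsum f A"
  by (subst nonneg_infsum_complete) (use assms in \<open>auto intro!: SUP_upper\<close>)

lemma infsum_ennreal_leI:
  fixes f :: "'a \<Rightarrow> ennreal"
  assumes "\<And>F. finite F \<Longrightarrow> F \<subseteq> A \<Longrightarrow> sum f F \<le> c"
  shows "infsum f A \<le> c"
  by (subst nonneg_infsum_complete) (use assms in \<open>auto intro!: SUP_least\<close>)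

lemma exp_ereal_mono: "x \<le> y \<Longrightarrow> exp_ereal x \<le> exp_ereal y"
  by (cases x; cases y) (auto simp: exp_ereal_def ennreal_leI)

text \<open>
  With the next lemma this identifies \<open>exp_ereal (SUP ...)\<close> as the least upper bound of the
  exponentials, which is all that is used about the summands of a partition sum.
\<close>

lemma exp_ereal_SUP_ge:
  assumes "\<omega> \<in> I"
  shows "ennreal (exp (g \<omega>)) \<le> exp_ereal (SUP \<omega>\<in>I. ereal (g \<omega>))"
proof -
  have "exp_ereal (ereal (g \<omega>)) \<le> exp_ereal (SUP \<omega>\<in>I. ereal (g \<omega>))"
    using assms by (intro exp_ereal_mono SUP_upper)
  then show ?thesis by (simp add: exp_ereal_def)
qed

lemma exp_ereal_SUP_le:
  assumes "\<And>\<omega>. \<omega> \<in> I \<Longrightarrow> ennreal (exp (g \<omega>)) \<le> c"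
  shows "exp_ereal (SUP \<omega>\<in>I. ereal (g \<omega>)) \<le> c"
proof (cases "c = \<infinity> \<or> I = {}")
  case True
  then show ?thesis by (auto simp: exp_ereal_def bot_ereal_def)
next
  case False
  then obtain r where r: "c = ennreal r" "0 \<le> r" by (cases c) auto
  obtain \<omega> where "\<omega> \<in> I" using False by auto
  then have "exp (g \<omega>) \<le> r" using assms[of \<omega>] r by simp
  then have rpos: "0 < r" using exp_gt_zero less_le_trans by blast
  have "(SUP \<omega>\<in>I. ereal (g \<omega>)) \<le> ereal (ln r)"
  proof (rule SUP_least)
    fix \<omega> assume "\<omega> \<in> I"
    then have "exp (g \<omega>) \<le> r" using assms[of \<omega>] r by simp
    then show "ereal (g \<omega>) \<le> ereal (ln r)" using rpos by (simp add: ln_ge_iff)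
  qed
  then have "exp_ereal (SUP \<omega>\<in>I. ereal (g \<omega>)) \<le> exp_ereal (ereal (ln r))" by (rule exp_ereal_mono)
  then show ?thesis using r rpos by (simp add: exp_ereal_def)
qed

lemma ennreal_infsum_tail:
  fixes f :: "'a \<Rightarrow> ennreal"
  assumes "infsum f A < \<infinity>" "0 < \<epsilon>"
  shows "\<exists>F. finite F \<and> F \<subseteq> A \<and> (\<forall>F'. finite F' \<longrightarrow> F' \<subseteq> A - F \<longrightarrow> sum f F' \<le> ennreal \<epsilon>)"
proof -
  have sup: "infsum f A = (SUP F\<in>{F. finite F \<and> F \<subseteq> A}. sum f F)" by (rule nonneg_infsum_complete) simp
  have "\<exists>F. finite F \<and> F \<subseteq> A \<and> infsum f A \<le> sum f F + ennreal \<epsilon>"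
  proof (cases "infsum f A = 0")
    case True
    then show ?thesis by (intro exI[of _ "{}"]) simp
  next
    case False
    obtain S where S: "infsum f A = ennreal S" "0 \<le> S" using assms(1) by (cases "infsum f A") auto
    have "0 < S" using False S by auto
    then have "ennreal (max 0 (S - \<epsilon>)) < infsum f A" using assms(2) S by (simp add: ennreal_less_iff)
    then obtain F where F: "finite F" "F \<subseteq> A" "ennreal (max 0 (S - \<epsilon>)) < sum f F"
      unfolding sup by (auto simp: less_SUP_iff)
    have "infsum f A \<le> ennreal (max 0 (S - \<epsilon>) + \<epsilon>)" unfolding S(1) by (intro ennreal_leI) auto
    also have "\<dots> = ennreal (max 0 (S - \<epsilon>)) + ennreal \<epsilon>" using assms(2) by (intro ennreal_plus) auto
    also have "\<dots> \<le> sum f F + ennreal \<epsilon>" using F(3) by (intro add_right_mono) simp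
    finally show ?thesis using F by blast
  qed
  then obtain F where F: "finite F" "F \<subseteq> A" "infsum f A \<le> sum f F + ennreal \<epsilon>" by blast
  have fin: "sum f F < \<infinity>" using sum_le_infsum_ennreal[OF F(1,2)] assms(1) by (rule le_less_trans)
  have "sum f F' \<le> ennreal \<epsilon>" if F': "finite F'" "F' \<subseteq> A - F" for F'
  proof -
    have "sum f F + sum f F' = sum f (F \<union> F')" using F F' by (intro sum.union_disjoint[symmetric]) auto
    also have "\<dots> \<le> infsum f A" using F F' by (intro sum_le_infsum_ennreal) auto
    also have "\<dots> \<le> sum f F + ennreal \<epsilon>" by (rule F(3))
    finally show ?thesis using fin by (auto simp: ennreal_add_left_cancel_le)
  qed
  then show ?thesis using F by blast
qed

text \<open>
  The number of ways to split a word of length \<open>n\<close> into three parts is quadratic in \<open>n\<close>; this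
  absorbs it into a slightly worse rate.
\<close>

lemma polynomial_times_geometric_bound:
  fixes \<theta> C :: real
  assumes "0 < \<theta>" "\<theta> < 1" "0 \<le> C"
  shows "\<exists>C' \<theta>'. 0 < \<theta>' \<and> \<theta>' < 1 \<and> (\<forall>n. C * (real n + 1)\<^sup>2 * \<theta> ^ n \<le> C' * \<theta>' ^ n)"
proof -
  define q where "q = sqrt \<theta>"
  have q: "0 < q" "q < 1" "\<theta> = q * q" using assms by (auto simp: q_def)
  have "(\<lambda>n. (real n)\<^sup>2 * q ^ n) \<longlonglongrightarrow> 0"
  proof -
    have "0 < 1 / sqrt q" "sqrt q < 1" using q by auto
    have "(\<lambda>n. (real n * (sqrt q) ^ n) * (real n * (sqrt q) ^ n)) \<longlonglongrightarrow> 0 * 0"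
      using q by (intro tendsto_mult powser_times_n_limit_0) auto
    moreover have "(real n * (sqrt q) ^ n) * (real n * (sqrt q) ^ n) = (real n)\<^sup>2 * q ^ n" for n
      using q by (simp add: power2_eq_square power_mult_distrib[symmetric] mult_ac)
    ultimately show ?thesis by simp
  qed
  then obtain K where K: "\<And>n. (real n)\<^sup>2 * q ^ n \<le> K"
    by (meson Bseq_bdd_above bdd_above.unfold convergent_def convergent_imp_Bseq rangeI)
  have "C * (real n + 1)\<^sup>2 * \<theta> ^ n \<le> (C * (K / q)) * q ^ n" for n
  proof -
    have "(real n + 1)\<^sup>2 * q ^ n = (real (Suc n))\<^sup>2 * q ^ Suc n / q" using q by (simp add: add.commute)
    also have "\<dots> \<le> K / q" using K[of "Suc n"] q by (intro divide_right_mono) auto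
    finally have "(C * q ^ n) * ((real n + 1)\<^sup>2 * q ^ n) \<le> (C * q ^ n) * (K / q)"
      using assms(3) q by (intro mult_left_mono) auto
    then show ?thesis unfolding q(3) power_mult_distrib by (simp add: mult_ac)
  qed
  then show ?thesis using q by blast
qed

lemma has_pressure_zero_subexponential:
  assumes "has_pressure G f 0" "0 < \<epsilon>"
  shows "\<forall>\<^sub>F n in sequentially. ennreal (exp (- \<epsilon> * real n)) \<le> partition_sum G f n \<and>
           partition_sum G f n \<le> ennreal (exp (\<epsilon> * real n))"
proof -
  have lim: "(\<lambda>n. ereal (1 / real n) * ln_ennreal (partition_sum G f n)) \<longlonglongrightarrow> 0"
    using assms(1) by (simp add: has_pressure_def)
  have "\<forall>\<^sub>F n in sequentially. ereal (- \<epsilon>) < ereal (1 / real n) * ln_ennreal (partition_sum G f n)"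
    by (rule order_tendstoD(1)[OF lim]) (use assms in simp)
  moreover have "\<forall>\<^sub>F n in sequentially. ereal (1 / real n) * ln_ennreal (partition_sum G f n) < ereal \<epsilon>"
    by (rule order_tendstoD(2)[OF lim]) (use assms in simp)
  ultimately show ?thesis using eventually_gt_at_top[of "0::nat"]
  proof eventually_elim
    case (elim n)
    show ?case
    proof (cases "partition_sum G f n")
      case (real z)
      have "z \<noteq> 0" using elim real by (auto simp: ln_ennreal_def)
      then have z: "0 < z" using real by simp
      then have "ln_ennreal (partition_sum G f n) = ereal (ln z)"
        using real by (simp add: ln_ennreal_def)
      then have "- \<epsilon> < ln z / n" "ln z / n < \<epsilon>" using elim by auto
      then have "- \<epsilon> * n < ln z" "ln z < \<epsilon> * n" using elim(3) by (auto simp: field_simps)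
      then have "exp (- \<epsilon> * n) < z" "z < exp (\<epsilon> * n)" using z
        by (metis exp_less_mono exp_ln)+
      then show ?thesis using real by (auto intro!: ennreal_leI)
    next
      case top
      then show ?thesis using elim by (auto simp: ln_ennreal_def)
    qed
  qed
qed

section \<open>Hausdorff measure and dimension\<close>

lemma hausdorff_premeasure_mono_set:
  "A \<subseteq> B \<Longrightarrow> hausdorff_premeasure s \<delta> A \<le> hausdorff_premeasure s \<delta> B"
  unfolding hausdorff_premeasure_def by (rule INF_superset_mono) auto

lemma hausdorff_measure_mono: "A \<subseteq> B \<Longrightarrow> hausdorff_measure s A \<le> hausdorff_measure s B"
  unfolding hausdorff_measure_def by (intro SUP_mono) (blast intro: hausdorff_premeasure_mono_set)

lemma hausdorff_dim_mono:
  assumes "A \<subseteq> B"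
  shows "hausdorff_dim A \<le> hausdorff_dim B"
proof -
  have "hausdorff_measure s A = 0" if "hausdorff_measure s B = 0" for s
    using hausdorff_measure_mono[OF assms, of s] that by simp
  then show ?thesis unfolding hausdorff_dim_def by (intro Inf_superset_mono) auto
qed

lemma hausdorff_dim_leI:
  assumes "0 \<le> s" "\<And>s'. s < s' \<Longrightarrow> hausdorff_measure s' A = 0"
  shows "hausdorff_dim A \<le> ereal s"
proof (rule ereal_le_epsilon2)
  fix e :: real assume "0 < e"
  then have "hausdorff_measure (s + e) A = 0" using assms(2) by simp
  then show "hausdorff_dim A \<le> ereal s + ereal e"
    unfolding hausdorff_dim_def using assms(1) \<open>0 < e\<close> by (intro Inf_lower) auto
qed

lemma hausdorff_dim_geI:
  assumes "\<And>s'. 0 \<le> s' \<Longrightarrow> s' < s \<Longrightarrow> hausdorff_measure s' A \<noteq> 0"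
  shows "ereal s \<le> hausdorff_dim A"
  unfolding hausdorff_dim_def
proof (rule Inf_greatest)
  fix x assume "x \<in> {ereal s |s. 0 \<le> s \<and> hausdorff_measure s A = 0}"
  then obtain s' where "x = ereal s'" "0 \<le> s'" "hausdorff_measure s' A = 0" by blast
  then show "ereal s \<le> x" using assms[of s'] by force
qed

text \<open>
  Covers are indexed by the naturals in \<^const>\<open>hausdorff_premeasure\<close>, whereas cylinders are indexed
  by words. The unused naturals carry the empty set, which contributes nothing.
\<close>

lemma hausdorff_measure_eq_0I:
  fixes A :: "'a::metric_space set"
  assumes "0 < s"
    and cover: "\<And>\<delta> \<epsilon>. 0 < \<delta> \<Longrightarrow> 0 < \<epsilon> \<Longrightarrow>
      \<exists>(W :: 'i set) C. countable W \<and> A \<subseteq> (\<Union>w\<in>W. C w) \<and> (\<forall>w\<in>W. bounded (C w) \<and> diameter (C w) \<le> \<delta>) \<and>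
        (\<forall>F. finite F \<longrightarrow> F \<subseteq> W \<longrightarrow> (\<Sum>w\<in>F. ennreal (diameter (C w) powr s)) \<le> ennreal \<epsilon>)"
  shows "hausdorff_measure s A = 0"
proof -
  have "hausdorff_premeasure s \<delta> A \<le> ennreal \<epsilon>" if pos: "0 < \<delta>" "0 < \<epsilon>" for \<delta> \<epsilon>
  proof -
    obtain W and C :: "'i \<Rightarrow> 'a set" where W: "countable W" "A \<subseteq> (\<Union>w\<in>W. C w)"
      "\<And>w. w \<in> W \<Longrightarrow> bounded (C w) \<and> diameter (C w) \<le> \<delta>"
      "\<And>F. finite F \<Longrightarrow> F \<subseteq> W \<Longrightarrow> (\<Sum>w\<in>F. ennreal (diameter (C w) powr s)) \<le> ennreal \<epsilon>"
      using cover[OF pos] by metis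
    define D where "D n = (if n \<in> to_nat_on W ` W then C (from_nat_into W n) else {})" for n
    have inj: "inj_on (to_nat_on W) W" using W(1) by (rule inj_on_to_nat_on)
    have D_eq: "D (to_nat_on W w) = C w" if "w \<in> W" for w
      using that W(1) by (auto simp: D_def)
    have D_cases: "D n = {} \<or> (\<exists>w\<in>W. n = to_nat_on W w \<and> D n = C w)" for n
      using D_eq by (auto simp: D_def)
    have "(\<Sum>n. diam_power s (D n)) \<le> ennreal \<epsilon>"
    proof (rule suminf_le_const)
      fix n
      define F where "F = {w \<in> W. to_nat_on W w < n}"
      have "inj_on (to_nat_on W) F" using inj by (rule inj_on_subset) (auto simp: F_def)
      moreover have "finite (to_nat_on W ` F)"
        by (rule finite_subset[of _ "{..<n}"]) (auto simp: F_def)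
      ultimately have finF: "finite F" by (simp add: finite_image_iff)
      have "(\<Sum>i<n. diam_power s (D i)) = (\<Sum>i\<in>to_nat_on W ` F. diam_power s (D i))"
      proof (rule sum.mono_neutral_right)
        show "\<forall>i\<in>{..<n} - to_nat_on W ` F. diam_power s (D i) = 0"
          using D_cases by (force simp: diam_power_def F_def)
      qed (auto simp: F_def)
      also have "\<dots> = (\<Sum>w\<in>F. diam_power s (D (to_nat_on W w)))"
        by (rule sum.reindex_cong[OF \<open>inj_on (to_nat_on W) F\<close>]) auto
      also have "\<dots> \<le> (\<Sum>w\<in>F. ennreal (diameter (C w) powr s))"
        by (rule sum_mono) (use D_eq \<open>0 < s\<close> in \<open>auto simp: diam_power_def F_def\<close>)
      also have "\<dots> \<le> ennreal \<epsilon>" using W(4)[OF finF] by (auto simp: F_def)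
      finally show "(\<Sum>i<n. diam_power s (D i)) \<le> ennreal \<epsilon>" .
    qed auto
    moreover have "D \<in> {C. A \<subseteq> (\<Union>n. C n) \<and> (\<forall>n. bounded (C n) \<and> diameter (C n) \<le> \<delta>)}"
    proof -
      have "A \<subseteq> (\<Union>n. D n)"
      proof
        fix x assume "x \<in> A"
        then obtain w where "w \<in> W" "x \<in> C w" using W(2) by blast
        then show "x \<in> (\<Union>n. D n)" using D_eq by blast
      qed
      moreover have "bounded (D n) \<and> diameter (D n) \<le> \<delta>" for n
        using D_cases[of n] W(3) pos by auto
      ultimately show ?thesis by blast
    qed
    ultimately show ?thesis
      unfolding hausdorff_premeasure_def by (meson INF_lower2)
  qed
  then have "hausdorff_premeasure s \<delta> A = 0" if "0 < \<delta>" for \<delta>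
    using that ennreal_le_epsilon[of 0 "hausdorff_premeasure s \<delta> A"] by simp
  then show ?thesis unfolding hausdorff_measure_def by (simp add: SUP_eq_const)
qed

lemma hausdorff_measure_0_nonempty:
  assumes "K \<noteq> {}"
  shows "hausdorff_measure 0 K \<noteq> 0"
proof
  assume "hausdorff_measure 0 K = 0"
  then have "hausdorff_premeasure 0 1 K \<le> 0"
    unfolding hausdorff_measure_def by (metis SUP_upper greaterThan_iff zero_less_one)
  then have "(INF C \<in> {C. K \<subseteq> (\<Union>n. C n) \<and> (\<forall>n. bounded (C n) \<and> diameter (C n) \<le> 1)}. \<Sum>n. diam_power 0 (C n)) < 1"
    unfolding hausdorff_premeasure_def by simp
  then obtain C where C: "K \<subseteq> (\<Union>n. C n)" "(\<Sum>n. diam_power 0 (C n)) < 1"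
    by (auto simp: INF_less_iff)
  then obtain n where "C n \<noteq> {}" using assms by blast
  then have "1 \<le> diam_power 0 (C n)" by (simp add: diam_power_def)
  also have "\<dots> \<le> (\<Sum>n. diam_power 0 (C n))"
    using sum_le_suminf[of "\<lambda>n. diam_power 0 (C n)" "{n}"] by simp
  finally show False using C(2) by simp
qed

text \<open>
  Each set of a good cover is enlarged to an open ball around one of its points, at the expense of
  \<open>\<epsilon> / 2\<^sup>n\<^sup>+\<^sup>2\<close> in the sum; compactness then leaves finitely many balls. The bound \<open>\<rho> \<le> 1\<close> comes from
  starting with sets of diameter at most \<open>1/2\<close>.
\<close>

lemma hausdorff_measure_0_ball_cover:
  fixes K :: "'a::metric_space set"
  assumes "hausdorff_measure s K = 0" "0 < s" "compact K" "0 < \<epsilon>"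
  shows "\<exists>I :: ('a \<times> real) set. finite I \<and> (\<forall>(c, \<rho>)\<in>I. 0 < \<rho> \<and> \<rho> \<le> 1) \<and>
           K \<subseteq> (\<Union>(c, \<rho>)\<in>I. ball c \<rho>) \<and> (\<Sum>(c, \<rho>)\<in>I. \<rho> powr s) < \<epsilon>"
proof -
  have "hausdorff_premeasure s (1/2) K \<le> 0"
    using assms(1) unfolding hausdorff_measure_def
    by (metis SUP_upper greaterThan_iff half_gt_zero zero_less_one)
  then have "(INF C \<in> {C. K \<subseteq> (\<Union>n. C n) \<and> (\<forall>n. bounded (C n) \<and> diameter (C n) \<le> 1/2)}. \<Sum>n. diam_power s (C n)) < ennreal (\<epsilon>/2)"
    unfolding hausdorff_premeasure_def using assms(4) by simp
  then obtain C where C: "K \<subseteq> (\<Union>n. C n)" "\<And>n. bounded (C n) \<and> diameter (C n) \<le> 1/2"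
    "(\<Sum>n. diam_power s (C n)) < ennreal (\<epsilon>/2)"
    by (auto simp: INF_less_iff)
  have "\<exists>\<rho>. diameter (C n) < \<rho> \<and> \<rho> \<le> 1 \<and> \<rho> powr s < diameter (C n) powr s + \<epsilon> / 2 * (1/2)^(Suc n)" for n
  proof -
    have "((\<lambda>\<rho>. \<rho> powr s) \<longlongrightarrow> diameter (C n) powr s) (at_right (diameter (C n)))"
      using assms(2) diameter_ge_0[of "C n"] C(2)[of n]
      by (intro tendsto_powr') (auto intro: tendsto_eq_intros simp: eventually_at_filter)
    moreover have "diameter (C n) powr s < diameter (C n) powr s + \<epsilon> / 2 * (1/2)^(Suc n)"
      using assms(4) by simp
    ultimately have "\<forall>\<^sub>F \<rho> in at_right (diameter (C n)). \<rho> powr s < diameter (C n) powr s + \<epsilon> / 2 * (1/2)^(Suc n)"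
      by (rule order_tendstoD(2))
    moreover have "\<forall>\<^sub>F \<rho> in at_right (diameter (C n)). \<rho> \<in> {diameter (C n)<..<1}"
      by (rule eventually_at_right_real) (use C(2)[of n] in simp)
    ultimately have "\<forall>\<^sub>F \<rho> in at_right (diameter (C n)). diameter (C n) < \<rho> \<and> \<rho> \<le> 1 \<and> \<rho> powr s < diameter (C n) powr s + \<epsilon> / 2 * (1/2)^(Suc n)"
      by eventually_elim auto
    then show ?thesis
      by (rule eventually_happens'[rotated]) simp
  qed
  then obtain \<rho> where \<rho>: "\<And>n. diameter (C n) < \<rho> n" "\<And>n. \<rho> n \<le> 1"
    "\<And>n. \<rho> n powr s < diameter (C n) powr s + \<epsilon> / 2 * (1/2)^(Suc n)" by metis
  have \<rho>_pos: "0 < \<rho> n" for n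
    using \<rho>(1)[of n] diameter_ge_0[of "C n"] C(2)[of n] by linarith
  define c where "c n = (SOME x. x \<in> C n)" for n
  have sub: "C n \<subseteq> ball (c n) (\<rho> n)" for n
  proof
    fix x assume "x \<in> C n"
    moreover from this have "c n \<in> C n" unfolding c_def by (rule someI)
    ultimately have "dist (c n) x \<le> diameter (C n)"
      using C(2) by (intro diameter_bounded_bound) auto
    then show "x \<in> ball (c n) (\<rho> n)" using \<rho>(1)[of n] by simp
  qed
  define Nn where "Nn = {n. C n \<noteq> {}}"
  have "K \<subseteq> (\<Union>n\<in>Nn. ball (c n) (\<rho> n))"
  proof
    fix x assume "x \<in> K"
    then obtain n where "x \<in> C n" using C(1) by blast
    then show "x \<in> (\<Union>n\<in>Nn. ball (c n) (\<rho> n))" using sub unfolding Nn_def by blast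
  qed
  then obtain F where F: "F \<subseteq> Nn" "finite F" "K \<subseteq> (\<Union>n\<in>F. ball (c n) (\<rho> n))"
    using compactE_image[OF assms(3), of Nn "\<lambda>n. ball (c n) (\<rho> n)"] by auto
  define I where "I = (\<lambda>n. (c n, \<rho> n)) ` F"
  have "(\<Sum>n\<in>F. ennreal (diameter (C n) powr s)) = (\<Sum>n\<in>F. diam_power s (C n))"
    by (rule sum.cong) (use F(1) assms(2) in \<open>auto simp: diam_power_def Nn_def\<close>)
  also have "\<dots> \<le> (\<Sum>n. diam_power s (C n))"
    by (rule sum_le_suminf) (use F in auto)
  also have "\<dots> < ennreal (\<epsilon>/2)" by (rule C(3))
  finally have dsum: "(\<Sum>n\<in>F. diameter (C n) powr s) < \<epsilon>/2"
    by (simp add: sum_nonneg ennreal_less_iff)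
  have gsum: "(\<Sum>n\<in>F. \<epsilon> / 2 * (1/2)^(Suc n)) \<le> \<epsilon> / 2"
  proof -
    have "(\<Sum>n\<in>F. (1/2::real)^(Suc n)) \<le> (\<Sum>n. (1/2)^(Suc n))"
      by (rule sum_le_suminf) (use F power_half_series in \<open>auto simp: sums_iff\<close>)
    also have "\<dots> = 1" using power_half_series by (simp add: sums_iff)
    finally have "\<epsilon> / 2 * (\<Sum>n\<in>F. (1/2::real)^(Suc n)) \<le> \<epsilon> / 2 * 1"
      using assms(4) by (intro mult_left_mono) auto
    then show ?thesis by (simp only: sum_distrib_left mult_1_right)
  qed
  have "(\<Sum>(c, \<rho>)\<in>I. \<rho> powr s) \<le> (\<Sum>n\<in>F. \<rho> n powr s)"
    unfolding I_def using sum_image_le[OF F(2), of "\<lambda>(c, \<rho>). \<rho> powr s" "\<lambda>n. (c n, \<rho> n)"]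
    by (simp add: o_def)
  also have "\<dots> \<le> (\<Sum>n\<in>F. diameter (C n) powr s + \<epsilon> / 2 * (1/2)^(Suc n))"
    using \<rho>(3) by (intro sum_mono less_imp_le)
  also have "\<dots> < \<epsilon>" using dsum gsum by (simp add: sum.distrib)
  finally have "(\<Sum>(c, \<rho>)\<in>I. \<rho> powr s) < \<epsilon>" .
  moreover have "finite I" "\<forall>(c, \<rho>)\<in>I. 0 < \<rho> \<and> \<rho> \<le> 1" "K \<subseteq> (\<Union>(c, \<rho>)\<in>I. ball c \<rho>)"
    using F \<rho>_pos \<rho>(2) by (auto simp: I_def)
  ultimately show ?thesis by blast
qed

section \<open>A mass distribution principle on finite words\<close>

lemma sum_prod_list_words:
  fixes p :: "'i \<Rightarrow> real"
  assumes "finite \<Lambda>"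
  shows "(\<Sum>w\<in>{w. set w \<subseteq> \<Lambda> \<and> length w = n}. prod_list (map p w)) = (sum p \<Lambda>) ^ n"
proof (induction n)
  case 0
  have "{w. set w \<subseteq> \<Lambda> \<and> length w = 0} = {[]}" by auto
  then show ?case by simp
next
  case (Suc n)
  let ?W = "\<lambda>n. {w. set w \<subseteq> \<Lambda> \<and> length w = n}"
  have eq: "?W (Suc n) = (\<lambda>(i, w). i # w) ` (\<Lambda> \<times> ?W n)"
    by (auto simp: length_Suc_conv image_iff)
  have "(\<Sum>w\<in>?W (Suc n). prod_list (map p w)) = (\<Sum>(i, w)\<in>\<Lambda> \<times> ?W n. p i * prod_list (map p w))"
    unfolding eq by (subst sum.reindex) (auto simp: inj_on_def o_def intro!: sum.cong)
  also have "\<dots> = sum p \<Lambda> * (\<Sum>w\<in>?W n. prod_list (map p w))"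
    by (simp add: sum.cartesian_product[symmetric] sum_product)
  finally show ?case using Suc.IH by simp
qed

lemma sum_prod_list_extensions:
  fixes p :: "'i \<Rightarrow> real"
  assumes "finite \<Lambda>" "sum p \<Lambda> = 1" "set u \<subseteq> \<Lambda>" "length u \<le> n"
  shows "(\<Sum>w\<in>{w. set w \<subseteq> \<Lambda> \<and> length w = n \<and> take (length u) w = u}. prod_list (map p w)) = prod_list (map p u)"
proof -
  let ?W = "{w. set w \<subseteq> \<Lambda> \<and> length w = n - length u}"
  have eq: "{w. set w \<subseteq> \<Lambda> \<and> length w = n \<and> take (length u) w = u} = (\<lambda>w. u @ w) ` ?W" (is "?A = _")
  proof
    show "?A \<subseteq> (\<lambda>w. u @ w) ` ?W"
    proof
      fix w assume w: "w \<in> ?A"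
      then have "w = u @ drop (length u) w" by (metis (mono_tags, lifting) append_take_drop_id mem_Collect_eq)
      moreover have "drop (length u) w \<in> ?W" using w set_drop_subset[of "length u" w] by auto
      ultimately show "w \<in> (\<lambda>w. u @ w) ` ?W" by blast
    qed
  qed (use assms in auto)
  have "(\<Sum>w\<in>?A. prod_list (map p w)) = (\<Sum>w\<in>?W. prod_list (map p u) * prod_list (map p w))"
    unfolding eq by (subst sum.reindex) (auto simp: inj_on_def)
  also have "\<dots> = prod_list (map p u)"
    using sum_prod_list_words[OF assms(1), of p "n - length u"] assms(2) by (simp add: sum_distrib_left[symmetric])
  finally show ?thesis .
qed

text \<open>
  The words at which the scale \<open>N\<close> drops below \<open>\<rho>\<close> for the first time. Since \<open>N\<close> need not be
  monotone along prefixes, all proper prefixes have to be mentioned. No two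
  different words of this kind are comparable.
\<close>

definition stopped :: "'i set \<Rightarrow> ('i list \<Rightarrow> real) \<Rightarrow> real \<Rightarrow> 'i list set" where
  "stopped \<Lambda> N \<rho> = {u. set u \<subseteq> \<Lambda> \<and> N u < \<rho> \<and> (\<forall>v. strict_prefix v u \<longrightarrow> \<rho> \<le> N v)}"

lemma sum_UN_le:
  fixes f :: "'b \<Rightarrow> real"
  assumes "finite I" "\<And>i. i \<in> I \<Longrightarrow> finite (A i)" "\<And>i x. i \<in> I \<Longrightarrow> x \<in> A i \<Longrightarrow> 0 \<le> f x"
  shows "sum f (\<Union>i\<in>I. A i) \<le> (\<Sum>i\<in>I. sum f (A i))"
  using assms
proof (induction I rule: finite_induct)
  case (insert i I)
  have "sum f (A i \<union> (\<Union>i\<in>I. A i)) \<le> sum f (A i) + sum f (\<Union>i\<in>I. A i)"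
    using insert by (subst sum.union_inter[symmetric]) (auto intro!: sum_nonneg)
  then show ?case using insert by fastforce
qed simp

lemma ex_stopped_prefix:
  assumes "set w \<subseteq> \<Lambda>" "N w < \<rho>"
  shows "\<exists>u \<in> stopped \<Lambda> N \<rho>. prefix u w"
proof -
  define k where "k = (LEAST k. N (take k w) < \<rho>)"
  have k: "N (take k w) < \<rho>" unfolding k_def by (rule LeastI[of _ "length w"]) (use assms in simp)
  have "\<rho> \<le> N v" if "strict_prefix v (take k w)" for v
  proof (rule ccontr)
    assume "\<not> \<rho> \<le> N v"
    moreover have "prefix v w"
      using that take_is_prefix[of k w] by (meson prefix_order.order_trans strict_prefix_def)
    then have "v = take (length v) w" by (metis append_eq_conv_conj prefix_def)
    moreover have "length v < k"
      using prefix_length_less[OF that] by simp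
    ultimately have "N (take (length v) w) < \<rho>" "length v < k" by auto
    then show False using not_less_Least unfolding k_def by blast
  qed
  moreover have "set (take k w) \<subseteq> \<Lambda>" using assms(1) set_take_subset[of k w] by blast
  ultimately have "take k w \<in> stopped \<Lambda> N \<rho>" using k by (auto simp: stopped_def)
  then show ?thesis using take_is_prefix by blast
qed

text \<open>
  The mass distribution principle, with the measure replaced by the finite sums
  \<open>\<Sum> P w\<close> over the words \<open>w\<close> of one large length \<open>n\<close>, each placed at the point \<open>x w\<close>. A ball of radius
  \<open>\<rho>\<close> receives mass only from words that extend some \<open>u \<in> stopped \<Lambda> N \<rho>\<close>. All extensions of \<open>u\<close>
  together weigh \<open>P u \<le> \<rho>\<^sup>s\<close>, and the disjoint balls \<open>Y u w\<close> bound the number of such \<open>u\<close> that occur.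
  So a ball has mass at most \<open>Q \<rho>\<^sup>s\<close>, whereas the total mass is \<open>1\<close>; a finite cover of \<open>K\<close> by balls
  with small \<open>\<Sum> \<rho>\<^sup>s\<close> is therefore impossible. The centre \<open>Y u w\<close> may depend on the witness \<open>w\<close>,
  so that it can be \<open>x w\<close> itself, as it will be under strong separation.
\<close>

lemma hausdorff_measure_nonzero_of_tree:
  fixes K :: "'a::euclidean_space set" and x :: "'i list \<Rightarrow> 'a" and p :: "'i \<Rightarrow> real"
  assumes "0 < s" "compact K" and fin: "finite \<Lambda>" and p: "\<And>i. i \<in> \<Lambda> \<Longrightarrow> 0 \<le> p i" "sum p \<Lambda> = 1"
    and x: "\<And>w. set w \<subseteq> \<Lambda> \<Longrightarrow> x w \<in> K"
    and weight: "\<And>u. set u \<subseteq> \<Lambda> \<Longrightarrow> prod_list (map p u) \<le> N u powr s"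
    and N_pos: "\<And>u. set u \<subseteq> \<Lambda> \<Longrightarrow> 0 < N u"
    and r: "0 < r" "r < 1" and N_le: "\<And>u. set u \<subseteq> \<Lambda> \<Longrightarrow> N u \<le> r ^ length u"
    and ab: "0 < a" "0 \<le> b"
    and inside: "\<And>\<rho> u w. 0 < \<rho> \<Longrightarrow> \<rho> \<le> 1 \<Longrightarrow> u \<in> stopped \<Lambda> N \<rho> \<Longrightarrow> set w \<subseteq> \<Lambda> \<Longrightarrow> prefix u w \<Longrightarrow>
      ball (Y u w) (a * \<rho>) \<subseteq> ball (x w) (b * \<rho>)"
    and apart: "\<And>\<rho> u w u' w'. 0 < \<rho> \<Longrightarrow> \<rho> \<le> 1 \<Longrightarrow> u \<in> stopped \<Lambda> N \<rho> \<Longrightarrow> u' \<in> stopped \<Lambda> N \<rho> \<Longrightarrow> u \<noteq> u' \<Longrightarrow>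
      set w \<subseteq> \<Lambda> \<Longrightarrow> set w' \<subseteq> \<Lambda> \<Longrightarrow> prefix u w \<Longrightarrow> prefix u' w' \<Longrightarrow>
      ball (Y u w) (a * \<rho>) \<inter> ball (Y u' w') (a * \<rho>) = {}"
  shows "hausdorff_measure s K \<noteq> 0"
proof
  assume zero: "hausdorff_measure s K = 0"
  define P where "P w = prod_list (map p w)" for w
  define W where "W n = {w. set w \<subseteq> \<Lambda> \<and> length w = n}" for n
  define Q where "Q = ((b + 1) / a) ^ DIM('a)"
  have Q: "0 < Q" using ab by (simp add: Q_def)
  have finW: "finite (W n)" for n unfolding W_def using finite_lists_length_eq[OF fin] .
  have P_nonneg: "0 \<le> P w" if "set w \<subseteq> \<Lambda>" for w
    unfolding P_def using that p(1) by (intro prod_list_nonneg) auto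
  have mass: "(\<Sum>w\<in>{w \<in> W n. x w \<in> ball c \<rho>}. P w) \<le> Q * \<rho> powr s"
    if \<rho>: "0 < \<rho>" "\<rho> \<le> 1" and n: "r ^ n < \<rho>" for \<rho> c n
  proof -
    define A where "A = {w \<in> W n. x w \<in> ball c \<rho>}"
    have "\<exists>u \<in> stopped \<Lambda> N \<rho>. prefix u w" if "w \<in> A" for w
      using that N_le[of w] n by (intro ex_stopped_prefix) (auto simp: A_def W_def)
    then obtain st where st: "\<And>w. w \<in> A \<Longrightarrow> st w \<in> stopped \<Lambda> N \<rho> \<and> prefix (st w) w" by metis
    have finA: "finite A" using finW by (simp add: A_def)
    define S where "S = st ` A"
    have finS: "finite S" using finA by (simp add: S_def)
    \<comment> \<open>One word of the ball is chosen for every stopped prefix that occurs in it.\<close>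
    define wit where "wit u = (SOME w. w \<in> A \<and> st w = u)" for u
    have wit: "wit u \<in> A \<and> st (wit u) = u" if "u \<in> S" for u
    proof -
      have "\<exists>w. w \<in> A \<and> st w = u" using that by (auto simp: S_def)
      then show ?thesis unfolding wit_def by (rule someI_ex)
    qed
    have "real (card S) \<le> (((b + 1) * \<rho>) / (a * \<rho>)) ^ DIM('a)"
    proof (rule card_disjoint_balls_le[OF finS])
      show "0 < a * \<rho>" "0 \<le> (b + 1) * \<rho>" using ab \<rho> by auto
      show "disjoint_family_on (\<lambda>u. ball (Y u (wit u)) (a * \<rho>)) S"
        unfolding disjoint_family_on_def
      proof (intro ballI impI)
        fix u u' assume u: "u \<in> S" "u' \<in> S" "u \<noteq> u'"
        have "wit u \<in> A" "wit u' \<in> A" "u \<in> stopped \<Lambda> N \<rho>" "u' \<in> stopped \<Lambda> N \<rho>" "prefix u (wit u)" "prefix u' (wit u')"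
          using wit[OF u(1)] wit[OF u(2)] st[of "wit u"] st[of "wit u'"] by simp_all
        then show "ball (Y u (wit u)) (a * \<rho>) \<inter> ball (Y u' (wit u')) (a * \<rho>) = {}"
          using \<rho> u(3) by (intro apart) (auto simp: A_def W_def)
      qed
      show "ball (Y u (wit u)) (a * \<rho>) \<subseteq> ball c ((b + 1) * \<rho>)" if "u \<in> S" for u
      proof -
        have A: "wit u \<in> A" "u \<in> stopped \<Lambda> N \<rho>" "prefix u (wit u)"
          using wit[OF that] st by metis+
        then have "ball (Y u (wit u)) (a * \<rho>) \<subseteq> ball (x (wit u)) (b * \<rho>)"
          using \<rho> by (intro inside) (auto simp: A_def W_def)
        also have "\<dots> \<subseteq> ball c ((b + 1) * \<rho>)"
        proof
          fix z assume "z \<in> ball (x (wit u)) (b * \<rho>)"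
          moreover have "dist c (x (wit u)) < \<rho>" using A(1) by (simp add: A_def)
          ultimately show "z \<in> ball c ((b + 1) * \<rho>)"
            using dist_triangle[of c z "x (wit u)"] by (simp add: distrib_right)
        qed
        finally show ?thesis .
      qed
    qed
    then have cardS: "real (card S) \<le> Q" using \<rho> by (simp add: Q_def)
    have "(\<Sum>w\<in>A. P w) = (\<Sum>u\<in>S. \<Sum>w\<in>{w \<in> A. st w = u}. P w)"
      unfolding S_def using finA by (rule sum.image_gen)
    also have "\<dots> \<le> (\<Sum>u\<in>S. \<rho> powr s)"
    proof (rule sum_mono)
      fix u assume "u \<in> S"
      then have u: "wit u \<in> A" "u \<in> stopped \<Lambda> N \<rho>" "prefix u (wit u)"
        using wit st by metis+
      then have len: "length u \<le> n" "set u \<subseteq> \<Lambda>"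
        by (auto simp: A_def W_def stopped_def dest: prefix_length_le)
      let ?E = "{w. set w \<subseteq> \<Lambda> \<and> length w = n \<and> take (length u) w = u}"
      have "(\<Sum>w\<in>{w \<in> A. st w = u}. P w) \<le> (\<Sum>w\<in>?E. P w)"
      proof (rule sum_mono2)
        show "finite ?E" by (rule finite_subset[OF _ finW[of n]]) (auto simp: W_def)
        show "{w \<in> A. st w = u} \<subseteq> ?E"
        proof
          fix w assume w: "w \<in> {w \<in> A. st w = u}"
          then have "take (length u) w = u" using st[of w] by (metis (mono_tags, lifting) append_eq_conv_conj mem_Collect_eq prefix_def)
          then show "w \<in> ?E" using w by (auto simp: A_def W_def)
        qed
      qed (use P_nonneg in auto)
      also have "\<dots> = P u" unfolding P_def using sum_prod_list_extensions[OF fin p(2) len(2,1)] .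
      also have "\<dots> \<le> N u powr s" unfolding P_def by (rule weight[OF len(2)])
      also have "\<dots> \<le> \<rho> powr s"
        using u(2) N_pos[OF len(2)] \<open>0 < s\<close> by (intro powr_mono2) (auto simp: stopped_def)
      finally show "(\<Sum>w\<in>{w \<in> A. st w = u}. P w) \<le> \<rho> powr s" .
    qed
    also have "\<dots> \<le> Q * \<rho> powr s" using cardS by (simp add: mult_right_mono)
    finally show ?thesis unfolding A_def .
  qed
  obtain I :: "('a \<times> real) set" where I: "finite I" "\<And>c \<rho>. (c, \<rho>) \<in> I \<Longrightarrow> 0 < \<rho> \<and> \<rho> \<le> 1"
    "K \<subseteq> (\<Union>(c, \<rho>)\<in>I. ball c \<rho>)" "(\<Sum>(c, \<rho>)\<in>I. \<rho> powr s) < 1 / Q"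
  proof -
    obtain I :: "('a \<times> real) set" where I: "finite I" "\<forall>(c, \<rho>)\<in>I. 0 < \<rho> \<and> \<rho> \<le> 1"
      "K \<subseteq> (\<Union>(c, \<rho>)\<in>I. ball c \<rho>)" "(\<Sum>(c, \<rho>)\<in>I. \<rho> powr s) < 1 / Q"
      using hausdorff_measure_0_ball_cover[OF zero \<open>0 < s\<close> \<open>compact K\<close>, of "1 / Q"] Q by (meson zero_less_divide_1_iff)
    show thesis by (rule that[OF I(1) _ I(3,4)]) (use I(2) in blast)
  qed
  have "\<exists>n. \<forall>(c, \<rho>)\<in>I. r ^ n < \<rho>"
  proof -
    have "(\<lambda>n. r ^ n) \<longlonglongrightarrow> 0" using r by (intro LIMSEQ_power_zero) auto
    then have "\<forall>\<^sub>F n in sequentially. r ^ n < \<rho>" if "(c, \<rho>) \<in> I" for c \<rho>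
      using I(2)[OF that] by (intro order_tendstoD) auto
    then have "\<forall>\<^sub>F n in sequentially. \<forall>z\<in>I. r ^ n < snd z"
      using I(1) by (auto simp: eventually_ball_finite_distrib)
    then obtain n where "\<forall>z\<in>I. r ^ n < snd z" using eventually_happens sequentially_bot by blast
    then show ?thesis by fastforce
  qed
  then obtain n where n: "\<And>c \<rho>. (c, \<rho>) \<in> I \<Longrightarrow> r ^ n < \<rho>" by blast
  have "1 = (\<Sum>w\<in>W n. P w)"
    unfolding W_def P_def sum_prod_list_words[OF fin] p(2) by simp
  also have "\<dots> \<le> (\<Sum>w\<in>(\<Union>z\<in>I. {w \<in> W n. x w \<in> ball (fst z) (snd z)}). P w)"
  proof (rule sum_mono2)
    show "W n \<subseteq> (\<Union>z\<in>I. {w \<in> W n. x w \<in> ball (fst z) (snd z)})"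
    proof
      fix w assume w: "w \<in> W n"
      then have "x w \<in> K" using x by (auto simp: W_def)
      then obtain z where "z \<in> I" "x w \<in> ball (fst z) (snd z)" using I(3) by (auto simp: split_beta)
      then show "w \<in> (\<Union>z\<in>I. {w \<in> W n. x w \<in> ball (fst z) (snd z)})" using w by blast
    qed
    show "finite (\<Union>z\<in>I. {w \<in> W n. x w \<in> ball (fst z) (snd z)})"
      using finW[of n] I(1) by simp
  qed (use P_nonneg in \<open>auto simp: W_def\<close>)
  also have "\<dots> \<le> (\<Sum>z\<in>I. \<Sum>w\<in>{w \<in> W n. x w \<in> ball (fst z) (snd z)}. P w)"
    by (rule sum_UN_le) (use I(1) finW[of n] P_nonneg in \<open>auto simp: W_def intro: rev_finite_subset\<close>)
  also have "\<dots> \<le> (\<Sum>z\<in>I. Q * snd z powr s)"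
  proof (rule sum_mono)
    fix z assume "z \<in> I"
    then have "(fst z, snd z) \<in> I" by simp
    then show "(\<Sum>w\<in>{w \<in> W n. x w \<in> ball (fst z) (snd z)}. P w) \<le> Q * snd z powr s"
      using I(2)[of "fst z" "snd z"] n[of "fst z" "snd z"] by (intro mass) auto
  qed
  also have "\<dots> = Q * (\<Sum>(c, \<rho>)\<in>I. \<rho> powr s)"
    by (simp add: sum_distrib_left split_beta)
  also have "\<dots> < 1" using I(4) Q by (simp add: field_simps)
  finally show False by simp
qed

section \<open>Strong components\<close>

text \<open>
  The component of \<open>v\<close> is induced by the vertices that can be reached from \<open>v\<close> and lead back to \<open>v\<close>.
  It contains every edge of every closed path through \<open>v\<close>, which is what the last conjunct says.
\<close>

lemma ex_strong_component:
  fixes G :: "('v, 'e) pre_digraph"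
  assumes wf: "wf_digraph G" and v: "(v, v) \<in> (arcs_ends G)\<^sup>+"
  shows "\<exists>H\<in>strong_components G. subgraph H G \<and>
    (\<forall>a b. (a, b) \<in> arcs_ends G \<longrightarrow> (v, a) \<in> (arcs_ends G)\<^sup>* \<longrightarrow> (b, v) \<in> (arcs_ends G)\<^sup>* \<longrightarrow> (a, b) \<in> arcs_ends H)"
proof -
  interpret wf_digraph G by (rule wf)
  let ?E = "arcs_ends G"
  define W where "W = {u. (v, u) \<in> ?E\<^sup>+ \<and> (u, v) \<in> ?E\<^sup>+}"
  define H where "H = G \<restriction> W"
  have vW: "v \<in> W" using v by (simp add: W_def)
  have W_verts: "W \<subseteq> verts G"
  proof
    fix u assume "u \<in> W"
    then have "(u, v) \<in> ?E\<^sup>+" by (simp add: W_def)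
    then obtain w where "(u, w) \<in> ?E" by (meson tranclD)
    then show "u \<in> verts G" by auto
  qed
  have H_simps: "verts H = W" "arcs H = {e \<in> arcs G. tail G e \<in> W \<and> head G e \<in> W}" "tail H = tail G" "head H = head G"
    by (auto simp: H_def induce_subgraph_def)
  have sub: "subgraph H G"
    unfolding H_def by (rule subgraph_induce_subgraphI[OF W_verts])
  have edge: "(a, b) \<in> arcs_ends H" if "(a, b) \<in> ?E" "a \<in> W" "b \<in> W" for a b
    using that by (auto simp: arcs_ends_conv H_simps)
  have to_v: "(u, v) \<in> (arcs_ends H)\<^sup>+" if "(u, v) \<in> ?E\<^sup>+" "(v, u) \<in> ?E\<^sup>+" for u
    using that
  proof (induction rule: converse_trancl_induct)
    case (base y)
    then show ?case using vW by (intro r_into_trancl edge) (auto simp: W_def)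
  next
    case (step y z)
    have "(v, z) \<in> ?E\<^sup>+" using step by (meson trancl.trancl_into_trancl)
    moreover have "(y, z) \<in> arcs_ends H"
      using step calculation by (intro edge) (auto simp: W_def intro: trancl_into_trancl2)
    ultimately show ?case using step.IH by (meson trancl_into_trancl2)
  qed
  have from_v: "(v, u) \<in> (arcs_ends H)\<^sup>+" if "(v, u) \<in> ?E\<^sup>+" "(u, v) \<in> ?E\<^sup>+" for u
    using that
  proof (induction rule: trancl_induct)
    case (base y)
    then show ?case using vW by (intro r_into_trancl edge) (auto simp: W_def)
  next
    case (step y z)
    have "(y, v) \<in> ?E\<^sup>+" using step by (meson trancl_into_trancl2)
    moreover have "(y, z) \<in> arcs_ends H"
      using step calculation by (intro edge) (auto simp: W_def intro: trancl.trancl_into_trancl)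
    ultimately show ?case using step.IH by (meson trancl.trancl_into_trancl)
  qed
  have psc: "pos_strongly_connected H"
    unfolding pos_strongly_connected_def H_simps using vW to_v from_v
    by (auto simp: W_def intro: trancl_trans)
  have max: "H' = H" if H': "subgraph H H'" "subgraph H' G" "pos_strongly_connected H'" for H'
  proof -
    have "v \<in> verts H'" using H'(1) vW by (auto simp: subgraph_def H_simps)
    have mono: "arcs_ends H' \<subseteq> ?E" using H'(2) by (auto simp: subgraph_def compatible_def arcs_ends_conv)
    have "verts H' \<subseteq> W"
    proof
      fix u assume "u \<in> verts H'"
      then have "(u, v) \<in> (arcs_ends H')\<^sup>+" "(v, u) \<in> (arcs_ends H')\<^sup>+"
        using H'(3) \<open>v \<in> verts H'\<close> by (auto simp: pos_strongly_connected_def)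
      then show "u \<in> W" using trancl_mono[OF _ mono] by (auto simp: W_def)
    qed
    interpret H': wf_digraph H' using H'(2) by (simp add: subgraph_def)
    have th: "tail H' = tail G" "head H' = head G" "arcs H' \<subseteq> arcs G" "verts H \<subseteq> verts H'" "arcs H \<subseteq> arcs H'"
      using H'(1,2) by (auto simp: subgraph_def compatible_def)
    have "arcs H' \<subseteq> arcs H"
      using th \<open>verts H' \<subseteq> W\<close> H'.head_in_verts H'.tail_in_verts by (auto simp: H_simps)
    then show ?thesis using th \<open>verts H' \<subseteq> W\<close> H_simps
      by (intro pre_digraph.equality) auto
  qed
  have "H \<in> strong_components G"
    unfolding strong_components_def max_subgraph_def mem_Collect_eq using sub psc max by blast
  moreover have "(a, b) \<in> arcs_ends H" if "(a, b) \<in> ?E" "(v, a) \<in> ?E\<^sup>*" "(b, v) \<in> ?E\<^sup>*" for a b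
  proof (rule edge[OF that(1)])
    have "(v, a) \<in> ?E\<^sup>+" "(b, v) \<in> ?E\<^sup>+" using v that(2,3) by (meson trancl_rtrancl_trancl rtrancl_trancl_trancl)+
    then show "a \<in> W" "b \<in> W" using that(1)
      by (auto simp: W_def intro: trancl_into_trancl2 trancl.trancl_into_trancl)
  qed
  ultimately show ?thesis using sub by blast
qed

section \<open>Compositions along paths\<close>

text \<open>
  The constants whose existence the hypotheses assert are parameters here, so that
  they can be named in statements. Of the derivative only its norm will matter: by conformality
  \<open>\<parallel>M\<parallel> = \<parallel>M\<parallel>\<^sub>i\<close>, and norms of derivatives are multiplicative along compositions.
\<close>

locale conformal_simple_gifs = gifs G J U T + nomulti_digraph G
  for G :: "('v, 'e) pre_digraph" and J U :: "'v \<Rightarrow> (real ^ 'n) set" and T :: "'e \<Rightarrow> real ^ 'n \<Rightarrow> real ^ 'n" +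
  fixes \<delta> r M c1 \<beta> :: real
  assumes conformal: "conformal_system G U T"
    and contractible: "contractible_seeds G J T"
    and \<delta>_pos: "0 < \<delta>" and \<delta>_setdist: "\<And>v. v \<in> verts G \<Longrightarrow> \<delta> \<le> setdist (J v) (- U v)"
    and r: "0 < r" "r < 1" and r_contracting: "\<And>e x. e \<in> arcs G \<Longrightarrow> x \<in> U (head G e) \<Longrightarrow> dnorm (T e) x \<le> r"
    and M: "\<And>v. v \<in> verts G \<Longrightarrow> diameter (J v) \<le> M"
    and c1: "0 < c1" and \<beta>: "0 < \<beta>"
    and distortion: "\<And>e x y. e \<in> arcs G \<Longrightarrow> x \<in> U (head G e) \<Longrightarrow> y \<in> U (head G e) \<Longrightarrow>
      \<bar>dnorm (T e) x - dnorm (T e) y\<bar> \<le> c1 * dnorm (T e) x * norm (x - y) powr \<beta>"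
begin

abbreviation tr :: "'v \<Rightarrow> 'v \<Rightarrow> real ^ 'n \<Rightarrow> real ^ 'n" where
  "tr \<equiv> arc_map G T"

abbreviation E :: "('v \<times> 'v) set" where "E \<equiv> arcs_ends G"

lemma tr_arc: "e \<in> arcs G \<Longrightarrow> tr (tail G e) (head G e) = T e"
  unfolding arc_map_def
  by (rule arg_cong[where f = T], rule the_equality) (auto simp: arc_to_ends_def intro: no_multi_arcs)

lemma E_arc:
  assumes "(u, v) \<in> E"
  obtains e where "e \<in> arcs G" "tail G e = u" "head G e = v" "tr u v = T e"
  using assms tr_arc by (auto simp: arcs_ends_def arc_to_ends_def)

lemma E_verts: "(u, v) \<in> E \<Longrightarrow> u \<in> verts G" "(u, v) \<in> E \<Longrightarrow> v \<in> verts G"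
  by (auto elim!: E_arc)

lemma ball_subset_U: "v \<in> verts G \<Longrightarrow> x \<in> J v \<Longrightarrow> ball x \<delta> \<subseteq> U v"
proof (rule subsetI, rule ccontr)
  fix y assume v: "v \<in> verts G" "x \<in> J v" and y: "y \<in> ball x \<delta>" "y \<notin> U v"
  have "setdist (J v) (- U v) \<le> dist x y" using v(2) y(2) by (intro setdist_le_dist) auto
  then show False using \<delta>_setdist[OF v(1)] y(1) by simp
qed

lemma J_subset_U: "v \<in> verts G \<Longrightarrow> J v \<subseteq> U v"
  using ball_subset_U \<delta>_pos by (meson centre_in_ball subset_iff)

lemma tr_J: "(u, v) \<in> E \<Longrightarrow> x \<in> J v \<Longrightarrow> tr u v x \<in> J u"
  using T_J by (metis E_arc image_subset_iff)

lemma tr_homeomorphism: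
  assumes "(u, v) \<in> E"
  shows "\<exists>W g. open W \<and> W \<subseteq> U u \<and> homeomorphism (U v) W (tr u v) g"
  using assms T_diffeomorphism unfolding C1_diffeomorphism_def by (metis E_arc)

lemma tr_derivative:
  assumes "(u, v) \<in> E" "x \<in> U v"
  shows "0 < dnorm (tr u v) x" "dnorm (tr u v) x \<le> r"
    "dinorm (tr u v) x = dnorm (tr u v) x"
    "\<exists>Q. orthogonal_transformation Q \<and> (tr u v has_derivative (\<lambda>h. dnorm (tr u v) x *\<^sub>R Q h)) (at x)"
proof -
  obtain e where e: "e \<in> arcs G" "tail G e = u" "head G e = v" "tr u v = T e"
    using E_arc[OF assms(1)] .
  have "conformal_on (T e) (U v)" using conformal e by (auto simp: conformal_system_def)
  then obtain c Q where Q: "0 < c" "orthogonal_transformation Q" "(tr u v has_derivative (\<lambda>h. c *\<^sub>R Q h)) (at x)"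
    using assms(2) e(4) unfolding conformal_on_def by metis
  have fd: "frechet_derivative (tr u v) (at x) = (\<lambda>h. c *\<^sub>R Q h)"
    using frechet_derivative_at[OF Q(3)] by simp
  have c: "dnorm (tr u v) x = c" using Q by (simp add: fd onorm_scaled_orthogonal)
  show "0 < dnorm (tr u v) x" "dinorm (tr u v) x = dnorm (tr u v) x"
    "\<exists>Q. orthogonal_transformation Q \<and> (tr u v has_derivative (\<lambda>h. dnorm (tr u v) x *\<^sub>R Q h)) (at x)"
    using Q unfolding c by (auto simp: fd inorm_scaled_orthogonal)
  show "dnorm (tr u v) x \<le> r" using r_contracting e assms(2) by simp
qed

lemma tr_distortion:
  assumes "(u, v) \<in> E" "x \<in> U v" "y \<in> U v"
  shows "dnorm (tr u v) y \<le> dnorm (tr u v) x * exp (c1 * dist x y powr \<beta>)"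
proof -
  obtain e where e: "e \<in> arcs G" "tail G e = u" "head G e = v" "tr u v = T e"
    using E_arc[OF assms(1)] .
  have "\<bar>dnorm (tr u v) x - dnorm (tr u v) y\<bar> \<le> c1 * dnorm (tr u v) x * dist x y powr \<beta>"
    using distortion[OF e(1)] assms e by (simp add: dist_norm)
  then have "dnorm (tr u v) y \<le> dnorm (tr u v) x * (1 + c1 * dist x y powr \<beta>)"
    by (simp add: algebra_simps abs_le_iff)
  also have "\<dots> \<le> dnorm (tr u v) x * exp (c1 * dist x y powr \<beta>)"
    using tr_derivative(1)[OF assms(1,2)] by (intro mult_left_mono exp_ge_add_one_self) auto
  finally show ?thesis .
qed

text \<open>
  \<open>U v\<close> need not be convex, so the mean value inequality is only available inside the balls of
  radius \<open>\<delta>\<close> around points of \<open>J v\<close>. This is why all local estimates below are about such balls.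
\<close>

lemma tr_ball_contraction:
  assumes "(u, v) \<in> E" "x \<in> J v" "y \<in> ball x \<delta>"
  shows "dist (tr u v x) (tr u v y) \<le> r * dist x y"
proof -
  have sub: "ball x \<delta> \<subseteq> U v" using ball_subset_U assms E_verts by blast
  have "norm (tr u v y - tr u v x) \<le> r * norm (y - x)"
  proof (rule differentiable_bound[of "ball x \<delta>" _ "\<lambda>z. frechet_derivative (tr u v) (at z)"])
    show "(tr u v has_derivative frechet_derivative (tr u v) (at z)) (at z within ball x \<delta>)" if "z \<in> ball x \<delta>" for z
      using tr_derivative(4)[OF assms(1)] sub that
      by (meson differentiable_def frechet_derivative_works has_derivative_at_withinI subsetD)
    show "onorm (frechet_derivative (tr u v) (at z)) \<le> r" if "z \<in> ball x \<delta>" for z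
      using tr_derivative(2)[OF assms(1)] sub that by blast
  qed (use assms \<delta>_pos in auto)
  then show ?thesis by (simp add: dist_norm norm_minus_commute)
qed

text \<open>
  A finite path is given by its nonempty list of vertices; \<open>vpath_map\<close> composes the maps along it, from the
  set of the last vertex to that of the first, and \<open>vpath_norm\<close> is the norm of the derivative of
  this composition. Two paths are concatenated by sharing a vertex, so the append rules have the
  shape \<open>p @ v # q\<close>. As rewrite rules they loop.
\<close>

fun vpath :: "'v list \<Rightarrow> bool" where
  "vpath [] = False"
| "vpath [u] = (u \<in> verts G)"
| "vpath (u # v # p) = ((u, v) \<in> E \<and> vpath (v # p))"

fun vpath_map :: "'v list \<Rightarrow> real ^ 'n \<Rightarrow> real ^ 'n" where
  "vpath_map [] = id"
| "vpath_map [u] = id"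
| "vpath_map (u # v # p) = tr u v \<circ> vpath_map (v # p)"

fun vpath_norm :: "'v list \<Rightarrow> real ^ 'n \<Rightarrow> real" where
  "vpath_norm [] x = 1"
| "vpath_norm [u] x = 1"
| "vpath_norm (u # v # p) x = dnorm (tr u v) (vpath_map (v # p) x) * vpath_norm (v # p) x"

lemma vpath_nonempty: "vpath p \<Longrightarrow> p \<noteq> []" by auto

lemma vpath_verts: "vpath p \<Longrightarrow> set p \<subseteq> verts G"
  by (induction p rule: vpath.induct) (auto simp: E_verts)

lemma vpath_last: "vpath p \<Longrightarrow> last p \<in> verts G"
  using vpath_verts[of p] vpath_nonempty[of p] last_in_set by blast

lemma vpath_append: "vpath (p @ v # q) \<longleftrightarrow> vpath (p @ [v]) \<and> vpath (v # q)"
proof (induction p rule: vpath.induct)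
  case (1)
  then show ?case using E_verts by (cases q) auto
next
  case (2 u)
  then show ?case using E_verts by (cases q) auto
qed auto

lemma vpath_map_append: "vpath_map (p @ v # q) = vpath_map (p @ [v]) \<circ> vpath_map (v # q)"
  by (induction p rule: vpath.induct) (simp_all add: o_assoc)

lemma vpath_norm_append:
  "vpath_norm (p @ v # q) x = vpath_norm (p @ [v]) (vpath_map (v # q) x) * vpath_norm (v # q) x"
proof (induction p rule: vpath.induct)
  case (3 u v' p)
  then show ?case using vpath_map_append[of "v' # p" v q] by simp
qed simp_all

lemma vpath_map_J: "vpath p \<Longrightarrow> x \<in> J (last p) \<Longrightarrow> vpath_map p x \<in> J (hd p)"
  by (induction p rule: vpath.induct) (auto simp: tr_J)

lemma vpath_homeomorphism:
  "vpath p \<Longrightarrow> \<exists>W g. open W \<and> W \<subseteq> U (hd p) \<and> homeomorphism (U (last p)) W (vpath_map p) g"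
proof (induction p rule: vpath.induct)
  case (2 u)
  then show ?case using U_open[of u] homeomorphism_ident[of "U u"]
    by (auto simp: id_def)
next
  case (3 u v p)
  then obtain W g where W: "open W" "W \<subseteq> U v" "homeomorphism (U (last (v # p))) W (vpath_map (v # p)) g"
    by auto
  obtain W' g' where W': "open W'" "W' \<subseteq> U u" "homeomorphism (U v) W' (tr u v) g'"
    using tr_homeomorphism 3 by (metis vpath.simps(3))
  have "v \<in> verts G" using 3 E_verts by auto
  have "openin (top_of_set W') (tr u v ` W)"
    using homeomorphism_imp_open_map[OF W'(3)] W(1,2) by (simp add: open_subset)
  then have "open (tr u v ` W)" "tr u v ` W \<subseteq> W'"
    using openin_open_eq[OF W'(1)] by simp_all
  moreover have "homeomorphism W (tr u v ` W) (tr u v) g'"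
    using W'(3) W(2) by (rule homeomorphism_of_subsets[where T''=W']) auto
  then have "homeomorphism (U (last (v # p))) (tr u v ` W) (tr u v \<circ> vpath_map (v # p)) (g \<circ> g')"
    using W(3) by (rule homeomorphism_compose[rotated])
  ultimately show ?case using W'(2) by (metis last_ConsR list.sel(1) list.distinct(1) order_trans vpath_map.simps(3))
qed simp

lemma vpath_map_U: "vpath p \<Longrightarrow> x \<in> U (last p) \<Longrightarrow> vpath_map p x \<in> U (hd p)"
proof -
  assume p: "vpath p" "x \<in> U (last p)"
  obtain W g where W: "W \<subseteq> U (hd p)" "homeomorphism (U (last p)) W (vpath_map p) g"
    using vpath_homeomorphism[OF p(1)] by metis
  then show ?thesis using p(2) homeomorphism_image1[OF W(2)] by blast
qed

lemma vpath_map_inj: "vpath p \<Longrightarrow> inj_on (vpath_map p) (U (last p))"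
  using vpath_homeomorphism[of p] unfolding homeomorphism_def by (metis inj_onI)

lemma vpath_map_continuous: "vpath p \<Longrightarrow> continuous_on (U (last p)) (vpath_map p)"
  using vpath_homeomorphism[of p] homeomorphism_cont1 by blast

lemma vpath_derivative:
  "vpath p \<Longrightarrow> x \<in> U (last p) \<Longrightarrow> 0 < vpath_norm p x \<and> vpath_norm p x \<le> r ^ (length p - 1) \<and>
     (\<exists>Q. orthogonal_transformation Q \<and> (vpath_map p has_derivative (\<lambda>h. vpath_norm p x *\<^sub>R Q h)) (at x))"
proof (induction p rule: vpath.induct)
  case (2 u)
  have "orthogonal_transformation (\<lambda>h::real^'n. h)" by (rule orthogonal_transformation_id)
  then show ?case by (auto simp: id_def intro!: exI[of _ "\<lambda>h. h"])
next
  case (3 u v p)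
  have E: "(u, v) \<in> E" and p: "vpath (v # p)" and x: "x \<in> U (last (v # p))" using 3 by auto
  let ?y = "vpath_map (v # p) x"
  obtain Q where Q: "orthogonal_transformation Q"
    "(vpath_map (v # p) has_derivative (\<lambda>h. vpath_norm (v # p) x *\<^sub>R Q h)) (at x)"
    and n: "0 < vpath_norm (v # p) x" "vpath_norm (v # p) x \<le> r ^ (length (v # p) - 1)"
    using 3(1)[OF p x] by blast
  have y: "?y \<in> U v" using vpath_map_U[OF p x] by simp
  obtain Q' where Q': "orthogonal_transformation Q'"
    "(tr u v has_derivative (\<lambda>h. dnorm (tr u v) ?y *\<^sub>R Q' h)) (at ?y)"
    using tr_derivative(4)[OF E y] by blast
  have "linear Q'" using Q'(1) orthogonal_transformation_linear by blast
  have "((tr u v \<circ> vpath_map (v # p)) has_derivative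
      ((\<lambda>h. dnorm (tr u v) ?y *\<^sub>R Q' h) \<circ> (\<lambda>h. vpath_norm (v # p) x *\<^sub>R Q h))) (at x)"
    by (rule diff_chain_at[OF Q(2) Q'(2)])
  also have "((\<lambda>h. dnorm (tr u v) ?y *\<^sub>R Q' h) \<circ> (\<lambda>h. vpath_norm (v # p) x *\<^sub>R Q h)) =
      (\<lambda>h. vpath_norm (u # v # p) x *\<^sub>R (Q' \<circ> Q) h)"
    using \<open>linear Q'\<close> by (auto simp: linear_scale fun_eq_iff)
  finally have "(vpath_map (u # v # p) has_derivative (\<lambda>h. vpath_norm (u # v # p) x *\<^sub>R (Q' \<circ> Q) h)) (at x)"
    by (simp only: vpath_map.simps)
  moreover have "orthogonal_transformation (Q' \<circ> Q)"
    using Q(1) Q'(1) by (simp add: orthogonal_transformation_compose)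
  moreover have "vpath_norm (u # v # p) x \<le> r * r ^ (length (v # p) - 1)"
    unfolding vpath_norm.simps using n tr_derivative(1,2)[OF E y] r by (intro mult_mono) auto
  moreover have "0 < vpath_norm (u # v # p) x" using n(1) tr_derivative(1)[OF E y] by simp
  ultimately show ?case by (metis One_nat_def diff_Suc_1 length_Cons power_Suc)
qed simp

lemmas vpath_norm_pos = vpath_derivative[THEN conjunct1]
lemmas vpath_norm_le = vpath_derivative[THEN conjunct2, THEN conjunct1]

lemma vpath_map_contraction:
  "vpath p \<Longrightarrow> x \<in> J (last p) \<Longrightarrow> y \<in> ball x \<delta> \<Longrightarrow>
     dist (vpath_map p x) (vpath_map p y) \<le> r ^ (length p - 1) * dist x y"
proof (induction p rule: vpath.induct)
  case (3 u v p)
  have E: "(u, v) \<in> E" and p: "vpath (v # p)" and x: "x \<in> J (last (v # p))" using 3 by auto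
  have IH: "dist (vpath_map (v # p) x) (vpath_map (v # p) y) \<le> r ^ (length (v # p) - 1) * dist x y"
    using 3(1)[OF p x 3(4)] .
  also have "\<dots> \<le> dist x y" using r by (intro mult_left_le_one_le power_le_one) auto
  also have "\<dots> < \<delta>" using 3(4) by simp
  finally have "vpath_map (v # p) y \<in> ball (vpath_map (v # p) x) \<delta>" by simp
  then have "dist (tr u v (vpath_map (v # p) x)) (tr u v (vpath_map (v # p) y)) \<le> r * dist (vpath_map (v # p) x) (vpath_map (v # p) y)"
    using tr_ball_contraction[OF E] vpath_map_J[OF p x] by simp
  also have "\<dots> \<le> r * (r ^ (length (v # p) - 1) * dist x y)" using IH r by (intro mult_left_mono) auto
  finally show ?case by simp
qed auto

text \<open>
  Bounds the ratio of the values of \<open>vpath_norm p\<close> at a point of \<open>J (last p)\<close> and at a point closer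
  to it than \<open>\<delta>\<close>, for paths of any length: after \<open>k\<close> maps the points are at distance at most
  \<open>r\<^sup>k \<delta>\<close>, so the logarithms of the ratios at the individual edges are dominated by the
  geometric series \<open>c\<^sub>1 \<Sum>\<^sub>k (r\<^sup>k \<delta>)\<^sup>\<beta>\<close>.
\<close>

definition B :: real where "B = exp (c1 * \<delta> powr \<beta> / (1 - r powr \<beta>))"

lemma r_powr: "0 < r powr \<beta>" "r powr \<beta> < 1"
  using r \<beta> powr_less_mono2[of \<beta> r 1] by auto

lemma B_ge_1: "1 \<le> B"
  unfolding B_def using r_powr c1 by (simp add: field_simps)

lemma vpath_norm_distortion_sum:
  "vpath p \<Longrightarrow> x \<in> J (last p) \<Longrightarrow> y \<in> ball x \<delta> \<Longrightarrow>
     vpath_norm p y \<le> vpath_norm p x * exp (c1 * \<delta> powr \<beta> * (\<Sum>k<length p - 1. (r powr \<beta>) ^ k)) \<and>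
     vpath_norm p x \<le> vpath_norm p y * exp (c1 * \<delta> powr \<beta> * (\<Sum>k<length p - 1. (r powr \<beta>) ^ k))"
proof (induction p rule: vpath.induct)
  case (3 u v p)
  have E: "(u, v) \<in> E" and p: "vpath (v # p)" and x: "x \<in> J (last (v # p))" using 3 by auto
  let ?n = "length (v # p) - 1" and ?f = "vpath_map (v # p)"
  let ?e = "exp (c1 * \<delta> powr \<beta> * (\<Sum>k<?n. (r powr \<beta>) ^ k))"
  have U: "x \<in> U (last (v # p))" "y \<in> U (last (v # p))"
    using ball_subset_U[OF vpath_last[OF p] x] J_subset_U[OF vpath_last[OF p]] x 3(4) by blast+
  have pos: "0 < vpath_norm (v # p) x" "0 < vpath_norm (v # p) y" using vpath_norm_pos[OF p] U by auto
  have "dist (?f x) (?f y) \<le> r ^ ?n * dist x y" using vpath_map_contraction[OF p x 3(4)] .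
  also have "\<dots> \<le> r ^ ?n * \<delta>" using r 3(4) by (intro mult_left_mono) auto
  finally have "dist (?f x) (?f y) powr \<beta> \<le> (r ^ ?n * \<delta>) powr \<beta>"
    using \<beta> by (intro powr_mono2) auto
  also have "\<dots> = (r powr \<beta>) ^ ?n * \<delta> powr \<beta>"
    using r \<delta>_pos by (simp add: powr_mult powr_power[symmetric] powr_realpow[symmetric] powr_powr mult.commute)
  finally have dp: "c1 * dist (?f x) (?f y) powr \<beta> \<le> c1 * \<delta> powr \<beta> * (r powr \<beta>) ^ ?n"
    using c1 by (simp add: mult.assoc mult.commute)
  have fU: "?f x \<in> U v" "?f y \<in> U v" using vpath_map_U[OF p] U by auto
  from dp have e1: "exp (c1 * dist (?f x) (?f y) powr \<beta>) \<le> exp (c1 * \<delta> powr \<beta> * (r powr \<beta>) ^ ?n)" by simp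
  have 1: "dnorm (tr u v) (?f y) \<le> dnorm (tr u v) (?f x) * exp (c1 * \<delta> powr \<beta> * (r powr \<beta>) ^ ?n)"
    using order_trans[OF tr_distortion[OF E fU] mult_left_mono[OF e1 less_imp_le[OF tr_derivative(1)[OF E fU(1)]]]] .
  have 2: "dnorm (tr u v) (?f x) \<le> dnorm (tr u v) (?f y) * exp (c1 * \<delta> powr \<beta> * (r powr \<beta>) ^ ?n)"
    using order_trans[OF tr_distortion[OF E fU(2,1)] mult_left_mono[OF e1[unfolded dist_commute[of "?f x"]] less_imp_le[OF tr_derivative(1)[OF E fU(2)]]]] .
  have IH: "vpath_norm (v # p) y \<le> vpath_norm (v # p) x * ?e" "vpath_norm (v # p) x \<le> vpath_norm (v # p) y * ?e"
    using 3(1)[OF p x 3(4)] by auto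
  have ee: "exp (c1 * \<delta> powr \<beta> * (\<Sum>k<length (u # v # p) - 1. (r powr \<beta>) ^ k)) = exp (c1 * \<delta> powr \<beta> * (r powr \<beta>) ^ ?n) * ?e"
    by (simp add: exp_add[symmetric] algebra_simps)
  have "vpath_norm (u # v # p) y \<le> (dnorm (tr u v) (?f x) * exp (c1 * \<delta> powr \<beta> * (r powr \<beta>) ^ ?n)) * (vpath_norm (v # p) x * ?e)"
    unfolding vpath_norm.simps using 1 IH(1) pos tr_derivative(1)[OF E fU(1)] by (intro mult_mono) auto
  moreover have "vpath_norm (u # v # p) x \<le> (dnorm (tr u v) (?f y) * exp (c1 * \<delta> powr \<beta> * (r powr \<beta>) ^ ?n)) * (vpath_norm (v # p) y * ?e)"
    unfolding vpath_norm.simps using 2 IH(2) pos tr_derivative(1)[OF E fU(2)] by (intro mult_mono) auto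
  ultimately show ?case unfolding ee by (simp add: mult_ac)
qed auto

lemma vpath_norm_local_distortion:
  assumes "vpath p" "x \<in> J (last p)" "y \<in> ball x \<delta>"
  shows "vpath_norm p y \<le> B * vpath_norm p x" "vpath_norm p x \<le> B * vpath_norm p y"
proof -
  let ?S = "\<Sum>k<length p - 1. (r powr \<beta>) ^ k"
  have "?S \<le> (\<Sum>k. (r powr \<beta>) ^ k)" using r_powr by (intro sum_le_suminf) auto
  also have "\<dots> = 1 / (1 - r powr \<beta>)" using r_powr by (simp add: suminf_geometric)
  finally have "c1 * \<delta> powr \<beta> * ?S \<le> c1 * \<delta> powr \<beta> * (1 / (1 - r powr \<beta>))"
    using c1 by (intro mult_left_mono) auto
  then have e: "exp (c1 * \<delta> powr \<beta> * ?S) \<le> B" by (simp add: B_def)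
  have U: "x \<in> U (last p)" "y \<in> U (last p)"
    using ball_subset_U[OF vpath_last[OF assms(1)] assms(2)] J_subset_U[OF vpath_last[OF assms(1)]] assms by blast+
  have pos: "0 < vpath_norm p x" "0 < vpath_norm p y" using vpath_norm_pos[OF assms(1)] U by auto
  show "vpath_norm p y \<le> B * vpath_norm p x" "vpath_norm p x \<le> B * vpath_norm p y"
    using vpath_norm_distortion_sum[OF assms] e pos
    by (smt (verit) mult.commute mult_left_mono)+
qed

lemma vpath_map_local_Lipschitz:
  assumes "vpath p" "x \<in> J (last p)" "y \<in> ball x \<delta>"
  shows "dist (vpath_map p x) (vpath_map p y) \<le> B * vpath_norm p x * dist x y"
proof -
  have sub: "ball x \<delta> \<subseteq> U (last p)" using ball_subset_U vpath_last assms by blast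
  then have "\<forall>z\<in>ball x \<delta>. \<exists>Q. orthogonal_transformation Q \<and> (vpath_map p has_derivative (\<lambda>h. vpath_norm p z *\<^sub>R Q h)) (at z)"
    using vpath_derivative[OF assms(1)] by blast
  then obtain Q where Q: "\<And>z. z \<in> ball x \<delta> \<Longrightarrow> orthogonal_transformation (Q z) \<and> (vpath_map p has_derivative (\<lambda>h. vpath_norm p z *\<^sub>R Q z h)) (at z)"
    by metis
  have "norm (vpath_map p y - vpath_map p x) \<le> B * vpath_norm p x * norm (y - x)"
  proof (rule differentiable_bound[of "ball x \<delta>" _ "\<lambda>z h. vpath_norm p z *\<^sub>R Q z h"])
    show "(vpath_map p has_derivative (\<lambda>h. vpath_norm p z *\<^sub>R Q z h)) (at z within ball x \<delta>)" if "z \<in> ball x \<delta>" for z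
      using Q[OF that] has_derivative_at_withinI by blast
    show "onorm (\<lambda>h. vpath_norm p z *\<^sub>R Q z h) \<le> B * vpath_norm p x" if z: "z \<in> ball x \<delta>" for z
      using onorm_scaled_orthogonal[of "Q z" "vpath_norm p z"] Q[OF z] vpath_norm_local_distortion(1)[OF assms(1,2) z]
        vpath_norm_pos[OF assms(1)] sub z by (metis less_imp_le subsetD)
  qed (use assms \<delta>_pos in auto)
  then show ?thesis by (simp add: dist_norm norm_minus_commute)
qed

text \<open>
  By conformality the inverse of the composition has derivative of norm \<open>1 / vpath_norm p z\<close> at the
  image of \<open>z\<close>, which the local distortion bound compares with its value at the centre.
\<close>

lemma ball_subset_vpath_map_image:
  assumes p: "vpath p" and x: "x \<in> J (last p)" and \<epsilon>: "0 < \<epsilon>" "\<epsilon> \<le> \<delta>"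
  shows "ball (vpath_map p x) (vpath_norm p x / B * \<epsilon>) \<subseteq> vpath_map p ` ball x \<epsilon>"
proof -
  obtain W g where W: "open W" "homeomorphism (U (last p)) W (vpath_map p) g"
    using vpath_homeomorphism[OF p] by metis
  have sub: "ball x \<epsilon> \<subseteq> U (last p)"
    using ball_subset_U[OF vpath_last[OF p] x] \<epsilon> by (meson order_trans subset_ball)
  have xU: "x \<in> U (last p)" using sub \<epsilon> by auto
  have "\<exists>g'. (g has_derivative g') (at q) \<and> onorm g' \<le> 1 / (vpath_norm p x / B)" if q: "q \<in> vpath_map p ` ball x \<epsilon>" for q
  proof -
    obtain z where z: "z \<in> ball x \<epsilon>" "q = vpath_map p z" using q by blast
    have zU: "z \<in> U (last p)" using sub z by blast
    have gz: "g q = z" using homeomorphism_apply1[OF W(2) zU] z(2) by simp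
    have qW: "q \<in> W" using homeomorphism_image1[OF W(2)] zU z(2) by blast
    define c where "c = vpath_norm p z"
    obtain Q where Q: "orthogonal_transformation Q" "(vpath_map p has_derivative (\<lambda>h. c *\<^sub>R Q h)) (at z)"
      and c: "0 < c" using vpath_derivative[OF p zU] unfolding c_def by blast
    have Qi: "orthogonal_transformation (inv Q)" by (rule orthogonal_transformation_inv[OF Q(1)])
    have lin: "linear (inv Q)" using Qi orthogonal_transformation_linear by blast
    have "(g has_derivative (\<lambda>h. (1 / c) *\<^sub>R inv Q h)) (at q)"
    proof (rule has_derivative_inverse_basic[where f = "vpath_map p" and T = W])
      show "(vpath_map p has_derivative (\<lambda>h. c *\<^sub>R Q h)) (at (g q))" using Q(2) gz by simp
      show "bounded_linear (\<lambda>h. (1 / c) *\<^sub>R inv Q h)"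
        using lin by (intro bounded_linear_compose[OF bounded_linear_scaleR_right]) (simp add: linear_linear)
      show "(\<lambda>h. (1 / c) *\<^sub>R inv Q h) \<circ> (\<lambda>h. c *\<^sub>R Q h) = id"
        using lin c orthogonal_transformation_inj[OF Q(1)] by (auto simp: fun_eq_iff linear_scale)
      show "continuous (at q) g"
        using homeomorphism_cont2[OF W(2)] W(1) qW by (simp add: continuous_on_eq_continuous_at)
      show "vpath_map p (g z) = z" if "z \<in> W" for z using homeomorphism_apply2[OF W(2) that] .
    qed (use W qW in auto)
    moreover have "onorm (\<lambda>h. (1 / c) *\<^sub>R inv Q h) = 1 / c"
      using onorm_scaled_orthogonal[OF Qi] c by simp
    moreover have "1 / c \<le> 1 / (vpath_norm p x / B)"
    proof -
      have "vpath_norm p x \<le> B * c"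
        unfolding c_def using vpath_norm_local_distortion(2)[OF p x] z(1) \<epsilon> by auto
      then have "vpath_norm p x / B \<le> c" using B_ge_1 by (simp add: field_simps)
      then show ?thesis using vpath_norm_pos[OF p xU] B_ge_1 c by (intro divide_left_mono) auto
    qed
    ultimately show ?thesis by metis
  qed
  then obtain g' where g': "\<And>q. q \<in> vpath_map p ` ball x \<epsilon> \<Longrightarrow>
      (g has_derivative g' q) (at q) \<and> onorm (g' q) \<le> 1 / (vpath_norm p x / B)"
    by metis
  show ?thesis
    by (rule ball_subset_image_ball[OF W(2) U_open[OF vpath_last[OF p]] W(1) sub \<epsilon>(1) _ g'])
       (use vpath_norm_pos[OF p xU] B_ge_1 in auto)
qed

text \<open>
  The local bounds extend to all of \<open>J (last p)\<close> along a chain with steps shorter than \<open>\<delta>\<close>, whose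
  length is bounded uniformly over all vertices. In the Lipschitz estimate, points
  closer than \<open>\<delta>\<close> are compared directly; otherwise the set has diameter at least \<open>\<delta>\<close>, so that
  each step of the chain costs at most the diameter.
\<close>

lemma ex_distortion_constant:
  "\<exists>L\<ge>1. \<forall>p. vpath p \<longrightarrow> (\<forall>x\<in>J (last p). \<forall>y\<in>J (last p).
     vpath_norm p y \<le> L * vpath_norm p x \<and>
     dist (vpath_map p x) (vpath_map p y) \<le> L * vpath_norm p x * diameter (J (last p)))"
proof -
  from connected_imp_bounded_chain[OF \<delta>_pos, of M]
  obtain N where N: "\<forall>S :: (real ^ 'n) set. Topological_Spaces.connected S \<longrightarrow> bounded S \<longrightarrow> diameter S \<le> M \<longrightarrow>
      (\<forall>x\<in>S. \<forall>y\<in>S. \<exists>k\<le>N. (x, y) \<in> {(a, b). a \<in> S \<and> b \<in> S \<and> dist a b < \<delta>} ^^ k)"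
    by (rule exE)
  define L where "L = (real N + 1) * B ^ (N + 1)"
  have BN: "1 \<le> B ^ k" for k using B_ge_1 by (rule one_le_power)
  have Bmono: "B ^ j \<le> B ^ k" if "j \<le> k" for j k using B_ge_1 that by (rule power_increasing[rotated])
  have L: "B ^ N \<le> L" "B \<le> L" "real N * B ^ (N + 1) \<le> L" "1 \<le> L"
  proof -
    have "1 * B ^ (N + 1) \<le> L" unfolding L_def using B_ge_1 by (intro mult_right_mono) auto
    then show "B ^ N \<le> L" "B \<le> L" "1 \<le> L" using Bmono[of N "N+1"] Bmono[of 1 "N+1"] BN[of "N+1"] by auto
    show "real N * B ^ (N + 1) \<le> L" unfolding L_def using B_ge_1 by (intro mult_right_mono) auto
  qed
  have "vpath_norm p y \<le> L * vpath_norm p x \<and> dist (vpath_map p x) (vpath_map p y) \<le> L * vpath_norm p x * diameter (J (last p))"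
    if p: "vpath p" and xy: "x \<in> J (last p)" "y \<in> J (last p)" for p x y
  proof -
    let ?S = "J (last p)"
    let ?R = "{(a, b). a \<in> ?S \<and> b \<in> ?S \<and> dist a b < \<delta>}"
    have v: "last p \<in> verts G" using vpath_last[OF p] .
    have pos: "0 < vpath_norm p z" if "z \<in> ?S" for z
      using vpath_norm_pos[OF p] J_subset_U[OF v] that by blast
    have bdd: "bounded ?S" using J_compact[OF v] compact_imp_bounded by blast
    \<comment> \<open>Both bounds are carried along the first \<open>k\<close> steps of the chain.\<close>
    have chain: "vpath_norm p z \<le> B ^ k * vpath_norm p x \<and>
        dist (vpath_map p x) (vpath_map p z) \<le> real k * B ^ (k + 1) * vpath_norm p x * \<delta> \<and> z \<in> ?S"
      if "(x, z) \<in> ?R ^^ k" for k z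
      using that
    proof (induction k arbitrary: z)
      case 0
      then show ?case using xy by auto
    next
      case (Suc k)
      from Suc.prems obtain w where w': "(x, w) \<in> ?R ^^ k" "(w, z) \<in> ?R" by (rule relpow_Suc_E)
      then have w: "(x, w) \<in> ?R ^^ k" "w \<in> ?S" "z \<in> ?S" "dist w z < \<delta>" by simp_all
      have IH: "vpath_norm p w \<le> B ^ k * vpath_norm p x"
        "dist (vpath_map p x) (vpath_map p w) \<le> real k * B ^ (k + 1) * vpath_norm p x * \<delta>"
        using Suc.IH[OF w(1)] by auto
      have z: "z \<in> ball w \<delta>" using w by simp
      have px: "0 < vpath_norm p x" using pos xy by blast
      have "vpath_norm p z \<le> B * vpath_norm p w" using vpath_norm_local_distortion(1)[OF p w(2) z] .
      also have "\<dots> \<le> B * (B ^ k * vpath_norm p x)" using IH(1) B_ge_1 by (intro mult_left_mono) auto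
      finally have 1: "vpath_norm p z \<le> B ^ Suc k * vpath_norm p x" by simp
      have "dist (vpath_map p w) (vpath_map p z) \<le> B * vpath_norm p w * dist w z"
        using vpath_map_local_Lipschitz[OF p w(2) z] .
      also have "\<dots> \<le> B * (B ^ k * vpath_norm p x) * \<delta>"
        using IH(1) B_ge_1 w(4) pos[OF w(2)] px by (intro mult_mono mult_nonneg_nonneg) auto
      finally have "dist (vpath_map p x) (vpath_map p z) \<le> real k * B ^ (k + 1) * vpath_norm p x * \<delta> + B ^ (k + 1) * vpath_norm p x * \<delta>"
        using IH(2) dist_triangle[of "vpath_map p x" "vpath_map p z" "vpath_map p w"] by simp
      also have "\<dots> = real (Suc k) * (B ^ (k + 1) * (vpath_norm p x * \<delta>))" by (simp add: algebra_simps)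
      also have "\<dots> \<le> real (Suc k) * (B ^ (Suc k + 1) * (vpath_norm p x * \<delta>))"
        using px \<delta>_pos B_ge_1 by (intro mult_left_mono mult_right_mono power_increasing) auto
      finally show ?case using 1 w(3) by (simp add: mult_ac)
    qed
    obtain k where k: "k \<le> N" "(x, y) \<in> ?R ^^ k"
      using N[rule_format, OF J_connected[OF v] bdd M[OF v] xy] by (elim exE conjE)
    have px: "0 < vpath_norm p x" using pos xy by blast
    have "vpath_norm p y \<le> B ^ k * vpath_norm p x" using chain[OF k(2)] by blast
    also have "\<dots> \<le> L * vpath_norm p x" using Bmono[OF k(1)] L(1) px by (intro mult_right_mono) auto
    finally have 1: "vpath_norm p y \<le> L * vpath_norm p x" .
    have dxy: "dist x y \<le> diameter ?S" using diameter_bounded_bound[OF bdd xy] .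
    have "dist (vpath_map p x) (vpath_map p y) \<le> L * vpath_norm p x * diameter ?S"
    proof (cases "dist x y < \<delta>")
      case True
      then have "dist (vpath_map p x) (vpath_map p y) \<le> B * vpath_norm p x * dist x y"
        using vpath_map_local_Lipschitz[OF p xy(1)] by simp
      also have "\<dots> \<le> L * vpath_norm p x * diameter ?S"
        using L px dxy B_ge_1 by (intro mult_mono mult_nonneg_nonneg) auto
      finally show ?thesis .
    next
      case False
      have "dist (vpath_map p x) (vpath_map p y) \<le> real k * B ^ (k + 1) * vpath_norm p x * \<delta>"
        using chain[OF k(2)] by blast
      also have "\<dots> \<le> real N * B ^ (N + 1) * vpath_norm p x * diameter ?S"
        using False dxy k(1) px \<delta>_pos B_ge_1 by (intro mult_mono mult_nonneg_nonneg power_increasing) auto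
      also have "\<dots> \<le> L * vpath_norm p x * diameter ?S"
        using L(3) px dxy False \<delta>_pos by (intro mult_right_mono) auto
      finally show ?thesis .
    qed
    with 1 show ?thesis by blast
  qed
  then show ?thesis using L(4) by blast
qed

definition L :: real where
  "L = (SOME L. 1 \<le> L \<and> (\<forall>p. vpath p \<longrightarrow> (\<forall>x\<in>J (last p). \<forall>y\<in>J (last p).
     vpath_norm p y \<le> L * vpath_norm p x \<and>
     dist (vpath_map p x) (vpath_map p y) \<le> L * vpath_norm p x * diameter (J (last p)))))"

lemma L_ge_1: "1 \<le> L"
  and vpath_norm_distortion:
    "vpath p \<Longrightarrow> x \<in> J (last p) \<Longrightarrow> y \<in> J (last p) \<Longrightarrow> vpath_norm p y \<le> L * vpath_norm p x"
  and vpath_map_Lipschitz: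
    "vpath p \<Longrightarrow> x \<in> J (last p) \<Longrightarrow> y \<in> J (last p) \<Longrightarrow>
       dist (vpath_map p x) (vpath_map p y) \<le> L * vpath_norm p x * diameter (J (last p))"
  using someI_ex[OF ex_distortion_constant[unfolded Bex_def]] unfolding L_def[symmetric] by blast+

lemma vpath_map_J_dist:
  assumes "vpath p" "x \<in> J (last p)" "y \<in> J (last p)"
  shows "dist (vpath_map p x) (vpath_map p y) \<le> L * M * r ^ (length p - 1)"
proof -
  have v: "last p \<in> verts G" using vpath_last[OF assms(1)] .
  have "vpath_norm p x \<le> r ^ (length p - 1)" "0 < vpath_norm p x"
    using vpath_norm_le[OF assms(1)] vpath_norm_pos[OF assms(1)] J_subset_U[OF v] assms(2) by blast+
  moreover have "0 \<le> diameter (J (last p))" using J_compact[OF v] compact_imp_bounded diameter_ge_0 by blast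
  ultimately have "L * vpath_norm p x * diameter (J (last p)) \<le> L * r ^ (length p - 1) * M"
    using L_ge_1 M[OF v] r by (intro mult_mono mult_nonneg_nonneg) auto
  then show ?thesis using vpath_map_Lipschitz[OF assms] by (simp add: mult_ac)
qed

section \<open>The coding map\<close>

lemma path_map_conv_vpath_map:
  assumes "\<omega> \<in> path_space G"
  shows "vpath (map \<omega> [0..<Suc n]) \<and> path_map G T \<omega> n = vpath_map (map \<omega> [0..<Suc n])"
proof (induction n)
  case 0
  then show ?case using assms by (auto simp: path_space_def)
next
  case (Suc n)
  have eq: "map \<omega> [0..<Suc (Suc n)] = map \<omega> [0..<n] @ \<omega> n # [\<omega> (Suc n)]" by simp
  have eq': "map \<omega> [0..<Suc n] = map \<omega> [0..<n] @ [\<omega> n]" by simp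
  have "vpath [\<omega> n, \<omega> (Suc n)]" using assms by (auto simp: path_space_def)
  then show ?case unfolding eq
    using Suc.IH unfolding eq' by (subst vpath_append, subst vpath_map_append) auto
qed

lemma shift_path: "\<omega> \<in> path_space G \<Longrightarrow> shift \<omega> \<in> path_space G"
  by (auto simp: path_space_def shift_def)

lemma path_map_Suc_shift: "path_map G T \<omega> (Suc n) = tr (\<omega> 0) (\<omega> 1) \<circ> path_map G T (shift \<omega>) n"
proof (induction n)
  case (Suc n)
  have "path_map G T \<omega> (Suc (Suc n)) = path_map G T \<omega> (Suc n) \<circ> tr (\<omega> (Suc n)) (\<omega> (Suc (Suc n)))" by simp
  also have "\<dots> = tr (\<omega> 0) (\<omega> 1) \<circ> path_map G T (shift \<omega>) (Suc n)"
    unfolding Suc.IH by (simp add: shift_def o_assoc)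
  finally show ?case .
qed simp

text \<open>
  The intersection that defines \<^const>\<open>coding\<close>. It is a singleton, but \<^const>\<open>coding\<close> only refers to
  it by a definite description.
\<close>

definition coded_points :: "(nat \<Rightarrow> 'v) \<Rightarrow> (real ^ 'n) set" where
  "coded_points \<omega> = (\<Inter>k. path_map G T \<omega> (Suc k) ` J (\<omega> (Suc k)))"

lemma coded_points_unique:
  assumes "\<omega> \<in> path_space G" "x \<in> coded_points \<omega>" "y \<in> coded_points \<omega>"
  shows "x = y"
proof -
  have le: "dist x y \<le> L * M * r ^ Suc k" for k
  proof -
    have p: "vpath (map \<omega> [0..<Suc (Suc k)])" "path_map G T \<omega> (Suc k) = vpath_map (map \<omega> [0..<Suc (Suc k)])"
      using path_map_conv_vpath_map[OF assms(1)] by blast+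
    have "x \<in> path_map G T \<omega> (Suc k) ` J (\<omega> (Suc k))" "y \<in> path_map G T \<omega> (Suc k) ` J (\<omega> (Suc k))"
      using assms unfolding coded_points_def by blast+
    then obtain x' y' where xy: "x' \<in> J (\<omega> (Suc k))" "y' \<in> J (\<omega> (Suc k))"
      "x = vpath_map (map \<omega> [0..<Suc (Suc k)]) x'" "y = vpath_map (map \<omega> [0..<Suc (Suc k)]) y'"
      unfolding p(2) by blast
    then show ?thesis using vpath_map_J_dist[OF p(1), of x' y'] by simp
  qed
  have "(\<lambda>k. L * M * r ^ Suc k) \<longlonglongrightarrow> L * M * 0"
    using LIMSEQ_Suc[OF LIMSEQ_power_zero[of r]] r by (intro tendsto_mult tendsto_const) auto
  then have "dist x y \<le> 0" using le by (intro LIMSEQ_le_const) auto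
  then show ?thesis by simp
qed

lemma coded_points_nonempty:
  assumes "\<omega> \<in> path_space G"
  shows "coded_points \<omega> \<noteq> {}"
proof -
  have v: "\<omega> k \<in> verts G" for k using assms by (auto simp: path_space_def)
  have p: "vpath (map \<omega> [0..<Suc k])" "path_map G T \<omega> k = vpath_map (map \<omega> [0..<Suc k])" for k
    using path_map_conv_vpath_map[OF assms] by blast+
  have step: "path_map G T \<omega> (Suc k) ` J (\<omega> (Suc k)) \<subseteq> path_map G T \<omega> k ` J (\<omega> k)" for k
    using tr_J[of "\<omega> k" "\<omega> (Suc k)"] assms by (auto simp: path_space_def)
  have "(\<Inter>k. path_map G T \<omega> (Suc k) ` J (\<omega> (Suc k))) \<noteq> {}"
  proof (rule compact_nest)
    show "compact (path_map G T \<omega> (Suc k) ` J (\<omega> (Suc k)))" for k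
    proof (rule compact_continuous_image)
      have "last (map \<omega> [0..<Suc (Suc k)]) = \<omega> (Suc k)" by simp
      then show "continuous_on (J (\<omega> (Suc k))) (path_map G T \<omega> (Suc k))"
        using vpath_map_continuous[OF p(1)[of "Suc k"]] J_subset_U[OF v] continuous_on_subset
        unfolding p(2) by metis
    qed (rule J_compact[OF v])
    show "path_map G T \<omega> (Suc k) ` J (\<omega> (Suc k)) \<noteq> {}" for k using J_nonempty[OF v] by blast
    show "path_map G T \<omega> (Suc n) ` J (\<omega> (Suc n)) \<subseteq> path_map G T \<omega> (Suc m) ` J (\<omega> (Suc m))" if "m \<le> n" for m n
      using that by (rule lift_Suc_antimono_le[rotated]) (rule step)
  qed
  then show ?thesis by (simp add: coded_points_def)
qed

lemma coding_eqI:
  assumes "\<omega> \<in> path_space G" "x \<in> coded_points \<omega>"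
  shows "coding G J T \<omega> = x"
  unfolding coding_def coded_points_def[symmetric]
  by (rule the_equality) (use assms coded_points_unique in blast)+

lemma coding_shift:
  assumes "\<omega> \<in> path_space G"
  shows "coding G J T \<omega> = tr (\<omega> 0) (\<omega> 1) (coding G J T (shift \<omega>))"
    and "coding G J T \<omega> \<in> J (\<omega> 0)"
proof -
  have J0: "x \<in> J (\<omega> 0)" if "x \<in> coded_points \<omega>" "\<omega> \<in> path_space G" for x \<omega>
  proof -
    have "x \<in> path_map G T \<omega> (Suc 0) ` J (\<omega> (Suc 0))" using that(1) unfolding coded_points_def by blast
    then show ?thesis using tr_J[of "\<omega> 0" "\<omega> 1"] that(2) by (auto simp: path_space_def)
  qed
  have E: "(\<omega> 0, \<omega> 1) \<in> E" using assms by (auto simp: path_space_def)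
  have sh: "shift \<omega> \<in> path_space G" using assms by (rule shift_path)
  obtain y where y: "y \<in> coded_points (shift \<omega>)" using coded_points_nonempty[OF sh] by blast
  have yJ: "y \<in> J (\<omega> 1)" using J0[OF y sh] by (simp add: shift_def)
  have "tr (\<omega> 0) (\<omega> 1) y \<in> coded_points \<omega>"
    unfolding coded_points_def
  proof
    fix k
    show "tr (\<omega> 0) (\<omega> 1) y \<in> path_map G T \<omega> (Suc k) ` J (\<omega> (Suc k))"
    proof (cases k)
      case 0
      then show ?thesis using yJ by auto
    next
      case (Suc j)
      have "y \<in> path_map G T (shift \<omega>) (Suc j) ` J (shift \<omega> (Suc j))" using y unfolding coded_points_def by blast
      then show ?thesis unfolding Suc path_map_Suc_shift by (auto simp: shift_def)
    qed
  qed
  then show "coding G J T \<omega> = tr (\<omega> 0) (\<omega> 1) (coding G J T (shift \<omega>))"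
    using coding_eqI[OF assms] coding_eqI[OF sh y] by simp
  show "coding G J T \<omega> \<in> J (\<omega> 0)"
    using coded_points_nonempty[OF assms] coding_eqI[OF assms] J0 assms by blast
qed

text \<open>
  To identify the point coded by \<open>\<omega>\<close> it suffices to exhibit its whole orbit under the inverse branches.
\<close>

lemma coding_orbit_eq:
  assumes "\<omega> \<in> path_space G" "\<And>k. z k \<in> J (\<omega> k)" "\<And>k. z k = tr (\<omega> k) (\<omega> (Suc k)) (z (Suc k))"
  shows "coding G J T \<omega> = z 0"
proof (rule coding_eqI[OF assms(1)])
  have "z 0 = path_map G T \<omega> n (z n)" for n
  proof (induction n)
    case (Suc n)
    have "path_map G T \<omega> (Suc n) (z (Suc n)) = path_map G T \<omega> n (z n)"
      using assms(3)[of n] by simp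
    then show ?case using Suc.IH by (rule trans[rotated, OF sym])
  qed simp
  then show "z 0 \<in> coded_points \<omega>" unfolding coded_points_def using assms(2) by blast
qed

lemma subgraph_arc_map:
  assumes "subgraph H G" "(u, v) \<in> arcs_ends H"
  shows "arc_map H T u v = tr u v" "(u, v) \<in> E"
proof -
  have comp: "tail G = tail H" "head G = head H" "arcs H \<subseteq> arcs G"
    using assms(1) by (auto simp: subgraph_def compatible_def)
  obtain e where e: "e \<in> arcs H" "arc_to_ends H e = (u, v)"
    using assms(2) by (auto simp: arcs_ends_def)
  have eG: "arc_to_ends G e = (u, v)" "e \<in> arcs G" using e comp by (auto simp: arc_to_ends_def)
  then show "(u, v) \<in> E" by (auto simp: arcs_ends_def intro: image_eqI[of _ _ e])
  have "(THE e'. e' \<in> arcs H \<and> arc_to_ends H e' = (u, v)) = e"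
    using e comp eG by (intro the_equality) (auto simp: arc_to_ends_def intro: no_multi_arcs)
  moreover have "(THE e'. e' \<in> arcs G \<and> arc_to_ends G e' = (u, v)) = e"
    using eG by (intro the_equality) (auto intro: no_multi_arcs)
  ultimately show "arc_map H T u v = tr u v" by (simp add: arc_map_def)
qed

lemma subgraph_path_space: "subgraph H G \<Longrightarrow> path_space H \<subseteq> path_space G"
  using subgraph_arc_map(2) by (auto simp: path_space_def subgraph_def)

lemma subgraph_coding:
  assumes "subgraph H G" "\<omega> \<in> path_space H"
  shows "coding H J T \<omega> = coding G J T \<omega>"
proof -
  have "path_map H T \<omega> n = path_map G T \<omega> n" for n
    by (induction n) (use assms subgraph_arc_map(1) in \<open>auto simp: path_space_def\<close>)
  then show ?thesis unfolding coding_def by (simp only:)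
qed

lemma subgraph_limit_set: "subgraph H G \<Longrightarrow> limit_set H J T \<subseteq> limit_set G J T"
  unfolding limit_set_def by (metis image_cong image_mono subgraph_coding subgraph_path_space)

text \<open>
  A coinduction principle: if every element of a set of pairs (vertex, point) has a predecessor
  under some map of the system that is again in the set, then following predecessors produces an
  infinite path that codes the point. This turns attractors of loop systems into subsets of limit
  sets without concatenating infinitely many loops explicitly.
\<close>

lemma orbit_in_coding_image:
  assumes H: "subgraph H G" and S: "\<And>v x. (v, x) \<in> S \<Longrightarrow>
      x \<in> J v \<and> (\<exists>v' x'. (v', x') \<in> S \<and> (v, v') \<in> arcs_ends H \<and> x = tr v v' x')"
    and vx: "(v, x) \<in> S"
  shows "\<exists>\<omega>\<in>path_space H. \<omega> 0 = v \<and> coding G J T \<omega> = x"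
proof -
  have "\<exists>z'. z' \<in> S \<and> (fst z, fst z') \<in> arcs_ends H \<and> snd z = tr (fst z) (fst z') (snd z')" if "z \<in> S" for z
    using S[of "fst z" "snd z"] that by auto
  then obtain f where f: "\<And>z. z \<in> S \<Longrightarrow> f z \<in> S \<and> (fst z, fst (f z)) \<in> arcs_ends H \<and> snd z = tr (fst z) (fst (f z)) (snd (f z))"
    by metis
  define s where "s n = (f ^^ n) (v, x)" for n
  have sS: "s n \<in> S" for n by (induction n) (use vx f in \<open>auto simp: s_def\<close>)
  have sSuc: "s (Suc n) = f (s n)" for n by (simp add: s_def)
  define \<omega> where "\<omega> n = fst (s n)" for n
  have edge: "(\<omega> n, \<omega> (Suc n)) \<in> arcs_ends H" for n using f[OF sS[of n]] by (simp add: \<omega>_def sSuc)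
  interpret H: wf_digraph H using H by (simp add: subgraph_def)
  have path: "\<omega> \<in> path_space H" using edge H.adj_in_verts(1) by (auto simp: path_space_def)
  have "coding G J T \<omega> = snd (s 0)"
  proof (rule coding_orbit_eq)
    show "\<omega> \<in> path_space G" using path subgraph_path_space[OF H] by blast
    show "snd (s k) \<in> J (\<omega> k)" for k using S[of "fst (s k)" "snd (s k)"] sS[of k] by (simp add: \<omega>_def)
    show "snd (s k) = tr (\<omega> k) (\<omega> (Suc k)) (snd (s (Suc k)))" for k
      using f[OF sS[of k]] by (simp add: \<omega>_def sSuc)
  qed
  then show ?thesis using path by (intro bexI[of _ \<omega>]) (auto simp: \<omega>_def s_def)
qed

section \<open>Extending finite paths\<close>

lemma diameter_J_pos:
  assumes "v \<in> verts G"
  shows "0 < diameter (J v)"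
proof -
  have "interior (J v) \<noteq> {}" using J_regular[OF assms] J_nonempty[OF assms] by auto
  then obtain x e where e: "0 < e" "ball x e \<subseteq> J v"
    by (meson ex_in_conv mem_interior)
  have "diameter (ball x e) \<le> diameter (J v)"
    using e(2) J_compact[OF assms] compact_imp_bounded by (intro diameter_subset) auto
  then show ?thesis using e(1) by simp
qed

text \<open>
  Contractibility with the supremum replaced by a single edge and point, at the price of a
  factor \<open>2\<close>. Since \<open>J v\<close> has positive diameter, the edge exists.
\<close>

lemma ex_contracting_constant:
  "\<exists>c2>0. \<forall>v\<in>verts G. \<exists>u z. (v, u) \<in> E \<and> z \<in> J u \<and> diameter (J v) \<le> c2 * dnorm (tr v u) z"
proof -
  obtain c2 where c2: "0 < c2" "\<And>v. v \<in> verts G \<Longrightarrow> ennreal (diameter (J v)) \<le>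
      ennreal c2 * (SUP e \<in> {e \<in> arcs G. tail G e = v}. SUP z \<in> J (head G e). ennreal (dnorm (T e) z))"
    using contractible unfolding contractible_seeds_def by blast
  have "\<exists>u z. (v, u) \<in> E \<and> z \<in> J u \<and> diameter (J v) \<le> (2 * c2) * dnorm (tr v u) z" if v: "v \<in> verts G" for v
  proof (rule ccontr)
    assume n: "\<not> ?thesis"
    let ?d = "diameter (J v)"
    have d: "0 < ?d" by (rule diameter_J_pos[OF v])
    have "(SUP e \<in> {e \<in> arcs G. tail G e = v}. SUP z \<in> J (head G e). ennreal (dnorm (T e) z)) \<le> ennreal (?d / (2 * c2))"
    proof (intro SUP_least ennreal_leI)
      fix e z assume e: "e \<in> {e \<in> arcs G. tail G e = v}" and z: "z \<in> J (head G e)"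
      have "arc_to_ends G e \<in> E" using e by (simp add: arcs_ends_def)
      then have "(v, head G e) \<in> E" "tr v (head G e) = T e" using e tr_arc[of e] by (auto simp: arc_to_ends_def)
      then have "(2 * c2) * dnorm (T e) z < ?d" using n z by (metis not_le)
      then show "dnorm (T e) z \<le> ?d / (2 * c2)" using c2(1) by (simp add: field_simps)
    qed
    then have "ennreal ?d \<le> ennreal c2 * ennreal (?d / (2 * c2))"
      using c2(2)[OF v] by (meson mult_left_mono order_trans zero_le)
    also have "\<dots> = ennreal (?d / 2)" using c2(1) d by (simp add: ennreal_mult[symmetric])
    finally show False using d by simp
  qed
  then show ?thesis using c2(1) by (intro exI[of _ "2 * c2"]) auto
qed

lemma ex_path_from:
  assumes "v \<in> verts G"
  shows "\<exists>\<omega>\<in>path_space G. \<omega> 0 = v"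
proof -
  have "\<exists>u. (v, u) \<in> E" if "v \<in> verts G" for v
    using ex_contracting_constant that by blast
  then obtain f where f: "\<And>v. v \<in> verts G \<Longrightarrow> (v, f v) \<in> E" by metis
  have "(f ^^ n) v \<in> verts G" for n
    by (induction n) (use assms E_verts(2)[OF f] in auto)
  then show ?thesis using f by (intro bexI[of _ "\<lambda>n. (f ^^ n) v"]) (auto simp: path_space_def)
qed

lemma map_upt_shift: "map \<omega> [0..<Suc n] = \<omega> 0 # map (shift \<omega>) [0..<n]"
  by (simp add: map_upt_Suc shift_def del: upt_Suc)

lemma ex_path_extending:
  assumes "vpath p" "\<omega> \<in> path_space G" "\<omega> 0 = last p"
  shows "\<exists>\<omega>'\<in>path_space G. map \<omega>' [0..<length p] = p \<and> (shift ^^ (length p - 1)) \<omega>' = \<omega>"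
  using assms
proof (induction p rule: vpath.induct)
  case (3 u v p)
  then obtain \<omega>' where w: "\<omega>' \<in> path_space G" "map \<omega>' [0..<length (v # p)] = v # p" "(shift ^^ (length (v # p) - 1)) \<omega>' = \<omega>"
    by auto
  define \<omega>'' where "\<omega>'' = case_nat u \<omega>'"
  have sh: "shift \<omega>'' = \<omega>'" by (auto simp: shift_def \<omega>''_def)
  have "\<omega>' 0 = v" using w(2) by (simp add: map_upt_Suc del: upt_Suc)
  then have "\<omega>'' \<in> path_space G"
    using w(1) 3(2) E_verts by (auto simp: path_space_def \<omega>''_def split: nat.split)
  moreover have "map \<omega>'' [0..<length (u # v # p)] = u # v # p"
  proof -
    have "map \<omega>'' [0..<Suc (length (v # p))] = u # map \<omega>' [0..<length (v # p)]"
      unfolding map_upt_shift sh by (simp add: \<omega>''_def)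
    then show ?thesis unfolding w(2) by simp
  qed
  moreover have "(shift ^^ (length (u # v # p) - 1)) \<omega>'' = \<omega>"
    using w(3) sh by (simp add: funpow_swap1)
  ultimately show ?case by (intro bexI[of _ \<omega>'']) auto
qed auto

section \<open>Derivatives along orbits and partition sums\<close>

text \<open>
  The exponential of the Birkhoff sum \<open>\<phi>(\<omega>) + ... + \<phi>(\<sigma>\<^sup>n\<^sup>-\<^sup>1 \<omega>)\<close>, written as the norm of a derivative. The list
  has \<open>n + 1\<close> vertices, that is \<open>n\<close> edges: the last edge leaves the word of length \<open>n\<close>.
\<close>

definition orbit_norm :: "nat \<Rightarrow> (nat \<Rightarrow> 'v) \<Rightarrow> real" where
  "orbit_norm n \<omega> = vpath_norm (map \<omega> [0..<Suc n]) (coding G J T ((shift ^^ n) \<omega>))"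

lemma shift_funpow: "(shift ^^ n) \<omega> = (\<lambda>i. \<omega> (n + i))"
  by (induction n arbitrary: \<omega>) (auto simp: shift_def)

lemma shift_funpow_path: "\<omega> \<in> path_space G \<Longrightarrow> (shift ^^ n) \<omega> \<in> path_space G"
  by (induction n) (auto intro: shift_path)

lemma coding_funpow_shift:
  assumes "\<omega> \<in> path_space G"
  shows "coding G J T \<omega> = vpath_map (map \<omega> [0..<Suc n]) (coding G J T ((shift ^^ n) \<omega>))"
  using assms
proof (induction n arbitrary: \<omega>)
  case (Suc n)
  have eq: "map \<omega> [0..<Suc (Suc n)] = \<omega> 0 # \<omega> 1 # map (shift (shift \<omega>)) [0..<n]"
    unfolding map_upt_shift by (simp add: shift_def)
  have eq': "map (shift \<omega>) [0..<Suc n] = \<omega> 1 # map (shift (shift \<omega>)) [0..<n]"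
    unfolding map_upt_shift by (simp add: shift_def)
  show ?case unfolding eq
    using Suc.IH[OF shift_path[OF Suc.prems]] coding_shift(1)[OF Suc.prems] unfolding eq'
    by (simp add: funpow_swap1)
qed simp

lemma exp_phi_V:
  assumes "\<omega> \<in> path_space G"
  shows "exp (phi_V G J T \<omega>) = dnorm (tr (\<omega> 0) (\<omega> 1)) (coding G J T (shift \<omega>))"
    and "lower_phi_V G J T \<omega> = phi_V G J T \<omega>"
proof -
  have E: "(\<omega> 0, \<omega> 1) \<in> E" using assms by (auto simp: path_space_def)
  have "coding G J T (shift \<omega>) \<in> U (\<omega> 1)"
    using coding_shift(2)[OF shift_path[OF assms]] J_subset_U E_verts(2)[OF E] by (auto simp: shift_def)
  note d = tr_derivative(1,3)[OF E this]
  show "exp (phi_V G J T \<omega>) = dnorm (tr (\<omega> 0) (\<omega> 1)) (coding G J T (shift \<omega>))"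
    "lower_phi_V G J T \<omega> = phi_V G J T \<omega>" using d by (simp_all add: phi_V_def lower_phi_V_def)
qed

lemma orbit_norm_eq_exp:
  assumes "\<omega> \<in> path_space G"
  shows "orbit_norm n \<omega> = exp (\<Sum>i<n. phi_V G J T ((shift ^^ i) \<omega>))"
  using assms
proof (induction n arbitrary: \<omega>)
  case 0
  then show ?case by (simp add: orbit_norm_def)
next
  case (Suc n)
  have eq: "map \<omega> [0..<Suc (Suc n)] = \<omega> 0 # \<omega> 1 # map (shift (shift \<omega>)) [0..<n]"
    unfolding map_upt_shift by (simp add: shift_def)
  have eq': "map (shift \<omega>) [0..<Suc n] = \<omega> 1 # map (shift (shift \<omega>)) [0..<n]"
    unfolding map_upt_shift by (simp add: shift_def)
  have "orbit_norm (Suc n) \<omega> = dnorm (tr (\<omega> 0) (\<omega> 1)) (coding G J T (shift \<omega>)) * orbit_norm n (shift \<omega>)"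
    unfolding orbit_norm_def eq using coding_funpow_shift[OF shift_path[OF Suc.prems], of n] unfolding eq'
    by (simp add: funpow_swap1)
  also have "\<dots> = exp (phi_V G J T \<omega>) * exp (\<Sum>i<n. phi_V G J T ((shift ^^ i) (shift \<omega>)))"
    using Suc.IH[OF shift_path[OF Suc.prems]] exp_phi_V(1)[OF Suc.prems] by simp
  also have "\<dots> = exp (\<Sum>i<Suc n. phi_V G J T ((shift ^^ i) \<omega>))"
    by (simp only: exp_add[symmetric] sum.lessThan_Suc_shift funpow_0) (simp add: funpow_swap1)
  finally show ?case .
qed

lemma orbit_norm_pos: "\<omega> \<in> path_space G \<Longrightarrow> 0 < orbit_norm n \<omega>"
  by (simp add: orbit_norm_eq_exp)

lemma orbit_norm_powr:
  "\<omega> \<in> path_space G \<Longrightarrow> orbit_norm n \<omega> powr s = exp (\<Sum>i<n. s * phi_V G J T ((shift ^^ i) \<omega>))"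
  by (simp add: orbit_norm_eq_exp powr_def sum_distrib_left)

lemma orbit_norm_add:
  assumes "\<omega> \<in> path_space G"
  shows "orbit_norm (n + m) \<omega> = orbit_norm n \<omega> * orbit_norm m ((shift ^^ n) \<omega>)"
proof -
  have split: "(\<Sum>i<n + m. g i) = (\<Sum>i<n. g i) + (\<Sum>i<m. g (n + i))" for g :: "nat \<Rightarrow> real"
    by (induction m) auto
  have "(shift ^^ i) ((shift ^^ n) \<omega>) = (shift ^^ (n + i)) \<omega>" for i
    by (simp add: shift_funpow add.assoc)
  then show ?thesis
    using assms by (simp add: orbit_norm_eq_exp shift_funpow_path exp_add split)
qed

lemma coding_in_U: "\<omega> \<in> path_space G \<Longrightarrow> coding G J T \<omega> \<in> U (\<omega> 0)"
  using coding_shift(2) J_subset_U by (auto simp: path_space_def)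

lemma orbit_norm_le: "\<omega> \<in> path_space G \<Longrightarrow> orbit_norm n \<omega> \<le> r ^ n"
proof -
  assume w: "\<omega> \<in> path_space G"
  have "coding G J T ((shift ^^ n) \<omega>) \<in> U (\<omega> n)"
    using coding_in_U[OF shift_funpow_path[OF w, of n]] by (simp add: shift_funpow)
  then show ?thesis
    using vpath_norm_le[of "map \<omega> [0..<Suc n]" "coding G J T ((shift ^^ n) \<omega>)"] path_map_conv_vpath_map[OF w, of n]
    by (simp add: orbit_norm_def)
qed

text \<open>
  The summand of the partition sum of \<open>s \<phi>\<close>. The set \<open>A\<close> in \<open>words\<close> and \<open>Z\<close> restricts the letters of
  the word, but not the continuation inside its cylinder, so that restricting the alphabet
  does not change weights.
\<close>

definition weight :: "real \<Rightarrow> 'v list \<Rightarrow> ennreal" where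
  "weight s w = exp_ereal (SUP \<omega> \<in> cylinder G w. ereal (\<Sum>i<length w. s * phi_V G J T ((shift ^^ i) \<omega>)))"

definition words :: "'v set \<Rightarrow> nat \<Rightarrow> 'v list set" where
  "words A n = {w. length w = n \<and> set w \<subseteq> A \<and> cylinder G w \<noteq> {}}"

definition Z :: "real \<Rightarrow> 'v set \<Rightarrow> nat \<Rightarrow> ennreal" where
  "Z s A n = infsum (weight s) (words A n)"

lemma cylinder_path: "\<omega> \<in> cylinder G w \<Longrightarrow> \<omega> \<in> path_space G"
  by (simp add: cylinder_def)

lemma partition_sum_eq_Z: "partition_sum G (\<lambda>\<omega>. s * phi_V G J T \<omega>) n = Z s (verts G) n"
  unfolding partition_sum_def Z_def words_def weight_def by (rule infsum_cong) auto

lemma partition_sum_lower_eq_Z: "partition_sum G (\<lambda>\<omega>. s * lower_phi_V G J T \<omega>) n = Z s (verts G) n"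
  unfolding partition_sum_eq_Z[symmetric] partition_sum_def
  by (intro infsum_cong arg_cong[where f = exp_ereal] SUP_cong refl arg_cong[where f = ereal] sum.cong)
     (simp add: exp_phi_V(2) shift_funpow_path cylinder_path)

lemma weight_ge: "\<omega> \<in> cylinder G w \<Longrightarrow> ennreal (orbit_norm (length w) \<omega> powr s) \<le> weight s w"
  unfolding weight_def orbit_norm_powr[OF cylinder_path] by (rule exp_ereal_SUP_ge)

lemma weight_le:
  "(\<And>\<omega>. \<omega> \<in> cylinder G w \<Longrightarrow> ennreal (orbit_norm (length w) \<omega> powr s) \<le> c) \<Longrightarrow> weight s w \<le> c"
  unfolding weight_def by (rule exp_ereal_SUP_le) (simp add: orbit_norm_powr[symmetric] cylinder_path)

lemma cylinder_append:
  assumes "\<omega> \<in> cylinder G (w @ w')"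
  shows "\<omega> \<in> cylinder G w" "(shift ^^ length w) \<omega> \<in> cylinder G w'"
proof -
  have path: "\<omega> \<in> path_space G" and eq: "map \<omega> [0..<length w + length w'] = w @ w'"
    using assms by (auto simp: cylinder_def)
  have nth: "\<omega> i = (w @ w') ! i" if "i < length w + length w'" for i
    using arg_cong[OF eq, of "\<lambda>l. l ! i"] that by simp
  show "\<omega> \<in> cylinder G w"
    using path nth by (auto simp: cylinder_def nth_append intro!: nth_equalityI)
  show "(shift ^^ length w) \<omega> \<in> cylinder G w'"
    using shift_funpow_path[OF path] nth
    by (auto simp: cylinder_def shift_funpow nth_append intro!: nth_equalityI)
qed

lemma weight_append: "weight s (w @ w') \<le> weight s w * weight s w'"
proof (rule weight_le)
  fix \<omega> assume w: "\<omega> \<in> cylinder G (w @ w')"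
  have "ennreal (orbit_norm (length (w @ w')) \<omega> powr s) =
      ennreal (orbit_norm (length w) \<omega> powr s) * ennreal (orbit_norm (length w') ((shift ^^ length w) \<omega>) powr s)"
    using orbit_norm_pos shift_funpow_path cylinder_path[OF w]
    by (simp add: orbit_norm_add powr_mult less_imp_le ennreal_mult[symmetric])
  also have "\<dots> \<le> weight s w * weight s w'"
    using cylinder_append[OF w] by (intro mult_mono weight_ge) auto
  finally show "ennreal (orbit_norm (length (w @ w')) \<omega> powr s) \<le> weight s w * weight s w'" .
qed

lemma weight_mono_exponent:
  assumes "s \<le> s'"
  shows "weight s' w \<le> ennreal ((r powr (s' - s)) ^ length w) * weight s w"
proof (rule weight_le)
  fix \<omega> assume w: "\<omega> \<in> cylinder G w"
  let ?b = "orbit_norm (length w) \<omega>"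
  have b: "0 < ?b" "?b \<le> r ^ length w" using orbit_norm_pos orbit_norm_le cylinder_path[OF w] by auto
  have "?b powr s' = ?b powr (s' - s) * ?b powr s" by (simp add: powr_add[symmetric])
  also have "\<dots> \<le> (r ^ length w) powr (s' - s) * ?b powr s"
    using b assms by (intro mult_right_mono powr_mono2) auto
  also have "(r ^ length w) powr (s' - s) = (r powr (s' - s)) ^ length w"
    using r by (simp add: powr_realpow[symmetric] powr_powr mult.commute)
  finally have "ennreal (?b powr s') \<le> ennreal ((r powr (s' - s)) ^ length w) * ennreal (?b powr s)"
    by (simp add: ennreal_mult[symmetric] ennreal_leI)
  also have "\<dots> \<le> ennreal ((r powr (s' - s)) ^ length w) * weight s w"
    using weight_ge[OF w] by (intro mult_left_mono) auto
  finally show "ennreal (?b powr s') \<le> ennreal ((r powr (s' - s)) ^ length w) * weight s w" .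
qed

text \<open>
  Each of the \<open>n\<close> edges of a word contributes a factor of at most \<open>r\<close> to the derivative.
\<close>

lemma Z_mono_exponent:
  assumes "s \<le> s'"
  shows "Z s' A n \<le> ennreal ((r powr (s' - s)) ^ n) * Z s A n"
  unfolding Z_def
proof (rule infsum_ennreal_leI)
  fix F assume F: "finite F" "F \<subseteq> words A n"
  have "sum (weight s') F \<le> (\<Sum>w\<in>F. ennreal ((r powr (s' - s)) ^ n) * weight s w)"
    using weight_mono_exponent[OF assms] F(2) by (intro sum_mono) (auto simp: words_def)
  also have "\<dots> = ennreal ((r powr (s' - s)) ^ n) * sum (weight s) F" by (simp add: sum_distrib_left)
  also have "\<dots> \<le> ennreal ((r powr (s' - s)) ^ n) * infsum (weight s) (words A n)"
    using sum_le_infsum_ennreal[OF F] by (intro mult_left_mono) auto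
  finally show "sum (weight s') F \<le> ennreal ((r powr (s' - s)) ^ n) * infsum (weight s) (words A n)" .
qed

lemma pressure_zero_subexponential:
  assumes "has_pressure G (\<lambda>\<omega>. s * phi_V G J T \<omega>) 0" "0 < \<epsilon>"
  shows "\<forall>\<^sub>F n in sequentially. ennreal (exp (- \<epsilon> * real n)) \<le> Z s (verts G) n \<and> Z s (verts G) n \<le> ennreal (exp (\<epsilon> * real n))"
  using has_pressure_zero_subexponential[OF assms] unfolding partition_sum_eq_Z .

lemma pressure_zero_unique:
  assumes "has_pressure G (\<lambda>\<omega>. s * phi_V G J T \<omega>) 0" "has_pressure G (\<lambda>\<omega>. s' * phi_V G J T \<omega>) 0"
  shows "s = s'"
proof -
  have "\<not> s < s'" if P: "has_pressure G (\<lambda>\<omega>. s * phi_V G J T \<omega>) 0" "has_pressure G (\<lambda>\<omega>. s' * phi_V G J T \<omega>) 0" for s s'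
  proof
    assume "s < s'"
    define \<epsilon> where "\<epsilon> = (s' - s) * ln (1 / r) / 3"
    have e: "0 < \<epsilon>" using \<open>s < s'\<close> r by (simp add: \<epsilon>_def)
    have re: "(r powr (s' - s)) ^ n = exp (- 3 * \<epsilon> * real n)" for n
      using r by (simp add: \<epsilon>_def powr_def ln_div exp_of_nat_mult[symmetric] algebra_simps)
    have "\<forall>\<^sub>F n in sequentially. 0 < n \<and> ennreal (exp (- \<epsilon> * real n)) \<le> Z s' (verts G) n \<and> Z s (verts G) n \<le> ennreal (exp (\<epsilon> * real n))"
      using pressure_zero_subexponential[OF P(1) e] pressure_zero_subexponential[OF P(2) e] eventually_gt_at_top[of 0]
      by eventually_elim auto
    then obtain n where n: "0 < n" "ennreal (exp (- \<epsilon> * real n)) \<le> Z s' (verts G) n" "Z s (verts G) n \<le> ennreal (exp (\<epsilon> * real n))"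
      using eventually_happens sequentially_bot by blast
    have "Z s' (verts G) n \<le> ennreal (exp (- 3 * \<epsilon> * real n)) * Z s (verts G) n"
      using Z_mono_exponent[of s s' "verts G" n] \<open>s < s'\<close> unfolding re by simp
    also have "\<dots> \<le> ennreal (exp (- 3 * \<epsilon> * real n)) * ennreal (exp (\<epsilon> * real n))"
      using n(3) by (intro mult_left_mono) auto
    also have "\<dots> = ennreal (exp (- 2 * \<epsilon> * real n))"
      by (simp add: ennreal_mult[symmetric] exp_add[symmetric])
    finally have "ennreal (exp (- \<epsilon> * real n)) \<le> ennreal (exp (- 2 * \<epsilon> * real n))" using n(2) by (rule order_trans[rotated])
    then show False using e n(1) by simp
  qed
  then show ?thesis using assms by (meson linorder_neqE_linordered_idom)
qed

section \<open>The upper bound\<close>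

lemma cylinder_vpath: "\<omega> \<in> cylinder G w \<Longrightarrow> w \<noteq> [] \<Longrightarrow> vpath w"
  using path_map_conv_vpath_map[of \<omega> "length w - 1"] by (auto simp: cylinder_def)

lemma cylinder_last:
  assumes "\<omega> \<in> cylinder G w" "w \<noteq> []"
  shows "last w = \<omega> (length w - 1)"
proof -
  have "map \<omega> [0..<length w] = w" using assms by (simp add: cylinder_def)
  then have "w ! (length w - 1) = map \<omega> [0..<length w] ! (length w - 1)" by simp
  also have "\<dots> = \<omega> (length w - 1)" using assms(2) by (simp del: upt_Suc)
  finally show ?thesis using assms(2) by (simp add: last_conv_nth)
qed

lemma coding_cylinder:
  assumes "\<omega> \<in> cylinder G w" "w \<noteq> []"
  shows "\<exists>x\<in>J (last w). coding G J T \<omega> = vpath_map w x"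
proof -
  let ?x = "coding G J T ((shift ^^ (length w - 1)) \<omega>)"
  have path: "\<omega> \<in> path_space G" and eq: "map \<omega> [0..<length w] = w" using assms by (auto simp: cylinder_def)
  have "Suc (length w - 1) = length w" using assms(2) by simp
  then have "coding G J T \<omega> = vpath_map w ?x"
    using coding_funpow_shift[OF path, of "length w - 1"] eq by metis
  moreover have "?x \<in> J (last w)"
    using coding_shift(2)[OF shift_funpow_path[OF path, of "length w - 1"]] cylinder_last[OF assms]
    by (simp add: shift_funpow)
  ultimately show ?thesis by blast
qed

text \<open>
  The path \<open>\<omega>\<close> has to make the weight of \<open>w\<close> as large as the diameter. It continues \<open>w\<close> along the edge
  that contractibility provides for the last vertex of \<open>w\<close>: the derivative of this edge
  is comparable to the diameter of the set at that vertex.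
\<close>

lemma ex_diameter_cylinder_constant:
  "\<exists>C>0. \<forall>w. w \<noteq> [] \<longrightarrow> cylinder G w \<noteq> {} \<longrightarrow> bounded (coding G J T ` cylinder G w) \<and>
     (\<exists>\<omega>\<in>cylinder G w. diameter (coding G J T ` cylinder G w) \<le> C * orbit_norm (length w) \<omega>)"
proof -
  obtain c2 where c2: "0 < c2" "\<And>v. v \<in> verts G \<Longrightarrow> \<exists>u z. (v, u) \<in> E \<and> z \<in> J u \<and> diameter (J v) \<le> c2 * dnorm (tr v u) z"
    using ex_contracting_constant by blast
  define C where "C = L * L * L * c2"
  have "bounded (coding G J T ` cylinder G w) \<and>
      (\<exists>\<omega>\<in>cylinder G w. diameter (coding G J T ` cylinder G w) \<le> C * orbit_norm (length w) \<omega>)"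
    if w: "w \<noteq> []" "cylinder G w \<noteq> {}" for w
  proof -
    let ?v = "last w"
    have p: "vpath w" using w cylinder_vpath by blast
    have v: "?v \<in> verts G" using vpath_last[OF p] .
    obtain u z where u: "(?v, u) \<in> E" "z \<in> J u" "diameter (J ?v) \<le> c2 * dnorm (tr ?v u) z"
      using c2(2)[OF v] by blast
    have uv: "u \<in> verts G" using E_verts(2)[OF u(1)] .
    obtain \<omega>' where \<omega>': "\<omega>' \<in> path_space G" "\<omega>' 0 = u" using ex_path_from[OF uv] by blast
    have wsplit: "w @ [u] = butlast w @ ?v # [u]" using w(1) by (metis append.assoc append_Cons append_Nil append_butlast_last_id)
    have wl: "butlast w @ [?v] = w" using w(1) by simp
    have pu: "vpath (w @ [u])" unfolding wsplit vpath_append wl using p u(1) uv by simp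
    obtain \<omega> where \<omega>: "\<omega> \<in> path_space G" "map \<omega> [0..<length (w @ [u])] = w @ [u]" "(shift ^^ (length (w @ [u]) - 1)) \<omega> = \<omega>'"
      using ex_path_extending[OF pu \<omega>'(1)] \<omega>'(2) by auto
    have cyl: "\<omega> \<in> cylinder G w" using \<omega>(1,2) by (auto simp: cylinder_def)
    let ?z = "coding G J T \<omega>'"
    have zJ: "?z \<in> J u" using coding_shift(2)[OF \<omega>'(1)] \<omega>'(2) by simp
    let ?y = "tr ?v u ?z"
    have yJ: "?y \<in> J ?v" using tr_J[OF u(1) zJ] .
    have bn: "orbit_norm (length w) \<omega> = vpath_norm w ?y * dnorm (tr ?v u) ?z"
    proof -
      have "orbit_norm (length w) \<omega> = vpath_norm (w @ [u]) ?z"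
        unfolding orbit_norm_def using \<omega>(2,3) by simp
      also have "\<dots> = vpath_norm w ?y * dnorm (tr ?v u) ?z"
        unfolding wsplit vpath_norm_append wl by simp
      finally show ?thesis .
    qed
    have "vpath [?v, u]" using u(1) uv by simp
    from vpath_norm_distortion[OF this, of ?z z] have "dnorm (tr ?v u) z \<le> L * dnorm (tr ?v u) ?z"
      using zJ u(2) by simp
    then have dJ: "diameter (J ?v) \<le> c2 * (L * dnorm (tr ?v u) ?z)"
      using u(3) c2(1) by (meson mult_left_mono less_imp_le order_trans)
    have dist_le: "dist (coding G J T \<omega>1) (coding G J T \<omega>2) \<le> C * orbit_norm (length w) \<omega>"
      if c: "\<omega>1 \<in> cylinder G w" "\<omega>2 \<in> cylinder G w" for \<omega>1 \<omega>2
    proof -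
      obtain x1 x2 where x: "x1 \<in> J ?v" "x2 \<in> J ?v" "coding G J T \<omega>1 = vpath_map w x1" "coding G J T \<omega>2 = vpath_map w x2"
        using coding_cylinder[OF c(1) w(1)] coding_cylinder[OF c(2) w(1)] by blast
      have pos: "0 < vpath_norm w x1" "0 < vpath_norm w ?y"
        using vpath_norm_pos[OF p] J_subset_U[OF v] x(1) yJ by blast+
      have "dist (coding G J T \<omega>1) (coding G J T \<omega>2) \<le> L * vpath_norm w x1 * diameter (J ?v)"
        unfolding x using vpath_map_Lipschitz[OF p x(1,2)] .
      also have "\<dots> \<le> L * (L * vpath_norm w ?y) * (c2 * (L * dnorm (tr ?v u) ?z))"
        using vpath_norm_distortion[OF p yJ x(1)] dJ L_ge_1 pos diameter_J_pos[OF v]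
        by (intro mult_mono mult_nonneg_nonneg) auto
      also have "\<dots> = C * orbit_norm (length w) \<omega>" by (simp add: bn C_def mult_ac)
      finally show ?thesis .
    qed
    have "bounded (coding G J T ` cylinder G w)"
    proof -
      obtain \<omega>0 where w0: "\<omega>0 \<in> cylinder G w" using w(2) by blast
      show ?thesis unfolding bounded_def
        by (rule exI[of _ "coding G J T \<omega>0"], rule exI[of _ "C * orbit_norm (length w) \<omega>"]) (use dist_le[OF w0] in auto)
    qed
    moreover have "diameter (coding G J T ` cylinder G w) \<le> C * orbit_norm (length w) \<omega>"
      using w(2) dist_le by (intro diameter_le) (auto simp: dist_norm)
    ultimately show ?thesis using cyl by blast
  qed
  moreover have "0 < C" unfolding C_def using L_ge_1 c2(1) by simp
  ultimately show ?thesis by blast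
qed

lemma countable_words: "A \<subseteq> verts G \<Longrightarrow> countable (words A n)"
  by (rule countable_subset[of _ "lists (verts G)"]) (use countable_verts in \<open>auto simp: words_def countable_lists\<close>)

lemma path_in_words: "\<omega> \<in> path_space G \<Longrightarrow> map \<omega> [0..<n] \<in> words (verts G) n \<and> \<omega> \<in> cylinder G (map \<omega> [0..<n])"
  by (auto simp: words_def cylinder_def path_space_def)

lemma hausdorff_dim_limit_set_le:
  assumes "0 \<le> s" and P: "has_pressure G (\<lambda>\<omega>. s * phi_V G J T \<omega>) 0"
  shows "hausdorff_dim (limit_set G J T) \<le> ereal s"
proof (rule hausdorff_dim_leI[OF assms(1)])
  fix t assume t: "s < t"
  then have "0 < t" using assms(1) by simp
  obtain C where C: "0 < C" "\<And>w. w \<noteq> [] \<Longrightarrow> cylinder G w \<noteq> {} \<Longrightarrow> bounded (coding G J T ` cylinder G w) \<and>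
     (\<exists>\<omega>\<in>cylinder G w. diameter (coding G J T ` cylinder G w) \<le> C * orbit_norm (length w) \<omega>)"
    using ex_diameter_cylinder_constant by blast
  define h where "h = (t - s) * ln (1 / r) / 2"
  have h: "0 < h" using t r by (simp add: h_def)
  have rh: "(r powr (t - s)) ^ n = exp (- 2 * h * real n)" for n
    using r by (simp add: h_def powr_def ln_div exp_of_nat_mult[symmetric] algebra_simps)
  show "hausdorff_measure t (limit_set G J T) = 0"
  proof (rule hausdorff_measure_eq_0I[OF \<open>0 < t\<close>])
    fix \<eta> \<epsilon> :: real assume pos: "0 < \<eta>" "0 < \<epsilon>"
    have "(\<lambda>n. C * r ^ n) \<longlonglongrightarrow> C * 0" using r by (intro tendsto_mult tendsto_const LIMSEQ_power_zero) auto
    then have e1: "\<forall>\<^sub>F n in sequentially. C * r ^ n < \<eta>" using pos by (intro order_tendstoD) auto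
    have "(\<lambda>n. C powr t * (exp (- h)) ^ n) \<longlonglongrightarrow> C powr t * 0"
      using h by (intro tendsto_mult tendsto_const LIMSEQ_power_zero) auto
    then have e2: "\<forall>\<^sub>F n in sequentially. C powr t * (exp (- h)) ^ n < \<epsilon>" using pos by (intro order_tendstoD) auto
    obtain n where n: "C * r ^ n < \<eta>" "C powr t * (exp (- h)) ^ n < \<epsilon>" "0 < n" "Z s (verts G) n \<le> ennreal (exp (h * real n))"
      using eventually_happens[OF eventually_conj[OF e1 eventually_conj[OF e2 eventually_conj[OF eventually_gt_at_top[of 0] pressure_zero_subexponential[OF P h]]]]]
      by auto
    let ?W = "words (verts G) n" and ?C = "\<lambda>w. coding G J T ` cylinder G w"
    have W: "w \<noteq> []" "length w = n" "cylinder G w \<noteq> {}" if "w \<in> ?W" for w using that n(3) by (auto simp: words_def)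
    have diam: "bounded (?C w) \<and> diameter (?C w) \<le> \<eta>" if w: "w \<in> ?W" for w
    proof -
      obtain \<omega> where \<omega>: "\<omega> \<in> cylinder G w" "diameter (?C w) \<le> C * orbit_norm n \<omega>"
        using C(2) W[OF w] by blast
      have "C * orbit_norm n \<omega> \<le> C * r ^ n" using orbit_norm_le[OF cylinder_path[OF \<omega>(1)]] C(1) by simp
      then show ?thesis using C(2) W[OF w] \<omega>(2) n(1) by (meson less_imp_le order_trans)
    qed
    have dw: "ennreal (diameter (?C w) powr t) \<le> ennreal (C powr t) * weight t w" if w: "w \<in> ?W" for w
    proof -
      obtain \<omega> where \<omega>: "\<omega> \<in> cylinder G w" "diameter (?C w) \<le> C * orbit_norm n \<omega>"
        using C(2) W[OF w] by blast
      have "0 \<le> diameter (?C w)" using diam[OF w] diameter_ge_0 by blast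
      then have "diameter (?C w) powr t \<le> (C * orbit_norm n \<omega>) powr t" using \<omega>(2) \<open>0 < t\<close> by (intro powr_mono2) auto
      also have "\<dots> = C powr t * orbit_norm n \<omega> powr t" using C(1) orbit_norm_pos[OF cylinder_path[OF \<omega>(1)], of n] by (simp add: powr_mult)
      finally have "ennreal (diameter (?C w) powr t) \<le> ennreal (C powr t) * ennreal (orbit_norm n \<omega> powr t)"
        by (simp add: ennreal_mult[symmetric] ennreal_leI)
      also have "\<dots> \<le> ennreal (C powr t) * weight t w" using weight_ge[OF \<omega>(1)] W(2)[OF w] by (intro mult_left_mono) auto
      finally show ?thesis .
    qed
    have sum_le: "(\<Sum>w\<in>F. ennreal (diameter (?C w) powr t)) \<le> ennreal \<epsilon>" if F: "finite F" "F \<subseteq> ?W" for F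
    proof -
      have "(\<Sum>w\<in>F. ennreal (diameter (?C w) powr t)) \<le> (\<Sum>w\<in>F. ennreal (C powr t) * weight t w)"
        using dw F(2) by (intro sum_mono) auto
      also have "\<dots> = ennreal (C powr t) * sum (weight t) F" by (simp add: sum_distrib_left)
      also have "\<dots> \<le> ennreal (C powr t) * Z t (verts G) n"
        unfolding Z_def using sum_le_infsum_ennreal[OF F] by (intro mult_left_mono) auto
      also have "\<dots> \<le> ennreal (C powr t) * (ennreal (exp (- 2 * h * real n)) * Z s (verts G) n)"
        using Z_mono_exponent[of s t "verts G" n] t unfolding rh by (intro mult_left_mono) auto
      also have "\<dots> \<le> ennreal (C powr t) * (ennreal (exp (- 2 * h * real n)) * ennreal (exp (h * real n)))"
        using n(4) by (intro mult_left_mono) auto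
      also have "\<dots> = ennreal (C powr t * (exp (- h)) ^ n)"
        by (simp add: ennreal_mult[symmetric] exp_add[symmetric] exp_of_nat_mult[symmetric] mult.commute)
      also have "\<dots> \<le> ennreal \<epsilon>" using n(2) by (intro ennreal_leI) simp
      finally show ?thesis .
    qed
    have cover: "limit_set G J T \<subseteq> (\<Union>w\<in>?W. ?C w)"
      unfolding limit_set_def using path_in_words by blast
    show "\<exists>(W :: 'v list set) C. countable W \<and> limit_set G J T \<subseteq> (\<Union>w\<in>W. C w) \<and> (\<forall>w\<in>W. bounded (C w) \<and> diameter (C w) \<le> \<eta>) \<and>
        (\<forall>F. finite F \<longrightarrow> F \<subseteq> W \<longrightarrow> (\<Sum>w\<in>F. ennreal (diameter (C w) powr t)) \<le> ennreal \<epsilon>)"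
      by (rule exI[of _ ?W], rule exI[of _ ?C]) (use countable_words[of "verts G" n] cover diam sum_le in blast)
  qed
qed

section \<open>Loops whose weights do not decay\<close>

text \<open>
  A loop of length \<open>n\<close> at \<open>v\<close> is the list of its first \<open>n\<close> vertices; the closing vertex \<open>v\<close> is
  omitted so that loops can be concatenated. The empty list is the loop of length \<open>0\<close>.
\<close>

definition loops :: "'v \<Rightarrow> nat \<Rightarrow> 'v list set" where
  "loops v n = {y. length y = n \<and> (y \<noteq> [] \<longrightarrow> hd y = v) \<and> cylinder G (y @ [v]) \<noteq> {}}"

definition loop_weight :: "real \<Rightarrow> 'v \<Rightarrow> 'v list \<Rightarrow> ennreal" where
  "loop_weight s v y = (SUP \<omega> \<in> cylinder G (y @ [v]). ennreal (orbit_norm (length y) \<omega> powr s))"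

definition loop_sum :: "real \<Rightarrow> 'v \<Rightarrow> nat \<Rightarrow> ennreal" where
  "loop_sum s v n = infsum (loop_weight s v) (loops v n)"

definition decays_exponentially :: "(nat \<Rightarrow> ennreal) \<Rightarrow> bool" where
  "decays_exponentially f \<longleftrightarrow> (\<exists>C \<theta>. 0 < \<theta> \<and> \<theta> < 1 \<and> (\<forall>n. f n \<le> ennreal (C * \<theta> ^ n)))"

lemma weight_le_1:
  assumes "0 \<le> s"
  shows "weight s w \<le> 1"
proof (rule weight_le)
  fix \<omega> assume w: "\<omega> \<in> cylinder G w"
  have "orbit_norm (length w) \<omega> powr s \<le> 1 powr s"
    using orbit_norm_pos[OF cylinder_path[OF w]] orbit_norm_le[OF cylinder_path[OF w], of "length w"] power_le_one[of r] r assms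
    by (intro powr_mono2) (auto intro: less_imp_le order_trans)
  then show "ennreal (orbit_norm (length w) \<omega> powr s) \<le> 1" by simp
qed

lemma weight_loop:
  assumes "0 \<le> s"
  shows "weight s (x @ y @ v # z) \<le> weight s x * (loop_weight s v y * weight s z)"
proof -
  have "weight s (y @ v # z) \<le> loop_weight s v y * weight s (v # z)"
  proof (rule weight_le)
    fix \<omega> assume w: "\<omega> \<in> cylinder G (y @ v # z)"
    have path: "\<omega> \<in> path_space G" using cylinder_path[OF w] .
    have c: "\<omega> \<in> cylinder G (y @ [v])" "(shift ^^ length y) \<omega> \<in> cylinder G (v # z)"
      using cylinder_append(1)[of \<omega> "y @ [v]" z] cylinder_append(2)[OF w] w by auto
    have "ennreal (orbit_norm (length (y @ v # z)) \<omega> powr s) =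
        ennreal (orbit_norm (length y) \<omega> powr s) * ennreal (orbit_norm (length (v # z)) ((shift ^^ length y) \<omega>) powr s)"
      using orbit_norm_pos shift_funpow_path path
      by (simp add: orbit_norm_add[of _ "length y" "Suc (length z)", simplified] powr_mult less_imp_le ennreal_mult[symmetric])
    also have "\<dots> \<le> loop_weight s v y * weight s (v # z)"
      unfolding loop_weight_def using c weight_ge[OF c(2)] by (intro mult_mono) (auto intro: SUP_upper)
    finally show "ennreal (orbit_norm (length (y @ v # z)) \<omega> powr s) \<le> loop_weight s v y * weight s (v # z)" .
  qed
  moreover have "weight s (v # z) \<le> weight s z"
  proof -
    have "weight s (v # z) \<le> weight s [v] * weight s z" using weight_append[of s "[v]" z] by simp
    also have "\<dots> \<le> 1 * weight s z" using weight_le_1[OF assms] by (intro mult_right_mono) auto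
    finally show ?thesis by simp
  qed
  ultimately have "weight s (y @ v # z) \<le> loop_weight s v y * weight s z"
    by (meson mult_left_mono order_trans zero_le)
  then show ?thesis using weight_append[of s x "y @ v # z"] by (meson mult_left_mono order_trans zero_le)
qed

text \<open>
  Split at the first and at the last occurrence of \<open>v\<close>; if these coincide, the loop is empty.
\<close>

lemma word_loop_decomposition:
  assumes "w \<in> words (insert v A) n" "v \<in> set w"
  shows "\<exists>x y z. w = x @ y @ v # z \<and> x \<in> words A (length x) \<and> y \<in> loops v (length y) \<and> z \<in> words A (length z)"
proof -
  obtain x u where x: "w = x @ v # u" "v \<notin> set x" using split_list_first[OF assms(2)] by blast
  have "v \<in> set (v # u)" by simp
  then obtain y z where y: "v # u = y @ v # z" "v \<notin> set z" using split_list_last by metis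
  have w: "w = x @ y @ v # z" using x(1) y(1) by simp
  have hd: "y \<noteq> [] \<longrightarrow> hd y = v" using y(1) by (metis hd_append2 list.sel(1))
  obtain \<omega> where \<omega>: "\<omega> \<in> cylinder G (x @ y @ v # z)" using assms(1) w by (auto simp: words_def)
  have c1: "\<omega> \<in> cylinder G x" "(shift ^^ length x) \<omega> \<in> cylinder G (y @ v # z)" using cylinder_append[OF \<omega>] .
  have c2: "(shift ^^ length x) \<omega> \<in> cylinder G (y @ [v])"
    using cylinder_append(1)[of "(shift ^^ length x) \<omega>" "y @ [v]" z] c1(2) by simp
  have c3: "cylinder G z \<noteq> {}"
    using cylinder_append(2)[of "(shift ^^ length x) \<omega>" "y @ [v]" z] c1(2) by auto
  have "set x \<subseteq> A" "set z \<subseteq> A" using assms(1) x(2) y(2) w by (auto simp: words_def)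
  then have "x \<in> words A (length x)" "z \<in> words A (length z)" "y \<in> loops v (length y)"
    using hd c1(1) c2 c3 by (auto simp: words_def loops_def)
  then show ?thesis using w by blast
qed

text \<open>
  The sum over the words that contain \<open>v\<close> is at most the sum over all decompositions into a word, a
  loop and a word of lengths \<open>i\<close>, \<open>j\<close>, \<open>k\<close> with \<open>i + j + k + 1 = n\<close>. For fixed \<open>i\<close> and \<open>k\<close> the sum
  factorizes.
\<close>

lemma decays_exponentially_insert:
  assumes s: "0 \<le> s" and A: "decays_exponentially (Z s A)" and v: "decays_exponentially (loop_sum s v)"
  shows "decays_exponentially (Z s (insert v A))"
proof -
  obtain C1 \<theta>1 where 1: "0 < \<theta>1" "\<theta>1 < 1" "\<And>n. Z s A n \<le> ennreal (C1 * \<theta>1 ^ n)"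
    using A unfolding decays_exponentially_def by blast
  obtain C2 \<theta>2 where 2: "0 < \<theta>2" "\<theta>2 < 1" "\<And>n. loop_sum s v n \<le> ennreal (C2 * \<theta>2 ^ n)"
    using v unfolding decays_exponentially_def by blast
  define C where "C = max 1 (max C1 C2)"
  define \<theta> where "\<theta> = max \<theta>1 \<theta>2"
  have \<theta>: "0 < \<theta>" "\<theta> < 1" and C: "1 \<le> C" using 1 2 by (auto simp: \<theta>_def C_def)
  have ZA: "Z s A n \<le> ennreal (C * \<theta> ^ n)" for n
  proof -
    have "C1 * \<theta>1 ^ n \<le> C * \<theta> ^ n" using 1 C by (intro mult_mono power_mono) (auto simp: C_def \<theta>_def)
    then show ?thesis using 1(3)[of n] by (meson ennreal_leI order_trans)
  qed
  have Lv: "loop_sum s v n \<le> ennreal (C * \<theta> ^ n)" for n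
  proof -
    have "C2 * \<theta>2 ^ n \<le> C * \<theta> ^ n" using 2 C by (intro mult_mono power_mono) (auto simp: C_def \<theta>_def)
    then show ?thesis using 2(3)[of n] by (meson ennreal_leI order_trans)
  qed
  have bound: "Z s (insert v A) n \<le> ennreal ((C ^ 3 / \<theta> + C) * (real n + 1)\<^sup>2 * \<theta> ^ n)" for n
    unfolding Z_def
  proof (rule infsum_ennreal_leI)
    fix F assume F: "finite F" "F \<subseteq> words (insert v A) n"
    define F0 where "F0 = {w \<in> F. v \<notin> set w}"
    define F1 where "F1 = {w \<in> F. v \<in> set w}"
    have F0: "sum (weight s) F0 \<le> ennreal (C * \<theta> ^ n)"
    proof -
      have "F0 \<subseteq> words A n" using F(2) by (auto simp: F0_def words_def)
      then have "sum (weight s) F0 \<le> Z s A n" unfolding Z_def using F(1) by (intro sum_le_infsum_ennreal) (auto simp: F0_def)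
      then show ?thesis using ZA order_trans by blast
    qed
    have "\<exists>x y z. w = x @ y @ v # z \<and> x \<in> words A (length x) \<and> y \<in> loops v (length y) \<and> z \<in> words A (length z)"
      if "w \<in> F1" for w
      using word_loop_decomposition[of w v A n] F(2) that by (auto simp: F1_def)
    then obtain X Y V where dec: "\<And>w. w \<in> F1 \<Longrightarrow> w = X w @ Y w @ v # V w"
      "\<And>w. w \<in> F1 \<Longrightarrow> X w \<in> words A (length (X w)) \<and> Y w \<in> loops v (length (Y w)) \<and> V w \<in> words A (length (V w))"
      by metis
    have finF1: "finite F1" using F(1) by (simp add: F1_def)
    have len: "length (X w) + length (Y w) + length (V w) + 1 = n" if "w \<in> F1" for w
      using arg_cong[OF dec(1)[OF that], of length] that F(2) by (auto simp: F1_def words_def)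
    let ?I = "{..<n} \<times> {..<n}"
    \<comment> \<open>The decomposition is injective on words, so the words with prescribed \<open>i\<close> and \<open>k\<close> sum to at
      most a product of three sums.\<close>
    have part: "sum (weight s) {w \<in> F1. (length (X w), length (V w)) = ik} \<le> ennreal (C ^ 3 / \<theta> * \<theta> ^ n)"
      if ik: "ik \<in> ?I" for ik
    proof -
      obtain i k where [simp]: "ik = (i, k)" by (cases ik)
      define D where "D = {w \<in> F1. (length (X w), length (V w)) = ik}"
      show ?thesis
      proof (cases "D = {}")
        case True
        then show ?thesis unfolding D_def[symmetric] by simp
      next
        case False
        then obtain w0 where "w0 \<in> D" by blast
        define j where "j = length (Y w0)"
        have ijk: "i + j + k + 1 = n" using \<open>w0 \<in> D\<close> len[of w0] by (auto simp: D_def j_def)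
        have D: "X w \<in> words A i" "Y w \<in> loops v j" "V w \<in> words A k" if "w \<in> D" for w
          using dec[of w] len[of w] ijk that by (auto simp: D_def)
        have finD: "finite D" using finF1 by (simp add: D_def)
        have inj: "inj_on (\<lambda>w. (X w, Y w, V w)) D"
          by (rule inj_onI) (metis (no_types, lifting) D_def dec(1) mem_Collect_eq prod.inject)
        have "sum (weight s) D \<le> (\<Sum>w\<in>D. weight s (X w) * (loop_weight s v (Y w) * weight s (V w)))"
        proof (rule sum_mono)
          fix w assume "w \<in> D"
          then have "w = X w @ Y w @ v # V w" using dec(1) by (simp add: D_def)
          then show "weight s w \<le> weight s (X w) * (loop_weight s v (Y w) * weight s (V w))"
            using weight_loop[OF s, of "X w" "Y w" v "V w"] by metis
        qed
        also have "\<dots> = (\<Sum>(x, y, z)\<in>(\<lambda>w. (X w, Y w, V w)) ` D. weight s x * (loop_weight s v y * weight s z))"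
          by (subst sum.reindex[OF inj]) simp
        also have "\<dots> \<le> (\<Sum>(x, y, z)\<in>X ` D \<times> Y ` D \<times> V ` D. weight s x * (loop_weight s v y * weight s z))"
          using finD by (intro sum_mono2) auto
        also have "\<dots> = sum (weight s) (X ` D) * (sum (loop_weight s v) (Y ` D) * sum (weight s) (V ` D))"
          by (simp add: sum.cartesian_product[symmetric] sum_distrib_left[symmetric] sum_distrib_right[symmetric])
        also have "\<dots> \<le> ennreal (C * \<theta> ^ i) * (ennreal (C * \<theta> ^ j) * ennreal (C * \<theta> ^ k))"
        proof (intro mult_mono)
          show "sum (weight s) (X ` D) \<le> ennreal (C * \<theta> ^ i)"
            using sum_le_infsum_ennreal[of "X ` D" "words A i" "weight s"] finD D ZA[of i] unfolding Z_def by (auto intro: order_trans)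
          show "sum (loop_weight s v) (Y ` D) \<le> ennreal (C * \<theta> ^ j)"
            using sum_le_infsum_ennreal[of "Y ` D" "loops v j" "loop_weight s v"] finD D Lv[of j] unfolding loop_sum_def by (auto intro: order_trans)
          show "sum (weight s) (V ` D) \<le> ennreal (C * \<theta> ^ k)"
            using sum_le_infsum_ennreal[of "V ` D" "words A k" "weight s"] finD D ZA[of k] unfolding Z_def by (auto intro: order_trans)
        qed auto
        also have "\<dots> = ennreal (C ^ 3 / \<theta> * \<theta> ^ n)"
          using \<theta> C by (simp add: ennreal_mult[symmetric] ijk[symmetric] power_add power3_eq_cube mult_ac)
        finally show ?thesis unfolding D_def .
      qed
    qed
    have "sum (weight s) F1 = (\<Sum>ik\<in>?I. sum (weight s) {w \<in> F1. (length (X w), length (V w)) = ik})"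
      by (rule sum.group[symmetric]) (use finF1 len in force)+
    also have "\<dots> \<le> (\<Sum>ik\<in>?I. ennreal (C ^ 3 / \<theta> * \<theta> ^ n))" by (rule sum_mono) (rule part)
    also have "\<dots> = of_nat (n * n) * ennreal (C ^ 3 / \<theta> * \<theta> ^ n)"
      by (simp only: sum_constant card_cartesian_product card_lessThan)
    also have "\<dots> = ennreal ((real n)\<^sup>2 * (C ^ 3 / \<theta> * \<theta> ^ n))"
      unfolding ennreal_of_nat_eq_real_of_nat using C \<theta> by (subst ennreal_mult[symmetric]) (auto simp: power2_eq_square)
    also have "\<dots> \<le> ennreal ((real n + 1)\<^sup>2 * (C ^ 3 / \<theta> * \<theta> ^ n))"
      using C \<theta> by (intro ennreal_leI mult_right_mono power_mono) auto
    finally have F1: "sum (weight s) F1 \<le> ennreal ((real n + 1)\<^sup>2 * (C ^ 3 / \<theta> * \<theta> ^ n))" .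
    have "C * \<theta> ^ n \<le> (real n + 1)\<^sup>2 * (C * \<theta> ^ n)"
      using mult_right_mono[of 1 "(real n + 1)\<^sup>2" "C * \<theta> ^ n"] one_le_power[of "real n + 1" 2] C \<theta> by simp
    then have "sum (weight s) F0 \<le> ennreal ((real n + 1)\<^sup>2 * (C * \<theta> ^ n))" using F0 by (meson ennreal_leI order_trans)
    then have "sum (weight s) F0 + sum (weight s) F1 \<le> ennreal ((real n + 1)\<^sup>2 * (C * \<theta> ^ n)) + ennreal ((real n + 1)\<^sup>2 * (C ^ 3 / \<theta> * \<theta> ^ n))"
      using F1 by (rule add_mono)
    also have "\<dots> = ennreal ((C ^ 3 / \<theta> + C) * (real n + 1)\<^sup>2 * \<theta> ^ n)"
      using C \<theta> by (subst ennreal_plus[symmetric]) (auto simp: algebra_simps)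
    also have "sum (weight s) F0 + sum (weight s) F1 = sum (weight s) F"
      using F(1) by (subst sum.union_disjoint[symmetric]) (auto simp: F0_def F1_def intro!: sum.cong)
    finally show "sum (weight s) F \<le> ennreal ((C ^ 3 / \<theta> + C) * (real n + 1)\<^sup>2 * \<theta> ^ n)" .
  qed
  obtain C' \<theta>' where "0 < \<theta>'" "\<theta>' < 1" "\<And>n. (C ^ 3 / \<theta> + C) * (real n + 1)\<^sup>2 * \<theta> ^ n \<le> C' * \<theta>' ^ n"
    using polynomial_times_geometric_bound[OF \<theta>, of "C ^ 3 / \<theta> + C"] C \<theta> by auto
  then show ?thesis unfolding decays_exponentially_def using bound by (meson ennreal_leI order_trans)
qed

definition vertex_weight :: "real \<Rightarrow> 'v \<Rightarrow> ennreal" where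
  "vertex_weight s v = (SUP u \<in> {u \<in> verts G. (v, u) \<in> E}.
     SUP x \<in> limit_set G J T \<inter> J u. ennreal (dinorm (tr v u) x powr s))"

text \<open>
  This is where summability over vertices enters: the edge that leaves \<open>v\<close> is only controlled
  by the supremum over all edges from \<open>v\<close>.
\<close>

lemma weight_single_le: "weight s [v] \<le> vertex_weight s v"
proof (rule weight_le)
  fix \<omega> assume w: "\<omega> \<in> cylinder G [v]"
  have path: "\<omega> \<in> path_space G" and v: "\<omega> 0 = v" using w by (auto simp: cylinder_def)
  let ?x = "coding G J T (shift \<omega>)"
  have E: "(v, \<omega> 1) \<in> E" using path v by (auto simp: path_space_def)
  have x: "?x \<in> limit_set G J T" "?x \<in> J (\<omega> 1)"
    using shift_path[OF path] coding_shift(2)[OF shift_path[OF path]] by (auto simp: limit_set_def shift_def)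
  then have "?x \<in> U (\<omega> 1)" using J_subset_U E_verts(2)[OF E] by blast
  then have "orbit_norm 1 \<omega> = dinorm (tr v (\<omega> 1)) ?x"
    using tr_derivative(3)[OF E] v by (simp add: orbit_norm_def)
  moreover have "ennreal (dinorm (tr v (\<omega> 1)) ?x powr s) \<le> vertex_weight s v"
    unfolding vertex_weight_def using E x E_verts(2)[OF E]
    by (intro SUP_upper2[of "\<omega> 1"] SUP_upper2[of ?x]) auto
  ultimately show "ennreal (orbit_norm (length [v]) \<omega> powr s) \<le> vertex_weight s v" by simp
qed

lemma Z_le_power:
  assumes "0 \<le> s" and A: "\<And>F. finite F \<Longrightarrow> F \<subseteq> A \<Longrightarrow> sum (vertex_weight s) F \<le> ennreal \<eta>" and "0 \<le> \<eta>"
  shows "Z s A n \<le> ennreal (\<eta> ^ n)"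
proof (induction n)
  case 0
  show ?case unfolding Z_def
  proof (rule infsum_ennreal_leI)
    fix F assume "finite F" "F \<subseteq> words A 0"
    then have "sum (weight s) F \<le> sum (weight s) {[]}" by (intro sum_mono2) (auto simp: words_def)
    also have "\<dots> \<le> 1" using weight_le_1[OF assms(1)] by simp
    finally show "sum (weight s) F \<le> ennreal (\<eta> ^ 0)" by simp
  qed
next
  case (Suc n)
  show ?case unfolding Z_def
  proof (rule infsum_ennreal_leI)
    fix F assume F: "finite F" "F \<subseteq> words A (Suc n)"
    have ne: "w \<noteq> []" if "w \<in> F" for w using that F(2) by (auto simp: words_def)
    have tl: "tl ` F \<subseteq> words A n"
    proof
      fix z assume "z \<in> tl ` F"
      then obtain w where w: "w \<in> F" "z = tl w" by blast
      then have eq: "w = [hd w] @ z" using ne by simp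
      have "w \<in> words A (Suc n)" using w F by blast
      then obtain \<omega> where "\<omega> \<in> cylinder G w" "length w = Suc n" "set w \<subseteq> A" by (auto simp: words_def)
      then show "z \<in> words A n"
        using cylinder_append(2)[of \<omega> "[hd w]" z] eq w(2) ne[OF w(1)] by (auto simp: words_def dest: list.set_sel(2))
    qed
    have hd: "hd ` F \<subseteq> A" using F(2) ne hd_in_set by (fastforce simp: words_def)
    have "sum (weight s) F \<le> (\<Sum>w\<in>F. vertex_weight s (hd w) * weight s (tl w))"
    proof (rule sum_mono)
      fix w assume "w \<in> F"
      then have "w = [hd w] @ tl w" using ne by simp
      then have "weight s w \<le> weight s [hd w] * weight s (tl w)" using weight_append by metis
      then show "weight s w \<le> vertex_weight s (hd w) * weight s (tl w)"
        using weight_single_le by (meson mult_right_mono order_trans zero_le)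
    qed
    also have "\<dots> = (\<Sum>(v, z)\<in>(\<lambda>w. (hd w, tl w)) ` F. vertex_weight s v * weight s z)"
      by (subst sum.reindex) (auto intro!: inj_onI simp: ne list.expand)
    also have "\<dots> \<le> (\<Sum>(v, z)\<in>hd ` F \<times> tl ` F. vertex_weight s v * weight s z)"
      using F(1) by (intro sum_mono2) auto
    also have "\<dots> = sum (vertex_weight s) (hd ` F) * sum (weight s) (tl ` F)"
      by (simp add: sum.cartesian_product[symmetric] sum_distrib_left[symmetric] sum_distrib_right[symmetric])
    also have "\<dots> \<le> ennreal \<eta> * ennreal (\<eta> ^ n)"
    proof (rule mult_mono)
      show "sum (weight s) (tl ` F) \<le> ennreal (\<eta> ^ n)"
        using sum_le_infsum_ennreal[of "tl ` F" "words A n" "weight s"] F(1) tl Suc.IH unfolding Z_def by (meson finite_imageI order_trans)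
    qed (use A F(1) hd in auto)
    also have "\<dots> = ennreal (\<eta> ^ Suc n)" using assms(3) by (simp add: ennreal_mult[symmetric])
    finally show "sum (weight s) F \<le> ennreal (\<eta> ^ Suc n)" .
  qed
qed

text \<open>
  Otherwise one starts with the vertices outside a finite set \<open>F\<close>, whose words decay like \<open>2\<^sup>-\<^sup>n\<close>,
  and adds the elements of \<open>F\<close>; finally the sum over all words decays exponentially, which
  contradicts that the pressure is \<open>0\<close>.
\<close>

lemma ex_nondecaying_loop_vertex:
  assumes s: "0 \<le> s" and summable: "infsum (vertex_weight s) (verts G) < \<infinity>"
    and P: "has_pressure G (\<lambda>\<omega>. s * phi_V G J T \<omega>) 0"
  shows "\<exists>v\<in>verts G. \<not> decays_exponentially (loop_sum s v)"
proof (rule ccontr)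
  assume "\<not> ?thesis"
  then have dec: "\<And>v. v \<in> verts G \<Longrightarrow> decays_exponentially (loop_sum s v)" by blast
  obtain F where F: "finite F" "F \<subseteq> verts G" "\<And>F'. finite F' \<Longrightarrow> F' \<subseteq> verts G - F \<Longrightarrow> sum (vertex_weight s) F' \<le> ennreal (1/2)"
    using ennreal_infsum_tail[OF summable, of "1/2"] by auto
  have "decays_exponentially (Z s ((verts G - F) \<union> F'))" if "F' \<subseteq> F" for F'
    using finite_subset[OF that F(1)] that
  proof (induction F' rule: finite_induct)
    case empty
    have "Z s (verts G - F) n \<le> ennreal (1 * (1/2) ^ n)" for n
      using Z_le_power[OF s F(3)] by simp
    then show ?case unfolding decays_exponentially_def by (intro exI[of _ 1] exI[of _ "1/2"]) simp
  next
    case (insert v F')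
    then have "decays_exponentially (Z s (insert v ((verts G - F) \<union> F')))"
      using F(2) by (intro decays_exponentially_insert[OF s _ dec]) auto
    then show ?case by simp
  qed
  from this[of F] F(2) have "decays_exponentially (Z s (verts G))" by (simp add: Un_absorb2)
  then obtain C \<theta> where C: "0 < \<theta>" "\<theta> < 1" "\<And>n. Z s (verts G) n \<le> ennreal (C * \<theta> ^ n)"
    unfolding decays_exponentially_def by blast
  define h where "h = ln (1 / \<theta>) / 2"
  have h: "0 < h" using C by (simp add: h_def)
  have th: "\<theta> ^ n = exp (- 2 * h * real n)" for n
    using C by (simp add: h_def ln_div powr_realpow[symmetric] powr_def)
  have "(\<lambda>n. C * exp (- h) ^ n) \<longlonglongrightarrow> C * 0"
    using h by (intro tendsto_mult tendsto_const LIMSEQ_power_zero) auto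
  then have "\<forall>\<^sub>F n in sequentially. C * exp (- h) ^ n < 1" by (intro order_tendstoD) auto
  then obtain n where n: "C * exp (- h) ^ n < 1" "ennreal (exp (- h * real n)) \<le> Z s (verts G) n"
    using eventually_happens[OF eventually_conj[OF _ pressure_zero_subexponential[OF P h]]] by auto
  have "ennreal (exp (- h * real n)) \<le> ennreal (C * \<theta> ^ n)" using n(2) C(3) order_trans by blast
  moreover have "C * \<theta> ^ n < exp (- h * real n)"
  proof -
    have "C * \<theta> ^ n = (C * exp (- h) ^ n) * exp (- h * real n)"
      unfolding th by (simp add: exp_of_nat_mult[symmetric] exp_add[symmetric] mult.commute)
    also have "\<dots> < 1 * exp (- h * real n)" using n(1) by (intro mult_strict_right_mono) auto
    finally show ?thesis by simp
  qed
  ultimately show False by (meson ennreal_le_iff exp_ge_zero exp_gt_zero ennreal_less_iff less_le_not_le not_le ennreal_leI linorder_not_less ennreal_lessI)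
qed

section \<open>Separation along paths\<close>

lemma vpath_map_invariant:
  assumes "\<And>a b. (a, b) \<in> E \<Longrightarrow> tr a b ` S b \<subseteq> S a" "vpath w"
  shows "vpath_map w ` S (last w) \<subseteq> S (hd w)"
  using assms(2)
proof (induction w rule: vpath.induct)
  case (3 u v w)
  then show ?case using assms(1)[of u v] by fastforce
qed auto

text \<open>
  Both separation conditions separate the images under different edges. For paths this carries over
  through the first edge at which they differ, because the common part is injective. In the applications
  \<open>S\<close> consists of the interiors of the sets \<open>J u\<close> under the open set condition, and of the
  sets \<open>vertex_limit u\<close> under strong separation.
\<close>

lemma vpath_images_disjoint:
  assumes S: "\<And>u. u \<in> verts G \<Longrightarrow> S u \<subseteq> U u" "\<And>a b. (a, b) \<in> E \<Longrightarrow> tr a b ` S b \<subseteq> S a"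
    and dis: "\<And>a b b'. (a, b) \<in> E \<Longrightarrow> (a, b') \<in> E \<Longrightarrow> b \<noteq> b' \<Longrightarrow> tr a b ` S b \<inter> tr a b' ` S b' = {}"
    and "vpath p" "vpath q" "length p = length q" "p \<noteq> q" "hd p = hd q"
  shows "vpath_map p ` S (last p) \<inter> vpath_map q ` S (last q) = {}"
  using assms(4-)
proof (induction p arbitrary: q rule: vpath.induct)
  case (2 u)
  then show ?case by (cases q) auto
next
  case (3 a b p)
  then obtain b' q' where q: "q = a # b' # q'" by (cases q rule: vpath.cases) auto
  have E: "(a, b) \<in> E" "(a, b') \<in> E" and p: "vpath (b # p)" "vpath (b' # q')" using 3 q by auto
  have im: "vpath_map w ` S (last w) \<subseteq> S (hd w)" if "vpath w" for w
    by (rule vpath_map_invariant[OF _ that]) (rule S(2))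
  show ?case
  proof (cases "b = b'")
    case False
    have "vpath_map (b # p) ` S (last (b # p)) \<subseteq> S b" "vpath_map (b' # q') ` S (last (b' # q')) \<subseteq> S b'"
      using im[OF p(1)] im[OF p(2)] by simp_all
    then have "tr a b ` (vpath_map (b # p) ` S (last (b # p))) \<inter> tr a b' ` (vpath_map (b' # q') ` S (last (b' # q'))) = {}"
      using dis[OF E False] by blast
    then show ?thesis unfolding q by (simp add: image_comp)
  next
    case True
    have "vpath_map (b # p) ` S (last (b # p)) \<inter> vpath_map (b' # q') ` S (last (b' # q')) = {}"
      using 3 q p True by (intro "3.IH") auto
    moreover have "inj_on (tr a b) (S b)"
      using vpath_map_inj[of "[a, b]"] E S(1)[OF E_verts(2)[OF E(1)]] E_verts(2)[OF E(1)]
      by (auto intro: inj_on_subset)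
    ultimately have "tr a b ` (vpath_map (b # p) ` S (last (b # p))) \<inter> tr a b ` (vpath_map (b' # q') ` S (last (b' # q'))) = {}"
      using im[OF p(1)] im[OF p(2)] True by (subst inj_on_image_Int[symmetric, of "tr a b" "S b"]) auto
    then show ?thesis unfolding q using True by (simp add: image_comp)
  qed
qed auto

text \<open>
  The sets \<open>J u\<close> may overlap, and \<open>J u \<inter> K\<close> may contain points whose codes start elsewhere;
  the map of an edge need not send such points to \<open>K\<close>. The points with a code starting at \<open>u\<close> form a
  family that the maps leave invariant.
\<close>

definition vertex_limit :: "'v \<Rightarrow> (real ^ 'n) set" where
  "vertex_limit u = coding G J T ` {\<omega> \<in> path_space G. \<omega> 0 = u}"

lemma vertex_limit_subset: "vertex_limit u \<subseteq> J u \<inter> limit_set G J T"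
  using coding_shift(2) by (auto simp: vertex_limit_def limit_set_def)

lemma tr_vertex_limit: "(a, b) \<in> E \<Longrightarrow> tr a b ` vertex_limit b \<subseteq> vertex_limit a"
proof
  fix x assume E: "(a, b) \<in> E" and "x \<in> tr a b ` vertex_limit b"
  then obtain \<omega> where w: "\<omega> \<in> path_space G" "\<omega> 0 = b" "x = tr a b (coding G J T \<omega>)"
    by (auto simp: vertex_limit_def)
  define \<omega>' where "\<omega>' = case_nat a \<omega>"
  have sh: "shift \<omega>' = \<omega>" by (auto simp: shift_def \<omega>'_def)
  have p: "\<omega>' \<in> path_space G"
    using w E E_verts by (auto simp: path_space_def \<omega>'_def split: nat.split)
  have "coding G J T \<omega>' = x" using coding_shift(1)[OF p] sh w by (simp add: \<omega>'_def)
  then show "x \<in> vertex_limit a" using p by (force simp: vertex_limit_def \<omega>'_def)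
qed

lemma tr_interior_J: "(a, b) \<in> E \<Longrightarrow> tr a b ` interior (J b) \<subseteq> interior (J a)"
proof (rule interior_maximal)
  assume E: "(a, b) \<in> E"
  show "tr a b ` interior (J b) \<subseteq> J a" using tr_J[OF E] interior_subset by blast
  obtain W g where W: "open W" "homeomorphism (U b) W (tr a b) g" using tr_homeomorphism[OF E] by metis
  have "interior (J b) \<subseteq> U b" using J_subset_U[OF E_verts(2)[OF E]] interior_subset by blast
  then have "openin (top_of_set W) (tr a b ` interior (J b))"
    by (intro homeomorphism_imp_open_map[OF W(2)] open_subset) auto
  then show "open (tr a b ` interior (J b))" using W(1) by (simp add: openin_open_eq)
qed

lemma strong_separation_tr:
  assumes "strong_separation G J T" "(a, b) \<in> E" "(a, b') \<in> E" "b \<noteq> b'"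
  shows "tr a b ` vertex_limit b \<inter> tr a b' ` vertex_limit b' = {}"
proof -
  obtain e where e: "e \<in> arcs G" "head G e = b" "tr a b = T e" using E_arc[OF assms(2)] by metis
  obtain e' where e': "e' \<in> arcs G" "head G e' = b'" "tr a b' = T e'" using E_arc[OF assms(3)] by metis
  have "T e ` (J b \<inter> limit_set G J T) \<inter> T e' ` (J b' \<inter> limit_set G J T) = {}"
    using assms(1) e e' assms(4) unfolding strong_separation_def by metis
  then show ?thesis using vertex_limit_subset[of b] vertex_limit_subset[of b'] unfolding e e' by blast
qed

lemma open_set_condition_tr:
  assumes "open_set_condition G J T" "(a, b) \<in> E" "(a, b') \<in> E" "b \<noteq> b'"
  shows "tr a b ` interior (J b) \<inter> tr a b' ` interior (J b') = {}"
proof -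
  obtain e where e: "e \<in> arcs G" "head G e = b" "tr a b = T e" using E_arc[OF assms(2)] by metis
  obtain e' where e': "e' \<in> arcs G" "head G e' = b'" "tr a b' = T e'" using E_arc[OF assms(3)] by metis
  show ?thesis using assms(1) e e' assms(4) unfolding open_set_condition_def by metis
qed

section \<open>Finite systems of loops\<close>

lemma loop_orbit_norm:
  assumes "\<omega> \<in> cylinder G (y @ [v])"
  shows "\<exists>x\<in>J v. orbit_norm (length y) \<omega> = vpath_norm (y @ [v]) x"
proof -
  have "map \<omega> [0..<Suc (length y)] = y @ [v]" using assms by (simp add: cylinder_def)
  moreover from this have "\<omega> (length y) = v" by simp
  ultimately show ?thesis
    using coding_shift(2)[OF shift_funpow_path[OF cylinder_path[OF assms], of "length y"]]
    by (auto simp: orbit_norm_def shift_funpow)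
qed

text \<open>
  If all finite sums of \<open>m y powr s\<close> over loops of one length \<open>n\<close> were below \<open>1\<close>, for every \<open>n\<close>, then the loop sums with
  exponent \<open>s0\<close> would be at most \<open>C r powr ((s0 - s) n)\<close>, where \<open>C\<close> accounts for comparing
  suprema with infima over \<open>J v\<close>. This is exponential decay.
\<close>

lemma ex_finite_loop_system:
  assumes v: "v \<in> verts G" and s: "0 \<le> s" "s < s0" and nd: "\<not> decays_exponentially (loop_sum s0 v)"
  shows "\<exists>n \<Lambda> m. 0 < n \<and> finite \<Lambda> \<and> \<Lambda> \<subseteq> loops v n \<and>
    (\<forall>y\<in>\<Lambda>. 0 < m y \<and> (\<forall>x\<in>J v. m y \<le> vpath_norm (y @ [v]) x)) \<and> 1 \<le> (\<Sum>y\<in>\<Lambda>. m y powr s)"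
proof -
  obtain x0 where x0: "x0 \<in> J v" using J_nonempty[OF v] by blast
  define m where "m y = vpath_norm (y @ [v]) x0 / L" for y
  have p: "vpath (y @ [v])" if "y \<in> loops v n" for y n
    using that cylinder_vpath[of _ "y @ [v]"] by (auto simp: loops_def)
  have pos: "0 < vpath_norm (y @ [v]) x0" if "y \<in> loops v n" for y n
    using vpath_norm_pos[OF p[OF that]] x0 J_subset_U[OF v] by auto
  have m: "0 < m y" "\<And>x. x \<in> J v \<Longrightarrow> m y \<le> vpath_norm (y @ [v]) x" "m y \<le> r ^ n"
    "loop_weight s0 v y \<le> ennreal ((L * L * m y) powr s0)"
    if y: "y \<in> loops v n" for y n
  proof -
    show "0 < m y" using pos[OF y] L_ge_1 by (simp add: m_def)
    show "m y \<le> vpath_norm (y @ [v]) x" if "x \<in> J v" for x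
      using vpath_norm_distortion[OF p[OF y], of x x0] that x0 L_ge_1 by (simp add: m_def field_simps)
    have "m y \<le> vpath_norm (y @ [v]) x0" using pos[OF y] L_ge_1 by (simp add: m_def field_simps)
    also have "\<dots> \<le> r ^ n" using vpath_norm_le[OF p[OF y], of x0] x0 J_subset_U[OF v] y by (auto simp: loops_def)
    finally show "m y \<le> r ^ n" .
    show "loop_weight s0 v y \<le> ennreal ((L * L * m y) powr s0)"
      unfolding loop_weight_def
    proof (rule SUP_least)
      fix \<omega> assume w: "\<omega> \<in> cylinder G (y @ [v])"
      obtain x where x: "x \<in> J v" "orbit_norm (length y) \<omega> = vpath_norm (y @ [v]) x" using loop_orbit_norm[OF w] by blast
      have "orbit_norm (length y) \<omega> \<le> L * L * m y"
        using vpath_norm_distortion[OF p[OF y], of x0 x] x x0 L_ge_1 by (simp add: m_def)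
      then show "ennreal (orbit_norm (length y) \<omega> powr s0) \<le> ennreal ((L * L * m y) powr s0)"
        using orbit_norm_pos[OF cylinder_path[OF w], of "length y"] s by (intro ennreal_leI powr_mono2) auto
    qed
  qed
  define C where "C = (L * L) powr s0"
  define \<theta> where "\<theta> = r powr (s0 - s)"
  have C: "1 \<le> C" unfolding C_def using L_ge_1 s by (intro ge_one_powr_ge_zero) (auto simp: mult_ge1_I)
  have \<theta>: "0 < \<theta>" "\<theta> < 1" unfolding \<theta>_def using r s powr_less_mono2[of "s0 - s" r 1] by auto
  obtain n where n: "\<not> loop_sum s0 v n \<le> ennreal (C * \<theta> ^ n)"
    using nd \<theta> unfolding decays_exponentially_def by blast
  then obtain \<Lambda> where \<Lambda>: "finite \<Lambda>" "\<Lambda> \<subseteq> loops v n" "\<not> sum (loop_weight s0 v) \<Lambda> \<le> ennreal (C * \<theta> ^ n)"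
    unfolding loop_sum_def using infsum_ennreal_leI by metis
  have n_pos: "0 < n"
  proof (rule ccontr)
    assume "\<not> 0 < n"
    then have "sum (loop_weight s0 v) \<Lambda> \<le> sum (loop_weight s0 v) {[]}"
      using \<Lambda>(2) by (intro sum_mono2) (auto simp: loops_def)
    also have "\<dots> \<le> 1" by (auto simp: loop_weight_def orbit_norm_def intro!: SUP_least)
    also have "\<dots> \<le> ennreal (C * \<theta> ^ n)" using C \<open>\<not> 0 < n\<close> by simp
    finally show False using \<Lambda>(3) by blast
  qed
  have le: "loop_weight s0 v y \<le> ennreal (C * \<theta> ^ n * m y powr s)" if "y \<in> \<Lambda>" for y
  proof -
    have y: "y \<in> loops v n" using that \<Lambda>(2) by blast
    have "(L * L * m y) powr s0 = C * (m y powr (s0 - s) * m y powr s)"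
      using m(1)[OF y] L_ge_1 by (simp add: C_def powr_mult powr_add[symmetric])
    also have "\<dots> \<le> C * (\<theta> ^ n * m y powr s)"
    proof -
      have "m y powr (s0 - s) \<le> (r ^ n) powr (s0 - s)" using m[OF y] s by (intro powr_mono2) auto
      also have "\<dots> = \<theta> ^ n" using r by (simp add: \<theta>_def powr_realpow[symmetric] powr_powr mult.commute)
      finally show ?thesis using C by (intro mult_left_mono mult_right_mono) auto
    qed
    finally have "ennreal ((L * L * m y) powr s0) \<le> ennreal (C * \<theta> ^ n * m y powr s)"
      by (intro ennreal_leI) (simp add: mult.assoc)
    then show ?thesis using m(4)[OF y] by (rule order_trans[rotated])
  qed
  have "sum (loop_weight s0 v) \<Lambda> \<le> (\<Sum>y\<in>\<Lambda>. ennreal (C * \<theta> ^ n * m y powr s))" by (rule sum_mono) (rule le)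
  also have "\<dots> = ennreal (C * \<theta> ^ n * (\<Sum>y\<in>\<Lambda>. m y powr s))"
    using C \<theta> by (subst sum_ennreal) (auto simp: sum_distrib_left)
  finally have "\<not> ennreal (C * \<theta> ^ n * (\<Sum>y\<in>\<Lambda>. m y powr s)) \<le> ennreal (C * \<theta> ^ n)"
    using \<Lambda>(3) order_trans by blast
  then have "\<not> C * \<theta> ^ n * (\<Sum>y\<in>\<Lambda>. m y powr s) \<le> C * \<theta> ^ n * 1" using ennreal_leI by auto
  then have "1 \<le> (\<Sum>y\<in>\<Lambda>. m y powr s)"
    using C \<theta> by (meson less_imp_le linear mult_left_mono mult_nonneg_nonneg order_trans zero_le_one zero_le_power)
  then show ?thesis using n_pos \<Lambda>(1,2) m(1,2) by (intro exI[of _ n] exI[of _ \<Lambda>] exI[of _ m]) blast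
qed

end

text \<open>
  Finitely many loops of the same length at one vertex generate a finite iterated function
  system on \<open>J v\<close>. Equal lengths guarantee that different loops are incomparable as paths.
\<close>

locale loop_system = conformal_simple_gifs G J U T \<delta> r M c1 \<beta>
  for G :: "('v, 'e) pre_digraph" and J U :: "'v \<Rightarrow> (real ^ 'n) set" and T :: "'e \<Rightarrow> real ^ 'n \<Rightarrow> real ^ 'n"
    and \<delta> r M c1 \<beta> :: real +
  fixes v :: 'v and n :: nat and \<Lambda> :: "'v list set"
  assumes v: "v \<in> verts G" and n: "0 < n" and fin: "finite \<Lambda>" and ne: "\<Lambda> \<noteq> {}" and \<Lambda>: "\<Lambda> \<subseteq> loops v n"
begin

text \<open>
  A word of loops, as a single path from \<open>v\<close> to \<open>v\<close>. Hence the uniform distortion bounds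
  for paths apply to all compositions of the loop system.
\<close>

definition loop_path :: "'v list list \<Rightarrow> 'v list" where
  "loop_path u = concat u @ [v]"

lemma loop_hd:
  assumes "y \<in> \<Lambda>"
  obtains q where "y = v # q" "length y = n" "vpath (y @ [v])"
proof -
  have "length y = n" "hd y = v" "y \<noteq> []" "cylinder G (y @ [v]) \<noteq> {}"
    using assms \<Lambda> n by (auto simp: loops_def)
  then show thesis using that cylinder_vpath[of _ "y @ [v]"] by (cases y) auto
qed

lemma loop_path_hd:
  assumes "set u \<subseteq> \<Lambda>"
  obtains q where "loop_path u = v # q"
  using assms by (cases u) (auto simp: loop_path_def elim: loop_hd)

lemma loop_path_Cons:
  assumes "y \<in> \<Lambda>" "set u \<subseteq> \<Lambda>"
  shows "vpath (loop_path (y # u)) \<longleftrightarrow> vpath (loop_path u)"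
    "vpath_map (loop_path (y # u)) = vpath_map (y @ [v]) \<circ> vpath_map (loop_path u)"
    "vpath_norm (loop_path (y # u)) x = vpath_norm (y @ [v]) (vpath_map (loop_path u) x) * vpath_norm (loop_path u) x"
proof -
  obtain q where q: "loop_path u = v # q" using loop_path_hd[OF assms(2)] .
  have eq: "loop_path (y # u) = y @ v # q" using q by (simp add: loop_path_def)
  have "vpath (y @ [v])" using loop_hd[OF assms(1)] by metis
  then show "vpath (loop_path (y # u)) \<longleftrightarrow> vpath (loop_path u)"
    unfolding eq q using vpath_append[of y v q] by simp
  show "vpath_map (loop_path (y # u)) = vpath_map (y @ [v]) \<circ> vpath_map (loop_path u)"
    unfolding eq q by (rule vpath_map_append)
  show "vpath_norm (loop_path (y # u)) x = vpath_norm (y @ [v]) (vpath_map (loop_path u) x) * vpath_norm (loop_path u) x"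
    unfolding eq q by (rule vpath_norm_append)
qed

lemma vpath_loop_path: "set u \<subseteq> \<Lambda> \<Longrightarrow> vpath (loop_path u)"
proof (induction u)
  case Nil
  then show ?case using v by (simp add: loop_path_def)
next
  case (Cons y u)
  then show ?case using loop_path_Cons(1)[of y u] by simp
qed

lemma last_loop_path [simp]: "last (loop_path u) = v"
  by (simp add: loop_path_def)

lemma hd_loop_path: "set u \<subseteq> \<Lambda> \<Longrightarrow> hd (loop_path u) = v"
  by (erule loop_path_hd) simp

lemma length_loop_path: "set u \<subseteq> \<Lambda> \<Longrightarrow> length (loop_path u) = n * length u + 1"
  by (induction u) (auto simp: loop_path_def elim: loop_hd)

lemma loop_path_append:
  assumes "set u \<subseteq> \<Lambda>" "set w \<subseteq> \<Lambda>"
  shows "vpath_map (loop_path (u @ w)) = vpath_map (loop_path u) \<circ> vpath_map (loop_path w)"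
    and "vpath_norm (loop_path (u @ w)) x = vpath_norm (loop_path u) (vpath_map (loop_path w) x) * vpath_norm (loop_path w) x"
proof -
  obtain q where q: "loop_path w = v # q" using loop_path_hd[OF assms(2)] .
  have eq: "loop_path (u @ w) = concat u @ v # q" using q by (simp add: loop_path_def)
  show "vpath_map (loop_path (u @ w)) = vpath_map (loop_path u) \<circ> vpath_map (loop_path w)"
    unfolding eq q by (subst vpath_map_append) (simp add: loop_path_def)
  show "vpath_norm (loop_path (u @ w)) x = vpath_norm (loop_path u) (vpath_map (loop_path w) x) * vpath_norm (loop_path w) x"
    unfolding eq q by (subst vpath_norm_append) (simp add: loop_path_def)
qed

lemma loop_path_single: "loop_path [y] = y @ [v]" by (simp add: loop_path_def)

lemma loop_path_map_J: "set u \<subseteq> \<Lambda> \<Longrightarrow> x \<in> J v \<Longrightarrow> vpath_map (loop_path u) x \<in> J v"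
  using vpath_map_J[OF vpath_loop_path, of u x] hd_loop_path[of u] by simp

text \<open>
  The largest subset of \<open>J v\<close> covered by its own images. The closure of such a set is again of
  this kind, which yields compactness, and membership can be proved by coinduction.
\<close>

definition attractor :: "(real ^ 'n) set" where
  "attractor = gfp (\<lambda>S. J v \<inter> (\<Union>y\<in>\<Lambda>. vpath_map (y @ [v]) ` S))"

lemma attractor_mono: "mono (\<lambda>S. J v \<inter> (\<Union>y\<in>\<Lambda>. vpath_map (y @ [v]) ` S))"
  by (intro monoI) blast

lemma attractor_unfold: "attractor = J v \<inter> (\<Union>y\<in>\<Lambda>. vpath_map (y @ [v]) ` attractor)"
  unfolding attractor_def by (rule gfp_unfold[OF attractor_mono])

lemma attractor_J: "attractor \<subseteq> J v" using attractor_unfold by blast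

lemma subset_attractorI: "S \<subseteq> J v \<Longrightarrow> S \<subseteq> (\<Union>y\<in>\<Lambda>. vpath_map (y @ [v]) ` S) \<Longrightarrow> S \<subseteq> attractor"
  unfolding attractor_def by (rule gfp_upperbound) simp

lemma loop_map_attractor: "y \<in> \<Lambda> \<Longrightarrow> vpath_map (y @ [v]) ` attractor \<subseteq> attractor"
proof -
  assume y: "y \<in> \<Lambda>"
  have "vpath_map (y @ [v]) ` attractor \<subseteq> J v"
    using loop_path_map_J[of "[y]"] y attractor_J by (auto simp: loop_path_single)
  then show ?thesis using attractor_unfold y by blast
qed

lemma loop_path_map_attractor: "set u \<subseteq> \<Lambda> \<Longrightarrow> x \<in> attractor \<Longrightarrow> vpath_map (loop_path u) x \<in> attractor"
proof (induction u)
  case Nil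
  then show ?case by (simp add: loop_path_def)
next
  case (Cons y u)
  then show ?case using loop_path_Cons(2)[of y u] loop_map_attractor[of y] by auto
qed

lemma compact_loop_image:
  assumes "y \<in> \<Lambda>" "compact S" "S \<subseteq> J v"
  shows "compact (vpath_map (y @ [v]) ` S)"
proof (rule compact_continuous_image[OF _ assms(2)])
  have "vpath (y @ [v])" using loop_hd[OF assms(1)] by metis
  then show "continuous_on S (vpath_map (y @ [v]))"
    using vpath_map_continuous[of "y @ [v]"] J_subset_U[OF v] assms(3) continuous_on_subset by (metis last_snoc order_trans)
qed

lemma compact_attractor: "compact attractor"
proof -
  have cl: "closure attractor \<subseteq> J v"
    using attractor_J J_compact[OF v] by (simp add: closure_minimal compact_imp_closed)
  have bdd: "bounded attractor" using attractor_J J_compact[OF v] bounded_subset compact_imp_bounded by blast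
  then have ccl: "compact (closure attractor)" by simp
  have "closed (\<Union>y\<in>\<Lambda>. vpath_map (y @ [v]) ` closure attractor)"
    using fin compact_loop_image[OF _ ccl cl] by (intro closed_UN) (auto intro: compact_imp_closed)
  moreover have "attractor \<subseteq> (\<Union>y\<in>\<Lambda>. vpath_map (y @ [v]) ` closure attractor)"
    using attractor_unfold closure_subset[of attractor] by blast
  ultimately have "closure attractor \<subseteq> (\<Union>y\<in>\<Lambda>. vpath_map (y @ [v]) ` closure attractor)"
    by (intro closure_minimal)
  then have "closure attractor \<subseteq> attractor" using cl by (intro subset_attractorI)
  then have "closure attractor = attractor" using closure_subset by blast
  then show ?thesis using ccl by simp
qed

text \<open>
  It contains the point coded by the periodic path that repeats one of the loops.
\<close>

lemma attractor_nonempty: "attractor \<noteq> {}"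
proof -
  obtain y where y: "y \<in> \<Lambda>" using ne by blast
  obtain q where q: "y = v # q" "length y = n" "vpath (y @ [v])" using loop_hd[OF y] .
  define \<omega> where "\<omega> i = y ! (i mod n)" for i
  have edge: "(p ! i, p ! Suc i) \<in> E" if "vpath p" "Suc i < length p" for p i
  proof -
    have "p = take i p @ p ! i # p ! Suc i # drop (Suc (Suc i)) p"
      using that(2) by (simp add: Cons_nth_drop_Suc)
    then show ?thesis using that(1) vpath_append[of "take i p" "p ! i" "p ! Suc i # drop (Suc (Suc i)) p"] by simp
  qed
  have "(\<omega> i, \<omega> (Suc i)) \<in> E" for i
  proof -
    have i: "i mod n < n" using n by simp
    have e: "((y @ [v]) ! (i mod n), (y @ [v]) ! Suc (i mod n)) \<in> E"
      by (rule edge[OF q(3)]) (use i q(2) in simp)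
    show ?thesis
    proof (cases "Suc (i mod n) = n")
      case True
      then have "\<omega> (Suc i) = v" using q(1) by (simp add: \<omega>_def mod_Suc)
      then show ?thesis using e True q(2) by (simp add: \<omega>_def nth_append)
    next
      case False
      then show ?thesis using e i q(2) by (simp add: \<omega>_def nth_append mod_Suc)
    qed
  qed
  then have path: "\<omega> \<in> path_space G" using E_verts(1) by (auto simp: path_space_def)
  have per: "(shift ^^ n) \<omega> = \<omega>" unfolding shift_funpow by (simp add: \<omega>_def fun_eq_iff)
  have "map \<omega> [0..<n] = y" using q(2) by (intro nth_equalityI) (auto simp: \<omega>_def)
  then have mp: "map \<omega> [0..<Suc n] = y @ [v]" using q(1) n by (simp add: \<omega>_def)
  have "coding G J T \<omega> = vpath_map (y @ [v]) (coding G J T \<omega>)"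
    using coding_funpow_shift[OF path, of n] unfolding per mp .
  moreover have "coding G J T \<omega> \<in> J v" using coding_shift(2)[OF path] q(1) by (simp add: \<omega>_def)
  ultimately have "{coding G J T \<omega>} \<subseteq> attractor"
    using y by (intro subset_attractorI) auto
  then show ?thesis by blast
qed

text \<open>
  Apply \<open>orbit_in_coding_image\<close> to the images of points of the attractor under the terminal
  segments of the loops.
\<close>

lemma attractor_coded:
  assumes H: "subgraph H G" and edges: "\<And>y p a b q. y \<in> \<Lambda> \<Longrightarrow> y @ [v] = p @ a # b # q \<Longrightarrow> (a, b) \<in> arcs_ends H"
    and x: "x \<in> attractor"
  shows "\<exists>\<omega>\<in>path_space H. \<omega> 0 = v \<and> coding G J T \<omega> = x"
proof -
  define S where "S = {(a, x). \<exists>y p q z. y \<in> \<Lambda> \<and> y @ [v] = p @ a # q \<and> q \<noteq> [] \<and> z \<in> attractor \<and> x = vpath_map (a # q) z}"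
  have start: "(v, x) \<in> S" if x: "x \<in> attractor" for x
  proof -
    obtain y z where y: "y \<in> \<Lambda>" "z \<in> attractor" "x = vpath_map (y @ [v]) z" using x attractor_unfold by blast
    obtain q where q: "y = v # q" using loop_hd[OF y(1)] by metis
    then have "y @ [v] = [] @ v # (q @ [v])" "x = vpath_map (v # (q @ [v])) z" using y(3) by auto
    then show ?thesis unfolding S_def using y(1,2) by blast
  qed
  have step: "x \<in> J a \<and> (\<exists>a' x'. (a', x') \<in> S \<and> (a, a') \<in> arcs_ends H \<and> x = tr a a' x')" if ax: "(a, x) \<in> S" for a x
  proof -
    obtain y p q z where y: "y \<in> \<Lambda>" "y @ [v] = p @ a # q" "q \<noteq> []" "z \<in> attractor" "x = vpath_map (a # q) z"
      using ax unfolding S_def by blast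
    obtain b q' where q: "q = b # q'" using y(3) by (cases q) auto
    have "vpath (y @ [v])" using loop_hd[OF y(1)] by metis
    then have "vpath (a # q)" using vpath_append[of p a q] y(2) by simp
    moreover have last: "last (a # q) = v" using arg_cong[OF y(2), of last] by simp
    ultimately have "x \<in> J a" using vpath_map_J[of "a # q" z] y(4,5) attractor_J by auto
    moreover have "(b, vpath_map (b # q') z) \<in> S"
    proof (cases "q' = []")
      case True
      then show ?thesis using start[OF y(4)] last q by simp
    next
      case False
      have "y @ [v] = (p @ [a]) @ b # q'" using y(2) q by simp
      then show ?thesis unfolding S_def using y(1,4) False by blast
    qed
    moreover have "(a, b) \<in> arcs_ends H" using edges[OF y(1)] y(2) q by blast
    moreover have "x = tr a b (vpath_map (b # q') z)" using y(5) q by simp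
    ultimately show ?thesis by blast
  qed
  show ?thesis by (rule orbit_in_coding_image[OF H step start[OF x]])
qed

lemma attractor_vertex_limit: "attractor \<subseteq> vertex_limit v"
proof
  fix x assume x: "x \<in> attractor"
  have "(a, b) \<in> E" if "y \<in> \<Lambda>" "y @ [v] = p @ a # b # q" for y p a b q
  proof -
    have "vpath (y @ [v])" using loop_hd[OF that(1)] by metis
    then show ?thesis using vpath_append[of p a "b # q"] that(2) by simp
  qed
  moreover have "subgraph G G" by (simp add: subgraph_def wf_digraph_axioms compatible_def)
  ultimately obtain \<omega> where "\<omega> \<in> path_space G" "\<omega> 0 = v" "coding G J T \<omega> = x"
    using attractor_coded[of G x] x by blast
  then show "x \<in> vertex_limit v" by (auto simp: vertex_limit_def)
qed

section \<open>Positive Hausdorff measure of the attractor\<close>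

lemma loop_images_disjoint:
  assumes ij: "i \<in> \<Lambda>" "j \<in> \<Lambda>" "i \<noteq> j"
    and S: "\<And>u. u \<in> verts G \<Longrightarrow> S u \<subseteq> U u" "\<And>a b. (a, b) \<in> E \<Longrightarrow> tr a b ` S b \<subseteq> S a"
    and dis: "\<And>a b b'. (a, b) \<in> E \<Longrightarrow> (a, b') \<in> E \<Longrightarrow> b \<noteq> b' \<Longrightarrow> tr a b ` S b \<inter> tr a b' ` S b' = {}"
  shows "vpath_map (i @ [v]) ` S v \<inter> vpath_map (j @ [v]) ` S v = {}"
proof -
  obtain q where q: "i = v # q" "length i = n" "vpath (i @ [v])" using loop_hd[OF ij(1)] .
  obtain q' where q': "j = v # q'" "length j = n" "vpath (j @ [v])" using loop_hd[OF ij(2)] .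
  show ?thesis using vpath_images_disjoint[OF S dis q(3) q'(3)] ij(3) q q' by simp
qed

text \<open>
  The mass distribution principle is applied to words of loops, with scale \<open>N u\<close> the derivative of
  the composition at a reference point \<open>x0\<close>, points \<open>x w\<close> the images of a fixed \<open>z0\<close>, and probabilities
  proportional to \<open>m y powr s\<close>. The product of the \<open>m y\<close> along \<open>u\<close> is a lower bound for \<open>N u\<close>, but it may be
  much smaller than \<open>N u\<close>; so words are stopped by \<open>N\<close>, whose ratio to the size of the piece is
  bounded by distortion. The disjoint balls are images of a ball in the interior of \<open>J v\<close> under
  the open set condition. Under strong separation they are centred at the points \<open>x w\<close> themselves:
  two stopped words differ first after a common prefix \<open>c\<close> with \<open>N c \<ge> \<rho>\<close>, and the map of \<open>c\<close>
  shrinks the positive distance between the first-level pieces of the attractor at most by a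
  factor comparable to \<open>N c\<close>.
\<close>

lemma hausdorff_measure_attractor_nonzero:
  assumes m: "\<And>y. y \<in> \<Lambda> \<Longrightarrow> 0 < m y" "\<And>y x. y \<in> \<Lambda> \<Longrightarrow> x \<in> J v \<Longrightarrow> m y \<le> vpath_norm (y @ [v]) x"
    and sum_m: "1 \<le> (\<Sum>y\<in>\<Lambda>. m y powr s)" and s: "0 < s"
    and sep: "strong_separation G J T \<or> open_set_condition G J T"
  shows "hausdorff_measure s attractor \<noteq> 0"
proof -
  let ?P = "loop_path" and ?K = "attractor"
  note vp = vpath_loop_path
  note app = loop_path_append
  obtain x0 where x0: "x0 \<in> J v" using J_nonempty[OF v] by blast
  obtain z0 where z0: "z0 \<in> ?K" using attractor_nonempty by blast
  have KJ: "?K \<subseteq> J v" by (rule attractor_J)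
  define N where "N u = vpath_norm (?P u) x0" for u
  define x where "x u = vpath_map (?P u) z0" for u
  define p where "p y = m y powr s / (\<Sum>y\<in>\<Lambda>. m y powr s)" for y
  have pos: "0 < vpath_norm (?P u) z" if "set u \<subseteq> \<Lambda>" "z \<in> J v" for u z
    using vpath_norm_pos[OF vp[OF that(1)], of z] J_subset_U[OF v] that(2) by auto
  have comp: "vpath_norm (?P u) z \<le> L * vpath_norm (?P u) z'" if "set u \<subseteq> \<Lambda>" "z \<in> J v" "z' \<in> J v" for u z z'
    using vpath_norm_distortion[OF vp[OF that(1)], of z' z] that by simp
  have xK: "x w \<in> ?K" if "set w \<subseteq> \<Lambda>" for w
    unfolding x_def using loop_path_map_attractor[OF that z0] .
  have x_app: "x (u @ w) = vpath_map (?P u) (x w)" if "set u \<subseteq> \<Lambda>" "set w \<subseteq> \<Lambda>" for u w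
    unfolding x_def using app(1)[OF that] by simp
  have prod_m: "prod_list (map m u) \<le> vpath_norm (?P u) z \<and> 0 < prod_list (map m u)"
    if "set u \<subseteq> \<Lambda>" "z \<in> J v" for u z
    using that(1)
  proof (induction u)
    case Nil
    then show ?case by (simp add: loop_path_def)
  next
    case (Cons y u)
    have y: "y \<in> \<Lambda>" and u: "set u \<subseteq> \<Lambda>" using Cons.prems by auto
    have "vpath_map (?P u) z \<in> J v" using loop_path_map_J[OF u that(2)] .
    then have "m y * prod_list (map m u) \<le> vpath_norm (y @ [v]) (vpath_map (?P u) z) * vpath_norm (?P u) z"
      using Cons.IH[OF u] m[OF y] by (intro mult_mono) (auto intro: less_imp_le order_trans)
    then show ?case using loop_path_Cons(3)[OF y u] Cons.IH[OF u] m(1)[OF y] by simp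
  qed
  have p_weight: "prod_list (map p u) \<le> N u powr s" if u: "set u \<subseteq> \<Lambda>" for u
  proof -
    have "prod_list (map p u) \<le> prod_list (map m u) powr s \<and> 0 \<le> prod_list (map p u)"
      using u
    proof (induction u)
      case (Cons y u)
      have "m y powr s / (\<Sum>y\<in>\<Lambda>. m y powr s) \<le> m y powr s / 1" using sum_m by (intro frac_le) auto
      then have "p y \<le> m y powr s" "0 \<le> p y" using sum_m by (auto simp: p_def)
      then show ?case using Cons m(1)[of y] prod_m[of u x0] x0
        by (auto simp: powr_mult less_imp_le intro!: mult_mono)
    qed simp
    moreover have "prod_list (map m u) powr s \<le> N u powr s"
      unfolding N_def using prod_m[OF u x0] s by (intro powr_mono2) auto
    ultimately show ?thesis by simp
  qed
  have N_pos: "0 < N u" if "set u \<subseteq> \<Lambda>" for u unfolding N_def using pos[OF that x0] .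
  have N_le: "N u \<le> r ^ length u" if u: "set u \<subseteq> \<Lambda>" for u
  proof -
    have "N u \<le> r ^ (n * length u)"
      unfolding N_def using vpath_norm_le[OF vp[OF u], of x0] x0 J_subset_U[OF v] length_loop_path[OF u] by auto
    also have "\<dots> \<le> r ^ length u" using r n by (intro power_decreasing) auto
    finally show ?thesis .
  qed
  define \<kappa> where "\<kappa> = Min (m ` \<Lambda>) / L"
  have \<kappa>: "0 < \<kappa>" unfolding \<kappa>_def using fin ne m(1) L_ge_1 by simp
  \<comment> \<open>One more loop after a prefix of scale at least \<open>\<rho>\<close> costs at most the factor \<open>\<kappa>\<close>.\<close>
  have stopped_lower: "\<kappa> * \<rho> \<le> N u" if u: "u \<in> stopped \<Lambda> N \<rho>" and \<rho>: "0 < \<rho>" "\<rho> \<le> 1" for u \<rho>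
  proof -
    have "u \<noteq> []" using u \<rho> by (auto simp: stopped_def N_def loop_path_def)
    then obtain u' y where uy: "u = u' @ [y]" by (meson rev_exhaust)
    have sets: "set u' \<subseteq> \<Lambda>" "y \<in> \<Lambda>" "\<rho> \<le> N u'"
      using u unfolding uy by (auto simp: stopped_def strict_prefix_def)
    have "vpath_map (?P [y]) x0 \<in> J v" using loop_path_map_J[OF _ x0, of "[y]"] sets by simp
    then have 1: "\<rho> / L \<le> vpath_norm (?P u') (vpath_map (?P [y]) x0)"
      using comp[OF sets(1) x0] sets(3) L_ge_1 by (auto simp: N_def field_simps intro: order_trans)
    have 2: "Min (m ` \<Lambda>) \<le> vpath_norm (?P [y]) x0"
      using m(2)[OF sets(2) x0] fin sets(2) by (auto simp: loop_path_def intro: order_trans[OF Min_le])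
    have 3: "0 \<le> Min (m ` \<Lambda>)" using fin ne m(1) by (auto intro: less_imp_le)
    have "\<rho> / L * Min (m ` \<Lambda>) \<le> vpath_norm (?P u') (vpath_map (?P [y]) x0) * vpath_norm (?P [y]) x0"
      using 1 2 3 \<rho> L_ge_1 by (intro mult_mono) (auto intro: order_trans[rotated])
    then show ?thesis unfolding uy N_def \<kappa>_def using app(2)[of u' "[y]" x0] sets by (simp add: mult.commute)
  qed
  have antichain: "\<exists>c i u1 j u2. i \<noteq> j \<and> u = c @ i # u1 \<and> u' = c @ j # u2 \<and> \<rho> \<le> N c \<and> set c \<subseteq> \<Lambda> \<and> i \<in> \<Lambda> \<and> j \<in> \<Lambda> \<and> set u1 \<subseteq> \<Lambda> \<and> set u2 \<subseteq> \<Lambda>"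
    if u: "u \<in> stopped \<Lambda> N \<rho>" "u' \<in> stopped \<Lambda> N \<rho>" "u \<noteq> u'" for u u' \<rho>
  proof -
    have "\<not> strict_prefix u u'" "\<not> strict_prefix u' u" using u by (force simp: stopped_def)+
    then have "parallel u u'" using u(3) unfolding parallel_def strict_prefix_def by blast
    then obtain c i u1 j u2 where c: "i \<noteq> j" "u = c @ i # u1" "u' = c @ j # u2"
      using parallel_decomp by blast
    have "strict_prefix c u" unfolding c(2) by (simp add: strict_prefix_def)
    then have "\<rho> \<le> N c" using u(1) by (auto simp: stopped_def)
    moreover have "set u \<subseteq> \<Lambda>" "set u' \<subseteq> \<Lambda>" using u by (auto simp: stopped_def)
    ultimately show ?thesis using c by (intro exI[of _ c] exI[of _ i] exI[of _ u1] exI[of _ j] exI[of _ u2]) auto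
  qed
  have disjoint_images: "vpath_map (?P u) ` S v \<inter> vpath_map (?P u') ` S v = {}"
    if S: "\<And>u. u \<in> verts G \<Longrightarrow> S u \<subseteq> J u" "\<And>a b. (a, b) \<in> E \<Longrightarrow> tr a b ` S b \<subseteq> S a"
      and dis: "\<And>a b b'. (a, b) \<in> E \<Longrightarrow> (a, b') \<in> E \<Longrightarrow> b \<noteq> b' \<Longrightarrow> tr a b ` S b \<inter> tr a b' ` S b' = {}"
      and u: "u = c @ i # u1" "u' = c @ j # u2" "i \<noteq> j" "set c \<subseteq> \<Lambda>" "i \<in> \<Lambda>" "j \<in> \<Lambda>" "set u1 \<subseteq> \<Lambda>" "set u2 \<subseteq> \<Lambda>"
    for S c i j u u' u1 u2
  proof -
    have im: "vpath_map w ` S (last w) \<subseteq> S (hd w)" if "vpath w" for w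
      by (rule vpath_map_invariant[OF _ that]) (rule S(2))
    have F: "vpath_map (?P w) ` S v \<subseteq> S v" if "set w \<subseteq> \<Lambda>" for w
      using im[OF vp[OF that]] hd_loop_path[OF that] by simp
    have SU: "S a \<subseteq> U a" if "a \<in> verts G" for a using S(1) J_subset_U that by blast
    have "vpath_map (?P (i # u1)) ` S v \<subseteq> vpath_map (i @ [v]) ` S v"
      unfolding loop_path_Cons(2)[OF u(5,7)] using F[OF u(7)] by auto
    moreover have "vpath_map (?P (j # u2)) ` S v \<subseteq> vpath_map (j @ [v]) ` S v"
      unfolding loop_path_Cons(2)[OF u(6,8)] using F[OF u(8)] by auto
    moreover have "vpath_map (i @ [v]) ` S v \<inter> vpath_map (j @ [v]) ` S v = {}"
      by (rule loop_images_disjoint[OF u(5,6,3) SU S(2) dis])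
    ultimately have d: "vpath_map (?P (i # u1)) ` S v \<inter> vpath_map (?P (j # u2)) ` S v = {}" by blast
    have s1: "set (i # u1) \<subseteq> \<Lambda>" "set (j # u2) \<subseteq> \<Lambda>" using u by auto
    have inj: "inj_on (vpath_map (?P c)) (S v)"
      using vpath_map_inj[OF vp[OF u(4)]] SU[OF v] by (auto intro: inj_on_subset)
    have "vpath_map (?P c) ` (vpath_map (?P (i # u1)) ` S v) \<inter> vpath_map (?P c) ` (vpath_map (?P (j # u2)) ` S v) = {}"
      using inj_on_image_Int[OF inj F[OF s1(1)] F[OF s1(2)]] d by simp
    then show ?thesis unfolding u(1,2) app(1)[OF u(4) s1(1)] app(1)[OF u(4) s1(2)] by (simp add: image_comp)
  qed
  have prefix_split: "\<exists>w'. w = u @ w' \<and> set w' \<subseteq> \<Lambda>" if "prefix u w" "set w \<subseteq> \<Lambda>" for u w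
    using that by (auto simp: prefix_def)
  have p_sum: "sum p \<Lambda> = 1" unfolding p_def using sum_m by (simp add: sum_divide_distrib[symmetric])
  have p_nonneg: "0 \<le> p y" if "y \<in> \<Lambda>" for y unfolding p_def using sum_m by simp
  note tree = hausdorff_measure_nonzero_of_tree[OF s compact_attractor fin,
      where p = p and N = N and x = x and r = r]
  from sep show ?thesis
  proof
    assume ssc: "strong_separation G J T"
    have disjoint_pieces: "vpath_map (i @ [v]) ` ?K \<inter> vpath_map (j @ [v]) ` ?K = {}" if "i \<in> \<Lambda>" "j \<in> \<Lambda>" "i \<noteq> j" for i j
    proof -
      have "vpath_map (i @ [v]) ` vertex_limit v \<inter> vpath_map (j @ [v]) ` vertex_limit v = {}"
      proof (rule loop_images_disjoint[OF that])
        show "vertex_limit u \<subseteq> U u" if "u \<in> verts G" for u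
          using vertex_limit_subset J_subset_U[OF that] by blast
      qed (use tr_vertex_limit strong_separation_tr[OF ssc] in blast)+
      then show ?thesis using attractor_vertex_limit by blast
    qed
    have cpt: "compact (vpath_map (i @ [v]) ` ?K)" if "i \<in> \<Lambda>" for i
      using compact_loop_image[OF that compact_attractor KJ] .
    have "\<exists>d>0. \<forall>a\<in>vpath_map (i @ [v]) ` ?K. \<forall>b\<in>vpath_map (j @ [v]) ` ?K. d \<le> dist a b" if "i \<in> \<Lambda>" "j \<in> \<Lambda>" "i \<noteq> j" for i j
      using separate_compact_closed[OF cpt[OF that(1)] compact_imp_closed[OF cpt[OF that(2)]] disjoint_pieces[OF that]] by blast
    then obtain d where d: "\<And>i j. i \<in> \<Lambda> \<Longrightarrow> j \<in> \<Lambda> \<Longrightarrow> i \<noteq> j \<Longrightarrow> 0 < d i j \<and>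
        (\<forall>a\<in>vpath_map (i @ [v]) ` ?K. \<forall>b\<in>vpath_map (j @ [v]) ` ?K. d i j \<le> dist a b)"
      by metis
    \<comment> \<open>Including \<open>\<delta>\<close> keeps the balls of radius \<open>\<epsilon>\<close> inside the domain of the maps.\<close>
    define D where "D = insert \<delta> ((\<lambda>(i, j). d i j) ` {(i, j) \<in> \<Lambda> \<times> \<Lambda>. i \<noteq> j})"
    have finD: "finite D" unfolding D_def using fin by (auto intro: finite_subset[of _ "\<Lambda> \<times> \<Lambda>"])
    define \<epsilon> where "\<epsilon> = Min D"
    have "\<forall>e\<in>D. 0 < e" unfolding D_def using d \<delta>_pos by auto
    then have \<epsilon>: "0 < \<epsilon>" unfolding \<epsilon>_def using finD by (subst Min_gr_iff) (auto simp: D_def)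
    have \<epsilon>_le: "\<epsilon> \<le> \<delta>" "\<And>i j. i \<in> \<Lambda> \<Longrightarrow> j \<in> \<Lambda> \<Longrightarrow> i \<noteq> j \<Longrightarrow> \<epsilon> \<le> d i j"
      unfolding \<epsilon>_def using finD by (auto intro!: Min_le simp: D_def)
    define a where "a = \<epsilon> / (2 * L * B)"
    have a: "0 < a" unfolding a_def using \<epsilon> L_ge_1 B_ge_1 by simp
    show ?thesis
    proof (rule tree[where Y = "\<lambda>u w. x w" and a = a and b = a])
      fix \<rho> :: real and u w u' w'
      assume \<rho>: "0 < \<rho>" "\<rho> \<le> 1" and u: "u \<in> stopped \<Lambda> N \<rho>" "u' \<in> stopped \<Lambda> N \<rho>" "u \<noteq> u'"
        and w: "set w \<subseteq> \<Lambda>" "set w' \<subseteq> \<Lambda>" "prefix u w" "prefix u' w'"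
      obtain c i u1 j u2 where c: "i \<noteq> j" "u = c @ i # u1" "u' = c @ j # u2" "\<rho> \<le> N c" "set c \<subseteq> \<Lambda>" "i \<in> \<Lambda>" "j \<in> \<Lambda>"
        "set u1 \<subseteq> \<Lambda>" "set u2 \<subseteq> \<Lambda>" using antichain[OF u] by blast
      obtain t where t: "w = c @ i # t" "set t \<subseteq> \<Lambda>" using prefix_split[OF w(3,1)] c by auto
      obtain t' where t': "w' = c @ j # t'" "set t' \<subseteq> \<Lambda>" using prefix_split[OF w(4,2)] c by auto
      let ?z = "x (i # t)" and ?z' = "x (j # t')"
      have st: "set (i # t) \<subseteq> \<Lambda>" "set (j # t') \<subseteq> \<Lambda>" using t t' c by auto
      have z: "?z \<in> vpath_map (i @ [v]) ` ?K" "?z' \<in> vpath_map (j @ [v]) ` ?K"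
        using x_app[of "[i]" t] x_app[of "[j]" t'] xK[OF t(2)] xK[OF t'(2)] t(2) t'(2) c(6,7) by (auto simp: loop_path_single)
      have zJ: "?z \<in> J v" "?z' \<in> J v" using xK st KJ by auto
      have "\<epsilon> \<le> dist ?z ?z'" using d[OF c(6,7,1)] z \<epsilon>_le(2)[OF c(6,7,1)] by (meson order_trans)
      then have "?z' \<notin> ball ?z \<epsilon>" by simp
      moreover have "ball ?z \<epsilon> \<subseteq> U v" using ball_subset_U[OF v zJ(1)] \<epsilon>_le(1) by (meson order_trans subset_ball)
      moreover have "inj_on (vpath_map (?P c)) (U v)" using vpath_map_inj[OF vp[OF c(5)]] by simp
      ultimately have "vpath_map (?P c) ?z' \<notin> vpath_map (?P c) ` ball ?z \<epsilon>"
        using J_subset_U[OF v] zJ(2) by (auto dest: inj_onD)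
      moreover have "ball (vpath_map (?P c) ?z) (vpath_norm (?P c) ?z / B * \<epsilon>) \<subseteq> vpath_map (?P c) ` ball ?z \<epsilon>"
        using ball_subset_vpath_map_image[OF vp[OF c(5)], of ?z \<epsilon>] zJ \<epsilon> \<epsilon>_le(1) by simp
      ultimately have dist: "vpath_norm (?P c) ?z / B * \<epsilon> \<le> dist (x w) (x w')"
        unfolding t(1) t'(1) x_app[OF c(5) st(1)] x_app[OF c(5) st(2)] by (meson mem_ball not_le subsetD)
      have "\<rho> \<le> L * vpath_norm (?P c) ?z" using comp[OF c(5) x0 zJ(1)] c(4) by (simp add: N_def)
      then have "\<rho> * (\<epsilon> / (L * B)) \<le> (L * vpath_norm (?P c) ?z) * (\<epsilon> / (L * B))"
        using \<epsilon> L_ge_1 B_ge_1 by (intro mult_right_mono) auto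
      also have "\<dots> = vpath_norm (?P c) ?z / B * \<epsilon>" using L_ge_1 by simp
      finally have "2 * (a * \<rho>) \<le> dist (x w) (x w')" using dist by (simp add: a_def mult.commute)
      then show "ball (x w) (a * \<rho>) \<inter> ball (x w') (a * \<rho>) = {}" by (intro disjoint_ballI) linarith
    qed (use a p_nonneg p_sum xK p_weight N_pos r N_le in auto)
  next
    assume osc: "open_set_condition G J T"
    have "interior (J v) \<noteq> {}" using J_regular[OF v] J_nonempty[OF v] by auto
    then obtain y0 e where y0: "0 < e" "ball y0 e \<subseteq> interior (J v)"
      by (meson ex_in_conv open_contains_ball open_interior)
    define \<epsilon> where "\<epsilon> = min e \<delta>"
    have \<epsilon>: "0 < \<epsilon>" "\<epsilon> \<le> \<delta>" "ball y0 \<epsilon> \<subseteq> interior (J v)" using y0 \<delta>_pos by (auto simp: \<epsilon>_def)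
    have y0J: "y0 \<in> J v" using \<epsilon> interior_subset by (meson centre_in_ball subsetD)
    have Mpos: "0 < M" using diameter_J_pos[OF v] M[OF v] by simp
    define a where "a = \<kappa> * \<epsilon> / (L * B)"
    define b where "b = L * L * M + a"
    have a: "0 < a" unfolding a_def using \<epsilon> L_ge_1 B_ge_1 \<kappa> by simp
    have b: "0 \<le> b" unfolding b_def using a L_ge_1 Mpos by simp
    have image: "ball (vpath_map (?P u) y0) (a * \<rho>) \<subseteq> vpath_map (?P u) ` interior (J v)"
      if u: "u \<in> stopped \<Lambda> N \<rho>" and \<rho>: "0 < \<rho>" "\<rho> \<le> 1" for u \<rho>
    proof -
      have su: "set u \<subseteq> \<Lambda>" using u by (simp add: stopped_def)
      have "\<kappa> * \<rho> \<le> L * vpath_norm (?P u) y0"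
        using stopped_lower[OF u \<rho>] comp[OF su x0 y0J] by (simp add: N_def)
      then have "\<kappa> * \<rho> * (\<epsilon> / (L * B)) \<le> (L * vpath_norm (?P u) y0) * (\<epsilon> / (L * B))"
        using \<epsilon> L_ge_1 B_ge_1 by (intro mult_right_mono) auto
      also have "\<dots> = vpath_norm (?P u) y0 / B * \<epsilon>" using L_ge_1 by simp
      finally have "a * \<rho> \<le> vpath_norm (?P u) y0 / B * \<epsilon>" by (simp add: a_def mult_ac)
      then have "ball (vpath_map (?P u) y0) (a * \<rho>) \<subseteq> ball (vpath_map (?P u) y0) (vpath_norm (?P u) y0 / B * \<epsilon>)"
        by (rule subset_ball)
      also have "\<dots> \<subseteq> vpath_map (?P u) ` ball y0 \<epsilon>"
        using ball_subset_vpath_map_image[OF vp[OF su], of y0 \<epsilon>] y0J \<epsilon> by simp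
      also have "\<dots> \<subseteq> vpath_map (?P u) ` interior (J v)" using \<epsilon>(3) by (rule image_mono)
      finally show ?thesis .
    qed
    show ?thesis
    proof (rule tree[where Y = "\<lambda>u w. vpath_map (?P u) y0" and a = a and b = b])
      fix \<rho> :: real and u w
      assume \<rho>: "0 < \<rho>" "\<rho> \<le> 1" and u: "u \<in> stopped \<Lambda> N \<rho>" and w: "set w \<subseteq> \<Lambda>" "prefix u w"
      have su: "set u \<subseteq> \<Lambda>" "N u < \<rho>" using u by (auto simp: stopped_def)
      obtain t where t: "w = u @ t" "set t \<subseteq> \<Lambda>" using prefix_split[OF w(2,1)] by blast
      have xt: "x t \<in> J v" using xK[OF t(2)] KJ by blast
      have "dist (vpath_map (?P u) y0) (x w) \<le> L * vpath_norm (?P u) y0 * diameter (J v)"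
        unfolding t(1) x_app[OF su(1) t(2)] using vpath_map_Lipschitz[OF vp[OF su(1)], of y0 "x t"] y0J xt by simp
      also have "\<dots> \<le> L * (L * N u) * M"
        using comp[OF su(1) y0J x0] M[OF v] diameter_J_pos[OF v] L_ge_1 pos[OF su(1) y0J] N_pos[OF su(1)]
        by (intro mult_mono mult_nonneg_nonneg) (auto simp: N_def)
      also have "\<dots> \<le> L * (L * \<rho>) * M"
        using su(2) L_ge_1 Mpos \<rho>(1) by (intro mult_mono mult_nonneg_nonneg) (auto simp: less_imp_le N_pos[OF su(1)])
      finally have "dist (x w) (vpath_map (?P u) y0) \<le> L * L * M * \<rho>" by (simp add: mult_ac dist_commute)
      then show "ball (vpath_map (?P u) y0) (a * \<rho>) \<subseteq> ball (x w) (b * \<rho>)"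
        using dist_triangle[of "x w" _ "vpath_map (?P u) y0"]
        by (intro subsetI) (simp add: b_def distrib_right, meson add_le_less_mono order_le_less_trans)
    next
      fix \<rho> :: real and u w u' w'
      assume \<rho>: "0 < \<rho>" "\<rho> \<le> 1" and u: "u \<in> stopped \<Lambda> N \<rho>" "u' \<in> stopped \<Lambda> N \<rho>" "u \<noteq> u'"
      obtain c i u1 j u2 where c: "i \<noteq> j" "u = c @ i # u1" "u' = c @ j # u2" "\<rho> \<le> N c" "set c \<subseteq> \<Lambda>" "i \<in> \<Lambda>" "j \<in> \<Lambda>"
        "set u1 \<subseteq> \<Lambda>" "set u2 \<subseteq> \<Lambda>" using antichain[OF u] by blast
      have "vpath_map (?P u) ` interior (J v) \<inter> vpath_map (?P u') ` interior (J v) = {}"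
        by (rule disjoint_images[OF interior_subset tr_interior_J open_set_condition_tr[OF osc] c(2,3,1,5,6,7,8,9)])
      then show "ball (vpath_map (?P u) y0) (a * \<rho>) \<inter> ball (vpath_map (?P u') y0) (a * \<rho>) = {}"
        using image[OF u(1) \<rho>] image[OF u(2) \<rho>] by blast
    qed (use a b p_nonneg p_sum xK p_weight N_pos r N_le in auto)
  qed
qed

end

section \<open>The dimension formula\<close>

context conformal_simple_gifs begin

lemma vpath_rtrancl: "vpath p \<Longrightarrow> (hd p, last p) \<in> E\<^sup>*"
  by (induction p rule: vpath.induct) (auto intro: converse_rtrancl_into_rtrancl)

text \<open>
  Without a closed path through \<open>v\<close> the empty loop is the only one, so the loop sums of positive
  length vanish.
\<close>

lemma nondecaying_vertex_on_cycle:
  assumes "\<not> decays_exponentially (loop_sum s v)"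
  shows "(v, v) \<in> E\<^sup>+"
proof (rule ccontr)
  assume no: "(v, v) \<notin> E\<^sup>+"
  have "loops v n = {}" if n: "0 < n" for n
  proof (rule ccontr)
    assume "loops v n \<noteq> {}"
    then obtain y where y: "length y = n" "hd y = v" "cylinder G (y @ [v]) \<noteq> {}" "y \<noteq> []"
      using n by (auto simp: loops_def)
    then have p: "vpath (y @ [v])" using cylinder_vpath[of _ "y @ [v]"] by blast
    obtain q where q: "y = v # q" using y by (cases y) auto
    obtain b q' where b: "q @ [v] = b # q'" by (cases "q @ [v]") auto
    have p': "vpath (v # b # q')" using p q b by simp
    have "last (b # q') = v" using b by (metis last_snoc)
    then have "(b, v) \<in> E\<^sup>*" using vpath_rtrancl[of "b # q'"] p' by auto
    moreover have "(v, b) \<in> E" using p' by simp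
    ultimately show False using no by (meson rtrancl_into_trancl2)
  qed
  then have "loop_sum s v n \<le> ennreal (1 * (1/2) ^ n)" for n
  proof (cases "n = 0")
    case True
    have "loop_sum s v 0 \<le> 1" unfolding loop_sum_def
    proof (rule infsum_ennreal_leI)
      fix F assume "finite F" "F \<subseteq> loops v 0"
      then have "sum (loop_weight s v) F \<le> sum (loop_weight s v) {[]}" by (intro sum_mono2) (auto simp: loops_def)
      also have "\<dots> \<le> 1" by (auto simp: loop_weight_def orbit_norm_def intro!: SUP_least)
      finally show "sum (loop_weight s v) F \<le> 1" .
    qed
    then show ?thesis using True by simp
  qed (simp add: loop_sum_def)
  then have "decays_exponentially (loop_sum s v)" unfolding decays_exponentially_def by (intro exI[of _ 1] exI[of _ "1/2"]) auto
  then show False using assms by simp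
qed

text \<open>
  For every \<open>t < s\<close> a finite loop system at \<open>v\<close> has an attractor of positive \<open>t\<close>-dimensional
  measure. All its loops, hence the codes of its points, stay inside \<open>H\<close>. For \<open>t = 0\<close> it is enough
  that the attractor is nonempty.
\<close>

lemma hausdorff_dim_component_ge:
  assumes v: "v \<in> verts G" and nd: "\<not> decays_exponentially (loop_sum s v)"
    and sep: "strong_separation G J T \<or> open_set_condition G J T"
    and H: "subgraph H G" and edges: "\<And>a b. (a, b) \<in> E \<Longrightarrow> (v, a) \<in> E\<^sup>* \<Longrightarrow> (b, v) \<in> E\<^sup>* \<Longrightarrow> (a, b) \<in> arcs_ends H"
  shows "ereal s \<le> hausdorff_dim (limit_set H J T)"
proof (rule hausdorff_dim_geI)
  fix t assume t: "0 \<le> t" "t < s"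
  obtain n \<Lambda> m where sys: "0 < n" "finite \<Lambda>" "\<Lambda> \<subseteq> loops v n"
    "\<And>y. y \<in> \<Lambda> \<Longrightarrow> 0 < m y \<and> (\<forall>x\<in>J v. m y \<le> vpath_norm (y @ [v]) x)" "1 \<le> (\<Sum>y\<in>\<Lambda>. m y powr t)"
    using ex_finite_loop_system[OF v t nd] by blast
  have "\<Lambda> \<noteq> {}" using sys(5) by auto
  then interpret loop_system G J U T \<delta> r M c1 \<beta> v n \<Lambda>
    using v sys by unfold_locales auto
  have loop_edges: "(a, b) \<in> arcs_ends H" if y: "y \<in> \<Lambda>" "y @ [v] = p @ a # b # q" for y p a b q
  proof -
    obtain y' where y': "y = v # y'" "vpath (y @ [v])" using loop_hd[OF y(1)] by metis
    have p: "vpath (p @ [a])" "vpath (a # b # q)" using y'(2) vpath_append[of p a "b # q"] y(2) by auto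
    have "hd (p @ [a]) = v" using arg_cong[OF y(2), of hd] y'(1) by (cases p) auto
    then have "(v, a) \<in> E\<^sup>*" using vpath_rtrancl[OF p(1)] by simp
    moreover have "last (b # q) = v" using arg_cong[OF y(2), of last] by simp
    then have "(b, v) \<in> E\<^sup>*" using vpath_rtrancl[of "b # q"] p(2) by simp
    ultimately show ?thesis using edges p(2) by simp
  qed
  have "attractor \<subseteq> limit_set H J T"
  proof
    fix x assume "x \<in> attractor"
    then have "\<exists>\<omega>\<in>path_space H. \<omega> 0 = v \<and> coding G J T \<omega> = x"
      by (rule attractor_coded[OF H, rotated]) (rule loop_edges)
    then obtain \<omega> where "\<omega> \<in> path_space H" "coding G J T \<omega> = x" by blast
    then show "x \<in> limit_set H J T" using subgraph_coding[OF H] by (auto simp: limit_set_def)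
  qed
  then have sub: "hausdorff_measure t attractor \<le> hausdorff_measure t (limit_set H J T)"
    and ne: "limit_set H J T \<noteq> {}" using attractor_nonempty hausdorff_measure_mono by auto
  show "hausdorff_measure t (limit_set H J T) \<noteq> 0"
  proof (cases "t = 0")
    case True
    then show ?thesis using hausdorff_measure_0_nonempty[OF ne] by simp
  next
    case False
    then have "hausdorff_measure t attractor \<noteq> 0"
      using t sys(4) by (intro hausdorff_measure_attractor_nonzero[OF _ _ sys(5) _ sep]) auto
    then show ?thesis using sub by auto
  qed
qed

end

theorem theorem3p9:
  fixes G :: "('v, 'e) pre_digraph"
    and J U :: "'v \<Rightarrow> (real ^ 'n) set"
    and T :: "'e \<Rightarrow> real ^ 'n \<Rightarrow> real ^ 'n"
  assumes "gifs G J U T"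
    and "nomulti_digraph G"
    and "conformal_system G U T"
    and "bounded_distortion G U T"
    and "V_summable G J T"
    and "contractible_seeds G J T"
    and "strong_separation G J T \<or> open_set_condition G J T"
  shows "(\<forall>s\<ge>0. hausdorff_dim (limit_set G J T) = ereal s \<longleftrightarrow>
                 has_pressure G (\<lambda>\<omega>. s * phi_V G J T \<omega>) 0) \<and>
         (\<exists>G0\<in>strong_components G.
            hausdorff_dim (limit_set G J T) = hausdorff_dim (limit_set G0 J T)) \<and>
         (\<forall>G0\<in>strong_components G.
            hausdorff_dim (limit_set G0 J T) \<le> hausdorff_dim (limit_set G J T))"
proof -
  interpret gifs G J U T by (rule assms(1))
  interpret nomulti_digraph G by (rule assms(2))
  obtain \<delta> where \<delta>: "0 < \<delta>" "\<forall>v\<in>verts G. \<delta> \<le> setdist (J v) (- U v)" using J_in_U by blast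
  obtain r where r: "0 < r" "r < 1" "\<forall>e\<in>arcs G. \<forall>x\<in>U (head G e). dnorm (T e) x \<le> r" using T_contracting by blast
  obtain M where M: "\<forall>v\<in>verts G. diameter (J v) \<le> M" using J_diameter by (auto simp: bdd_above_def)
  obtain c1 \<beta> where c1: "0 < c1" "0 < \<beta>" "\<forall>e\<in>arcs G. \<forall>x\<in>U (head G e). \<forall>y\<in>U (head G e).
      \<bar>dnorm (T e) x - dnorm (T e) y\<bar> \<le> c1 * dnorm (T e) x * norm (x - y) powr \<beta>"
    using assms(4) unfolding bounded_distortion_def by blast
  interpret conformal_simple_gifs G J U T \<delta> r M c1 \<beta>
    by unfold_locales (use assms(3,6) \<delta> r M c1 in auto)
  obtain s0 where s0: "s0 \<in> lower_I_V G J T" "has_pressure G (\<lambda>\<omega>. s0 * lower_phi_V G J T \<omega>) 0"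
    using assms(5) by (auto simp: V_summable_def)
  have s0_nonneg: "0 \<le> s0" and summable: "infsum (vertex_weight s0) (verts G) < \<infinity>"
    using s0(1) unfolding lower_I_V_def vertex_weight_def[abs_def] by blast+
  have P: "has_pressure G (\<lambda>\<omega>. s0 * phi_V G J T \<omega>) 0"
    using s0(2) unfolding has_pressure_def partition_sum_lower_eq_Z partition_sum_eq_Z .
  obtain v where v: "v \<in> verts G" "\<not> decays_exponentially (loop_sum s0 v)"
    using ex_nondecaying_loop_vertex[OF s0_nonneg summable P] by blast
  obtain H where H: "H \<in> strong_components G" "subgraph H G"
    "\<And>a b. (a, b) \<in> E \<Longrightarrow> (v, a) \<in> E\<^sup>* \<Longrightarrow> (b, v) \<in> E\<^sup>* \<Longrightarrow> (a, b) \<in> arcs_ends H"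
    using ex_strong_component[OF wf_digraph_axioms nondecaying_vertex_on_cycle[OF v(2)]] by blast
  have comp: "hausdorff_dim (limit_set G0 J T) \<le> hausdorff_dim (limit_set G J T)" if "G0 \<in> strong_components G" for G0
    using that subgraph_limit_set by (intro hausdorff_dim_mono) (auto simp: strong_components_def max_subgraph_def)
  have ge: "ereal s0 \<le> hausdorff_dim (limit_set H J T)"
    by (rule hausdorff_dim_component_ge[OF v assms(7) H(2,3)])
  have le: "hausdorff_dim (limit_set G J T) \<le> ereal s0"
    by (rule hausdorff_dim_limit_set_le[OF s0_nonneg P])
  have dim_G: "hausdorff_dim (limit_set G J T) = ereal s0"
    by (rule antisym[OF le order_trans[OF ge comp[OF H(1)]]])
  have dim_H: "hausdorff_dim (limit_set H J T) = ereal s0"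
    by (rule antisym[OF order_trans[OF comp[OF H(1)] le] ge])
  have "hausdorff_dim (limit_set G J T) = ereal s \<longleftrightarrow> has_pressure G (\<lambda>\<omega>. s * phi_V G J T \<omega>) 0" for s
    using P pressure_zero_unique[OF P, of s] unfolding dim_G ereal.inject by metis
  moreover have "\<exists>G0\<in>strong_components G. hausdorff_dim (limit_set G J T) = hausdorff_dim (limit_set G0 J T)"
    using H(1) dim_G dim_H by (intro bexI[of _ H]) simp_all
  ultimately show ?thesis using comp by (intro conjI allI impI ballI) simp_all
qed

end
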